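(* Let $F$ be an exponential functor with $\deg(F(t_1))>0$. Then $H^k_{\pi_1(\mathbb T^2)}(\mathfrak t;\mathcal R_{\mathbb Q})=0$ for $k\ne2$ and $$H^2_{\pi_1(\mathbb T^2)}(\mathfrak t;\mathcal R_{\mathbb Q})\cong R_F(\mathbb T^2)\otimes\mathbb Q/(F(t_2)-F(t_1),F(t_3)-F(t_2)).$$ Moreover, the Weyl group $W=S_3$ acts on $H^2_{\pi_1(\mathbb T^2)}(\mathfrak t;\mathcal R_{\mathbb Q})$ by signed permutations, i.e. under this isomorphism $w\in W$ acts by $[p]\mapsto\mathrm{sgn}(w)[w(p)]$, where $w(p)$ permutes the variables $t_1,t_2,t_3$.
   Context: An exponential functor is a functor $F$ on finite-dimensional complex inner product spaces and unitary isomorphisms, preserving adjoints, with natural unitary isomorphisms $F(V\oplus W)\cong F(V)\otimes F(W)$, $F(0)\cong\mathbb C$, associative and unital. $\mathbb T^2\subset SU(3)$ is the diagonal maximal torus, $R(\mathbb T^2)\cong\mathbb Z[t_i^{\pm1}]/(t_1t_2t_3-1)$ with $t_i$ the $i$-th diagonal entry, $F(t_i)$ the character of $F(\mathbb C)$ with $\mathbb T^2$ acting via $t_i$, $\deg(F(t_1))$ the highest power of $t_1$ in it, and $R_F(\mathbb T^2)=R(\mathbb T^2)[(F(t_1)F(t_2)F(t_3))^{-1}]$. $\mathfrak t=\{h\in\mathbb R^3:h_1+h_2+h_3=0\}$ and $\pi_1(\mathbb T^2)=\Lambda=\{k\in\mathbb Z^3:k_1+k_2+k_3=0\}$ acts on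 $\mathfrak t$ by translation and on $R_F(\mathbb T^2)\otimes\mathbb Q$ by multiplication with $F(t_1)^{k_1}F(t_2)^{k_2}F(t_3)^{k_3}$. The equivariant cohomology $H^*_{\Lambda}(\mathfrak t;\mathcal R_{\mathbb Q})$ is the cohomology of the cochain complex $\mathrm{Hom}_{\mathbb Q[\Lambda]}(C_*(\mathfrak t)\otimes\mathbb Q,R_F(\mathbb T^2)\otimes\mathbb Q)$, with $C_*(\mathfrak t)$ the cellular chain complex of $\mathfrak t$ as a $\Lambda$-CW-complex. $W=S_3$ acts on $\mathfrak t$, $\Lambda$ and $R_F(\mathbb T^2)$ by permuting coordinates/variables, and on cochains by $(w\cdot\phi)(c)=w\phi(w^{-1}c)$, inducing an action on cohomology. *)

theory Defs
  imports "Jordan_Normal_Form.Matrix" "HOL-Computational_Algebra.Fraction_Field"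
    "HOL-Computational_Algebra.Polynomial" "HOL-Combinatorics.Permutations"
begin

section \<open>Exponential functors (skeletal model: V = C^n, morphisms = unitary matrices)\<close>

definition adj :: "complex mat \<Rightarrow> complex mat" where
  "adj A = mat (dim_col A) (dim_row A) (\<lambda>(i,j). cnj (A $$ (j,i)))"

definition unitary_mat :: "nat \<Rightarrow> complex mat \<Rightarrow> bool" where
  "unitary_mat n U \<longleftrightarrow> U \<in> carrier_mat n n \<and> U * adj U = 1\<^sub>m n \<and> adj U * U = 1\<^sub>m n"

definition kron :: "complex mat \<Rightarrow> complex mat \<Rightarrow> complex mat" where
  "kron A B = mat (dim_row A * dim_row B) (dim_col A * dim_col B)
     (\<lambda>(i,j). A $$ (i div dim_row B, j div dim_col B) * B $$ (i mod dim_row B, j mod dim_col B))"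

definition dsum :: "complex mat \<Rightarrow> complex mat \<Rightarrow> complex mat" where
  "dsum A B = four_block_mat A (0\<^sub>m (dim_row A) (dim_col B)) (0\<^sub>m (dim_row B) (dim_col A)) B"

definition mtrace :: "complex mat \<Rightarrow> complex" where
  "mtrace A = (\<Sum>i<dim_row A. A $$ (i,i))"

text \<open>F(C^n) = C^(d n); F on unitaries given by Fm; tau n m : F(C^n (+) C^m) -> F(C^n) (x) F(C^m).\<close>
definition exponential_functor ::
  "(nat \<Rightarrow> nat) \<Rightarrow> (complex mat \<Rightarrow> complex mat) \<Rightarrow> (nat \<Rightarrow> nat \<Rightarrow> complex mat) \<Rightarrow> bool" where
  "exponential_functor d Fm tau \<longleftrightarrow>
     (\<forall>n U. unitary_mat n U \<longrightarrow> unitary_mat (d n) (Fm U)) \<and>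
     (\<forall>n. Fm (1\<^sub>m n) = 1\<^sub>m (d n)) \<and>
     (\<forall>n U V. unitary_mat n U \<longrightarrow> unitary_mat n V \<longrightarrow> Fm (U * V) = Fm U * Fm V) \<and>
     (\<forall>n U. unitary_mat n U \<longrightarrow> Fm (adj U) = adj (Fm U)) \<and>
     (\<forall>n U. unitary_mat n U \<longrightarrow> (\<forall>e>0. \<exists>\<delta>>0. \<forall>V. unitary_mat n V \<and>
          (\<forall>i<n. \<forall>j<n. cmod (V $$ (i,j) - U $$ (i,j)) < \<delta>) \<longrightarrow>
          (\<forall>i<d n. \<forall>j<d n. cmod (Fm V $$ (i,j) - Fm U $$ (i,j)) < e))) \<and>
     (\<forall>n m. d (n + m) = d n * d m \<and> unitary_mat (d (n + m)) (tau n m)) \<and>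
     (\<forall>n m U V. unitary_mat n U \<longrightarrow> unitary_mat m V \<longrightarrow>
          tau n m * Fm (dsum U V) = kron (Fm U) (Fm V) * tau n m) \<and>
     (\<forall>n m k. kron (tau n m) (1\<^sub>m (d k)) * tau (n + m) k = kron (1\<^sub>m (d n)) (tau m k) * tau n (m + k)) \<and>
     d 0 = 1 \<and>
     (\<exists>\<epsilon>. unitary_mat 1 \<epsilon> \<and> (\<forall>n. kron \<epsilon> (1\<^sub>m (d n)) * tau 0 n = 1\<^sub>m (d n) \<and>
                                    kron (1\<^sub>m (d n)) \<epsilon> * tau n 0 = 1\<^sub>m (d n)))"

text \<open>Character of F(C) as a U(1)-representation: multiplicity of weight k.\<close>
definition Fchar :: "(complex mat \<Rightarrow> complex mat) \<Rightarrow> int \<Rightarrow> nat" where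
  "Fchar Fm = (THE \<chi>. finite {k. \<chi> k \<noteq> 0} \<and> (\<forall>z. cmod z = 1 \<longrightarrow>
      mtrace (Fm (mat 1 1 (\<lambda>_. z))) = (\<Sum>k\<in>{k. \<chi> k \<noteq> 0}. of_nat (\<chi> k) * z powi k)))"

definition lpdeg :: "(int \<Rightarrow> nat) \<Rightarrow> int" where
  "lpdeg \<chi> = (if {k. \<chi> k \<noteq> 0} = {} then 0 else Max {k. \<chi> k \<noteq> 0})"

section \<open>R(T^2) (x) Q inside Q(t1,t2), with t3 = (t1 t2)^-1\<close>

type_synonym rf = "rat poly poly fract"

definition tv :: "nat \<Rightarrow> rf" where
  "tv i = (if i = 1 then Fract [:[:0,1:]:] 1 else if i = 2 then Fract [:0,1:] 1
           else inverse (Fract [:[:0,1:]:] 1 * Fract [:0,1:] 1))"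

definition scal :: "rat \<Rightarrow> rf" where "scal c = Fract [:[:c:]:] 1"

definition lmon :: "(nat \<Rightarrow> int) \<Rightarrow> rf" where
  "lmon e = tv 1 powi e 1 * tv 2 powi e 2 * tv 3 powi e 3"

definition RQ :: "rf set" where
  "RQ = {\<Sum>e\<in>S. scal (c e) * lmon e | S c. finite S}"

definition Fval :: "(int \<Rightarrow> nat) \<Rightarrow> nat \<Rightarrow> rf" where
  "Fval \<chi> i = (\<Sum>k\<in>{k. \<chi> k \<noteq> 0}. of_nat (\<chi> k) * tv i powi k)"

definition sF :: "(int \<Rightarrow> nat) \<Rightarrow> rf" where
  "sF \<chi> = Fval \<chi> 1 * Fval \<chi> 2 * Fval \<chi> 3"

definition RFQ :: "(int \<Rightarrow> nat) \<Rightarrow> rf set" where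
  "RFQ \<chi> = {r / sF \<chi> ^ n | r n. r \<in> RQ}"

text \<open>w acts by the substitution t_i |-> t_(w i).\<close>
definition wact :: "(nat \<Rightarrow> nat) \<Rightarrow> (int \<Rightarrow> nat) \<Rightarrow> rf \<Rightarrow> rf" where
  "wact w \<chi> p = (THE q. \<exists>S c n. finite S \<and>
      p = (\<Sum>e\<in>S. scal (c e) * lmon e) / sF \<chi> ^ n \<and>
      q = (\<Sum>e\<in>S. scal (c e) * lmon (e \<circ> inv_into UNIV w)) / sF \<chi> ^ n)"

definition Fideal :: "(int \<Rightarrow> nat) \<Rightarrow> rf set" where
  "Fideal \<chi> = {a * (Fval \<chi> 2 - Fval \<chi> 1) + b * (Fval \<chi> 3 - Fval \<chi> 2) | a b. a \<in> RFQ \<chi> \<and> b \<in> RFQ \<chi>}"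

section \<open>The alcove triangulation of t (coordinates scaled by 3)\<close>

type_synonym pt = "int \<times> int \<times> int"

definition cmp :: "pt \<Rightarrow> nat \<Rightarrow> int" where
  "cmp x i = (if i = 1 then fst x else if i = 2 then fst (snd x) else snd (snd x))"

definition mkpt :: "(nat \<Rightarrow> int) \<Rightarrow> pt" where "mkpt f = (f 1, f 2, f 3)"

text \<open>pi_1(T^2) = Lambda (unscaled integer vectors with sum 0)\<close>
definition Lambda :: "pt set" where
  "Lambda = {k. cmp k 1 + cmp k 2 + cmp k 3 = 0}"

text \<open>Vertices: 3 * (coweight lattice), i.e. points h in t with h_i - h_j integral.\<close>
definition alc_vertices :: "pt set" where
  "alc_vertices = {x. cmp x 1 + cmp x 2 + cmp x 3 = 0 \<and> (cmp x 1 - cmp x 2) mod 3 = 0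
                       \<and> (cmp x 2 - cmp x 3) mod 3 = 0}"

text \<open>Edge directions: +- 3 * (W-orbit of the fundamental coweight).\<close>
definition edge_dirs :: "pt set" where
  "edge_dirs = {mkpt (\<lambda>j. s * (3 * of_bool (j = i) - 1)) | i s. i \<in> {1,2,3} \<and> s \<in> {1, -1}}"

definition adjacent :: "pt \<Rightarrow> pt \<Rightarrow> bool" where
  "adjacent x y \<longleftrightarrow> mkpt (\<lambda>i. cmp y i - cmp x i) \<in> edge_dirs"

definition simplices :: "nat \<Rightarrow> pt list set" where
  "simplices k = {xs. length xs = Suc k \<and> set xs \<subseteq> alc_vertices \<and>
      (\<forall>i<length xs. \<forall>j<length xs. i \<noteq> j \<longrightarrow> adjacent (xs ! i) (xs ! j))}"

definition transl :: "pt \<Rightarrow> pt \<Rightarrow> pt" where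
  "transl l x = mkpt (\<lambda>i. cmp x i + 3 * cmp l i)"

definition wpt :: "(nat \<Rightarrow> nat) \<Rightarrow> pt \<Rightarrow> pt" where
  "wpt w x = mkpt (\<lambda>i. cmp x (inv_into UNIV w i))"

definition Fmon :: "(int \<Rightarrow> nat) \<Rightarrow> pt \<Rightarrow> rf" where
  "Fmon \<chi> l = Fval \<chi> 1 powi cmp l 1 * Fval \<chi> 2 powi cmp l 2 * Fval \<chi> 3 powi cmp l 3"

text \<open>Hom_{Q[Lambda]}(C_k(t) (x) Q, R_F (x) Q), cellular cochains as alternating functions
  on ordered simplices.\<close>
definition cochains :: "(int \<Rightarrow> nat) \<Rightarrow> nat \<Rightarrow> (pt list \<Rightarrow> rf) set" where
  "cochains \<chi> k = {\<phi>. (\<forall>xs. xs \<notin> simplices k \<longrightarrow> \<phi> xs = 0) \<and>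
      (\<forall>xs\<in>simplices k. \<phi> xs \<in> RFQ \<chi>) \<and>
      (\<forall>xs\<in>simplices k. \<forall>\<pi>. \<pi> permutes {..<Suc k} \<longrightarrow>
          \<phi> (permute_list \<pi> xs) = of_int (sign \<pi>) * \<phi> xs) \<and>
      (\<forall>xs\<in>simplices k. \<forall>l\<in>Lambda. \<phi> (map (transl l) xs) = Fmon \<chi> l * \<phi> xs)}"

definition cobd :: "nat \<Rightarrow> (pt list \<Rightarrow> rf) \<Rightarrow> pt list \<Rightarrow> rf" where
  "cobd k \<phi> xs = (if xs \<in> simplices (Suc k)
      then (\<Sum>i\<le>Suc k. (-1) ^ i * \<phi> (take i xs @ drop (Suc i) xs)) else 0)"

definition cocycles :: "(int \<Rightarrow> nat) \<Rightarrow> nat \<Rightarrow> (pt list \<Rightarrow> rf) set" where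
  "cocycles \<chi> k = {\<phi> \<in> cochains \<chi> k. cobd k \<phi> = (\<lambda>_. 0)}"

definition coboundaries :: "(int \<Rightarrow> nat) \<Rightarrow> nat \<Rightarrow> (pt list \<Rightarrow> rf) set" where
  "coboundaries \<chi> k = (if k = 0 then {\<lambda>_. 0} else cobd (k - 1) ` cochains \<chi> (k - 1))"

definition wcoch :: "(nat \<Rightarrow> nat) \<Rightarrow> (int \<Rightarrow> nat) \<Rightarrow> (pt list \<Rightarrow> rf) \<Rightarrow> pt list \<Rightarrow> rf" where
  "wcoch w \<chi> \<phi> xs = wact w \<chi> (\<phi> (map (wpt (inv_into UNIV w)) xs))"

end

theory Submission
  imports Defs "HOL-Combinatorics.Combinatorics" "Jordan_Normal_Form.Schur_Decomposition"
    "HOL-Computational_Algebra.Computational_Algebra"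
begin

text \<open>Write \<open>f\<close> for the Laurent polynomial \<open>F(t)\<close>. The trace of \<open>F(U)\<close> is a positive definite class function of
  the unitary matrix \<open>U\<close> and multiplicative on block sums, so on \<open>z\<close> times an \<open>l\<close>-cycle in \<open>U(N)\<close> it equals
  \<open>f(z)\<^sup>N\<^sup>-\<^sup>l\<close> times the product of \<open>f(z \<zeta>)\<close> over the \<open>l\<close>-th roots of unity \<open>\<zeta>\<close>. Positive definiteness on cycles with one
  common point, continued from the circle to positive real \<open>z\<close>, yields in the limit of large \<open>N\<close> a Hankel
  positivity for the power sums of subset products of the roots of \<open>f\<close>; interpolation then forces all
  nonzero roots to be negative reals. Hence \<open>F(t\<^sub>1) - F(t\<^sub>2)\<close> and \<open>F(t\<^sub>2) - F(t\<^sub>3)\<close> are coprime in the localised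
  ring of Laurent polynomials.

  In lattice coordinates \<open>(m, n)\<close> of the alcove vertices, an equivariant cochain is a function on
  \<open>{0} \<times> {0, 1, 2}\<close> for each translation type of simplices, since a step in the \<open>m\<close> direction can be traded for
  multiplication by \<open>u = F(t\<^sub>1) / F(t\<^sub>2)\<close> and three steps in the \<open>n\<close> direction for \<open>w = F(t\<^sub>2)\<^sup>2 / (F(t\<^sub>1) F(t\<^sub>3))\<close>.
  The complex then behaves like the Koszul complex of \<open>(u - 1, w - 1)\<close>, which generate the ideal of the
  theorem, and is exact below the top degree by coprimality. The isomorphism sums a 2-cochain over the
  upward triangles of a fundamental domain and subtracts the sum over the downward ones; reflections exchange
  the two kinds of triangles, which produces the sign.\<close>

text \<open>Coprimality rests on t_1 t_2 t_3 = 1. A common factor of F(t_1) - F(t_2) and F(t_2) -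
  F(t_3) has a zero whose t_1 is a root of F; then t_2 and t_3 are roots too, and three negative
  reals cannot have product 1. If no weight is negative, F may have no nonzero root, and the point
  t_1 = 0 together with the positive top weight takes over. The limit in N works by counting: with
  many blocks of points sharing one point, pairs from different blocks outnumber pairs from the same
  block, and only the former depend on i + i' alone. A nonreal subset product x enters the limit
  form as Q(x) times the conjugate of Q at the conjugate of x, which unlike a squared modulus can be
  made negative. The radius of the circle is chosen so that products omitting exactly one root are
  recognised by their modulus and hence carry a common sign. A separate obstacle is that the
  character is a definite description while F is only assumed continuous: integral weights are first
  found on roots of unity of order 2^m and then bounded uniformly in m.\<close>

section \<open>Adjoints, traces and Kronecker products\<close>

lemma adj_carrier [simp]: "A \<in> carrier_mat n m \<Longrightarrow> adj A \<in> carrier_mat m n"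
  by (auto simp: adj_def)

lemma adj_index [simp]: "A \<in> carrier_mat n m \<Longrightarrow> i < m \<Longrightarrow> j < n \<Longrightarrow> adj A $$ (i,j) = cnj (A $$ (j,i))"
  by (auto simp: adj_def)

lemma adj_mult:
  assumes "A \<in> carrier_mat n m" "B \<in> carrier_mat m k"
  shows "adj (A * B) = adj B * adj A"
  using assms by (intro eq_matI) (auto simp: adj_def scalar_prod_def mult.commute)

lemma adj_adj [simp]: "adj (adj A) = A"
  by (intro eq_matI) (auto simp: adj_def)

lemma unitary_carrier: "unitary_mat n U \<Longrightarrow> U \<in> carrier_mat n n"
  by (simp add: unitary_mat_def)

lemma unitary_adj: "unitary_mat n U \<Longrightarrow> unitary_mat n (adj U)"
  by (simp add: unitary_mat_def)

lemma unitary_mult: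
  assumes "unitary_mat n U" "unitary_mat n V"
  shows "unitary_mat n (U * V)"
proof -
  have c: "U \<in> carrier_mat n n" "V \<in> carrier_mat n n" "adj U \<in> carrier_mat n n" "adj V \<in> carrier_mat n n"
    using assms by (auto simp: unitary_mat_def)
  have c2: "adj V * adj U \<in> carrier_mat n n" "U * V \<in> carrier_mat n n" "adj V * adj U * U \<in> carrier_mat n n" "adj U * U \<in> carrier_mat n n"
    
    by (rule mult_carrier_mat[OF c(4,3)] mult_carrier_mat[OF c(1,2)] mult_carrier_mat[OF c(3,1)]
        mult_carrier_mat[OF mult_carrier_mat[OF c(4,3)] c(1)])+
  have "U * V * (adj V * adj U) = U * V * adj V * adj U"
    by (rule assoc_mult_mat[symmetric, of _ n n _ n _ n]) (use c c2 in blast)+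
  also have "U * V * adj V = U * (V * adj V)"
    by (rule assoc_mult_mat[of _ n n _ n _ n]) (use c c2 in blast)+
  finally have "U * V * (adj V * adj U) = U * (V * adj V) * adj U" .
  moreover have "adj V * adj U * (U * V) = adj V * adj U * U * V"
    by (rule assoc_mult_mat[symmetric, of _ n n _ n _ n]) (use c c2 in blast)+
  moreover have "adj V * adj U * U = adj V * (adj U * U)"
    by (rule assoc_mult_mat[of _ n n _ n _ n]) (use c c2 in blast)+
  ultimately show ?thesis
    using assms c unfolding unitary_mat_def by (simp add: adj_mult[of _ n n _ n])
qed

lemma mtrace_mult_comm:
  assumes "A \<in> carrier_mat n m" "B \<in> carrier_mat m n"
  shows "mtrace (A * B) = mtrace (B * A)"
proof -
  have "mtrace (A * B) = (\<Sum>i<n. \<Sum>j<m. A $$ (i,j) * B $$ (j,i))"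
    using assms by (simp add: mtrace_def scalar_prod_def lessThan_atLeast0)
  also have "\<dots> = (\<Sum>j<m. \<Sum>i<n. B $$ (j,i) * A $$ (i,j))"
    by (subst sum.swap) (simp add: mult.commute)
  also have "\<dots> = mtrace (B * A)"
    using assms by (simp add: mtrace_def scalar_prod_def lessThan_atLeast0)
  finally show ?thesis .
qed

lemma sum_lessThan_prod_divmod:
  fixes g :: "nat \<Rightarrow> nat \<Rightarrow> 'a::comm_monoid_add"
  shows "(\<Sum>i<n * m. g (i div m) (i mod m)) = (\<Sum>a<n. \<Sum>b<m. g a b)"
proof -
  have "(\<Sum>a<n. \<Sum>b<m. g a b) = (\<Sum>(a,b)\<in>{..<n} \<times> {..<m}. g a b)"
    by (simp add: sum.cartesian_product)
  also have "\<dots> = (\<Sum>i<n * m. g (i div m) (i mod m))"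
  proof (rule sum.reindex_bij_witness[of _ "\<lambda>i. (i div m, i mod m)" "\<lambda>(a,b). a * m + b"])
    fix p assume "p \<in> {..<n} \<times> {..<m}"
    then obtain a b where p: "p = (a,b)" "a < n" "b < m" by auto
    have "a * m + b < Suc a * m" using p by simp
    also have "\<dots> \<le> n * m" using p by (intro mult_le_mono) auto
    finally show "(case p of (a,b) \<Rightarrow> a * m + b) \<in> {..<n * m}" using p by simp
  next
    fix i assume "i \<in> {..<n * m}"
    then show "(i div m, i mod m) \<in> {..<n} \<times> {..<m}"
      using less_mult_imp_div_less[of i n m] by (cases "m = 0") auto
  qed auto
  finally show ?thesis by simp
qed

lemma mtrace_kron:
  assumes "A \<in> carrier_mat n n" "B \<in> carrier_mat m m"
  shows "mtrace (kron A B) = mtrace A * mtrace B"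
proof -
  have "mtrace (kron A B) = (\<Sum>i<n * m. A $$ (i div m, i div m) * B $$ (i mod m, i mod m))"
    using assms by (simp add: mtrace_def kron_def)
  also have "\<dots> = (\<Sum>a<n. \<Sum>b<m. A $$ (a,a) * B $$ (b,b))"
    by (rule sum_lessThan_prod_divmod)
  also have "\<dots> = mtrace A * mtrace B"
    using assms by (simp add: mtrace_def sum_product)
  finally show ?thesis .
qed

text \<open>The double sum is the squared Frobenius norm of the combination of the
  \<open>A i\<close> with coefficients \<open>c i\<close>; \<open>Z\<close> holds the entries of
  that combination.\<close>

lemma mtrace_gram_nonneg:
  fixes A :: "'i \<Rightarrow> complex mat"
  assumes "finite I" "\<And>i. i \<in> I \<Longrightarrow> A i \<in> carrier_mat n n"
  shows "0 \<le> Re (\<Sum>i\<in>I. \<Sum>j\<in>I. cnj (c i) * c j * mtrace (adj (A i) * A j))"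
    and "Im (\<Sum>i\<in>I. \<Sum>j\<in>I. cnj (c i) * c j * mtrace (adj (A i) * A j)) = 0"
proof -
  define Z where "Z a b = (\<Sum>i\<in>I. c i * A i $$ (a,b))" for a b
  have tr: "mtrace (adj (A i) * A j) = (\<Sum>b<n. \<Sum>a<n. cnj (A i $$ (a,b)) * A j $$ (a,b))"
    if "i \<in> I" "j \<in> I" for i j
    using assms(2)[OF that(1)] assms(2)[OF that(2)]
    by (simp add: mtrace_def scalar_prod_def lessThan_atLeast0 adj_def)
  have "(\<Sum>i\<in>I. \<Sum>j\<in>I. cnj (c i) * c j * mtrace (adj (A i) * A j))
     = (\<Sum>i\<in>I. \<Sum>j\<in>I. \<Sum>b<n. \<Sum>a<n. (cnj (c i) * cnj (A i $$ (a,b))) * (c j * A j $$ (a,b)))"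
    by (intro sum.cong refl) (simp add: tr sum_distrib_left mult_ac)
  also have "\<dots> = (\<Sum>b<n. \<Sum>a<n. \<Sum>i\<in>I. \<Sum>j\<in>I. (cnj (c i) * cnj (A i $$ (a,b))) * (c j * A j $$ (a,b)))"
  proof -
    have "(\<Sum>i\<in>I. \<Sum>j\<in>I. \<Sum>b<n. \<Sum>a<n. g i j a b) = (\<Sum>b<n. \<Sum>a<n. \<Sum>i\<in>I. \<Sum>j\<in>I. g i j a b)" for g :: "'i \<Rightarrow> 'i \<Rightarrow> nat \<Rightarrow> nat \<Rightarrow> complex"
    proof -
      have "(\<Sum>i\<in>I. \<Sum>j\<in>I. \<Sum>b<n. \<Sum>a<n. g i j a b) = (\<Sum>i\<in>I. \<Sum>b<n. \<Sum>j\<in>I. \<Sum>a<n. g i j a b)"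
        by (intro sum.cong refl sum.swap)
      also have "\<dots> = (\<Sum>b<n. \<Sum>i\<in>I. \<Sum>a<n. \<Sum>j\<in>I. g i j a b)"

      proof -
        have "(\<Sum>i\<in>I. \<Sum>b<n. \<Sum>j\<in>I. \<Sum>a<n. g i j a b) = (\<Sum>b<n. \<Sum>i\<in>I. \<Sum>j\<in>I. \<Sum>a<n. g i j a b)"
          by (rule sum.swap)
        also have "\<dots> = (\<Sum>b<n. \<Sum>i\<in>I. \<Sum>a<n. \<Sum>j\<in>I. g i j a b)"
          by (intro sum.cong refl sum.swap)
        finally show ?thesis .
      qed
      also have "\<dots> = (\<Sum>b<n. \<Sum>a<n. \<Sum>i\<in>I. \<Sum>j\<in>I. g i j a b)"
        by (intro sum.cong refl sum.swap)
      finally show ?thesis .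
    qed
    then show ?thesis .
  qed
  also have "\<dots> = (\<Sum>b<n. \<Sum>a<n. cnj (Z a b) * Z a b)"
    by (simp add: Z_def sum_product)
  also have "\<dots> = of_real (\<Sum>b<n. \<Sum>a<n. (cmod (Z a b))\<^sup>2)"
    unfolding of_real_sum complex_norm_square by (simp only: mult.commute)
  finally have eq: "(\<Sum>i\<in>I. \<Sum>j\<in>I. cnj (c i) * c j * mtrace (adj (A i) * A j))
     = of_real (\<Sum>b<n. \<Sum>a<n. (cmod (Z a b))\<^sup>2)" .
  show "0 \<le> Re (\<Sum>i\<in>I. \<Sum>j\<in>I. cnj (c i) * c j * mtrace (adj (A i) * A j))"
    unfolding eq Re_complex_of_real by (intro sum_nonneg) simp
  show "Im (\<Sum>i\<in>I. \<Sum>j\<in>I. cnj (c i) * c j * mtrace (adj (A i) * A j)) = 0"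
    unfolding eq by simp
qed

section \<open>Diagonal, permutation and Fourier matrices\<close>

definition scalm :: "complex \<Rightarrow> complex mat" where
  "scalm z = mat 1 1 (\<lambda>_. z)"

definition diagm :: "nat \<Rightarrow> (nat \<Rightarrow> complex) \<Rightarrow> complex mat" where
  "diagm n z = mat n n (\<lambda>(i,j). if i = j then z i else 0)"

definition permm :: "nat \<Rightarrow> complex \<Rightarrow> (nat \<Rightarrow> nat) \<Rightarrow> complex mat" where
  "permm n z \<sigma> = mat n n (\<lambda>(i,j). if i = \<sigma> j then z else 0)"

lemma carrier_simps [simp]:
  "scalm z \<in> carrier_mat 1 1" "diagm n w \<in> carrier_mat n n" "permm n z \<sigma> \<in> carrier_mat n n"
  by (auto simp: scalm_def diagm_def permm_def)

lemma diagm_mult: "diagm n a * diagm n b = diagm n (\<lambda>i. a i * b i)"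
proof (intro eq_matI)
  fix i j assume "i < dim_row (diagm n (\<lambda>i. a i * b i))" "j < dim_col (diagm n (\<lambda>i. a i * b i))"
  then have ij: "i < n" "j < n" by (auto simp: diagm_def)
  have "(diagm n a * diagm n b) $$ (i,j) = (\<Sum>k\<in>{0..<n}. (if i = k then a i else 0) * (if k = j then b k else 0))"
    using ij by (simp add: diagm_def scalar_prod_def)
  also have "\<dots> = (\<Sum>k\<in>{0..<n}. if k = i then (if i = j then a i * b i else 0) else 0)"
    by (intro sum.cong refl) auto
  also have "\<dots> = diagm n (\<lambda>i. a i * b i) $$ (i,j)" using ij by (simp add: diagm_def)
  finally show "(diagm n a * diagm n b) $$ (i,j) = diagm n (\<lambda>i. a i * b i) $$ (i,j)" .
qed (auto simp: diagm_def)

lemma adj_diagm: "adj (diagm n a) = diagm n (\<lambda>i. cnj (a i))"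
  by (intro eq_matI) (auto simp: diagm_def adj_def)

lemma diagm_one: "(\<And>i. i < n \<Longrightarrow> a i = 1) \<Longrightarrow> diagm n a = 1\<^sub>m n"
  by (intro eq_matI) (auto simp: diagm_def)

lemma cmod_one_cnj: "cmod z = 1 \<Longrightarrow> z * cnj z = 1" "cmod z = 1 \<Longrightarrow> cnj z * z = 1"
  using complex_norm_square[of z] by (simp_all add: mult.commute)

lemma unitary_diagm: "(\<And>i. i < n \<Longrightarrow> cmod (z i) = 1) \<Longrightarrow> unitary_mat n (diagm n z)"
  unfolding unitary_mat_def adj_diagm diagm_mult
  by (simp add: diagm_one cmod_one_cnj)

lemma scalm_diagm: "scalm z = diagm 1 (\<lambda>_. z)"
  by (intro eq_matI) (auto simp: scalm_def diagm_def)

lemma unitary_scalm: "cmod z = 1 \<Longrightarrow> unitary_mat 1 (scalm z)"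
  unfolding scalm_diagm by (rule unitary_diagm)

lemma diagm_Suc: "diagm (Suc n) z = dsum (diagm n z) (scalm (z n))"
  by (intro eq_matI) (auto simp: diagm_def dsum_def scalm_def less_Suc_eq)

lemma permm_mult:
  assumes "\<tau> permutes {..<n}"
  shows "permm n z \<sigma> * permm n w \<tau> = permm n (z * w) (\<sigma> \<circ> \<tau>)"
proof (intro eq_matI)
  fix i j assume "i < dim_row (permm n (z * w) (\<sigma> \<circ> \<tau>))" "j < dim_col (permm n (z * w) (\<sigma> \<circ> \<tau>))"
  then have ij: "i < n" "j < n" by (auto simp: permm_def)
  have "\<tau> j < n" using permutes_in_image[OF assms, of j] ij by simp
  show "(permm n z \<sigma> * permm n w \<tau>) $$ (i,j) = permm n (z * w) (\<sigma> \<circ> \<tau>) $$ (i,j)"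
  proof -
    have "(permm n z \<sigma> * permm n w \<tau>) $$ (i,j) = (\<Sum>k\<in>{0..<n}. (if i = \<sigma> k then z else 0) * (if k = \<tau> j then w else 0))"
      using ij by (simp add: permm_def scalar_prod_def)
    also have "\<dots> = (\<Sum>k\<in>{0..<n}. if k = \<tau> j then (if i = \<sigma> (\<tau> j) then z * w else 0) else 0)"
      by (intro sum.cong refl) auto
    finally show ?thesis using ij \<open>\<tau> j < n\<close> by (simp add: permm_def)
  qed
qed (auto simp: permm_def)

lemma adj_permm:
  assumes "\<sigma> permutes {..<n}"
  shows "adj (permm n z \<sigma>) = permm n (cnj z) (inv_into UNIV \<sigma>)"
proof -
  have "j = \<sigma> i \<longleftrightarrow> i = inv_into UNIV \<sigma> j" for i j
    using permutes_inv_eq[OF assms] by metis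
  then show ?thesis by (intro eq_matI) (auto simp: permm_def adj_def)
qed

lemma permm_id: "permm n 1 id = 1\<^sub>m n"
  by (intro eq_matI) (auto simp: permm_def)

lemma unitary_permm:
  assumes "\<sigma> permutes {..<n}" "cmod z = 1"
  shows "unitary_mat n (permm n z \<sigma>)"
proof -
  show ?thesis
    using permutes_inv[OF assms(1)] cmod_one_cnj[OF assms(2)] assms(1)
    by (simp add: unitary_mat_def adj_permm permm_mult permutes_inv_o permm_id)
qed

definition rou :: "nat \<Rightarrow> complex" where
  "rou l = cis (2 * pi / real l)"

lemma cmod_rou [simp]: "cmod (rou l) = 1" by (simp add: rou_def)

lemma rou_pow_self: "l > 0 \<Longrightarrow> rou l ^ l = 1"
  by (simp add: rou_def DeMoivre)

lemma rou_pow_eq_1: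
  assumes "l > 0" "\<bar>k\<bar> < int l" "rou l powi k = 1"
  shows "k = 0"
proof -
  have "cis (2 * pi / real l * of_int k) = 1"
    using assms(3) by (simp add: rou_def cis_power_int mult.commute)
  then have "cos (2 * pi / real l * of_int k) = 1" by (simp add: complex_eq_iff)
  then obtain m :: int where "2 * pi / real l * of_int k = of_int m * 2 * pi"
    using cos_one_2pi_int by blast
  then have "real_of_int k = of_int m * real l" using assms(1) by (simp add: field_simps)
  then have "real_of_int k = real_of_int (m * int l)" by simp
  then have k: "k = m * int l" by (simp only: of_int_eq_iff)
  show ?thesis
  proof (rule ccontr)
    assume "k \<noteq> 0"
    then have "m \<noteq> 0" using k by auto
    then have "1 * int l \<le> \<bar>m\<bar> * int l" by (intro mult_right_mono) auto
    then show False using assms(2) k by (simp add: abs_mult)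
  qed
qed

text \<open>The bound on \<open>k\<close> excludes nonzero multiples of \<open>l\<close>, so a
  nonzero \<open>k\<close> gives a full geometric series with ratio different from 1.\<close>

lemma sum_rou_powi:
  assumes "l > 0" "\<bar>k\<bar> < int l"
  shows "(\<Sum>j<l. rou l powi (int j * k)) = (if k = 0 then of_nat l else 0)"
proof (cases "k = 0")
  case False
  define z where "z = rou l powi k"
  have z1: "z \<noteq> 1" using rou_pow_eq_1[OF assms] False by (auto simp: z_def)
  have zl: "z ^ l = 1"
  proof -
    have "z ^ l = rou l powi (k * int l)" by (simp add: z_def power_int_mult power_int_of_nat)
    also have "k * int l = int l * k" by simp
    also have "rou l powi (int l * k) = 1"
      by (simp only: power_int_mult power_int_of_nat rou_pow_self[OF assms(1)] power_int_1_left)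
    finally show ?thesis .
  qed
  have "(\<Sum>j<l. rou l powi (int j * k)) = (\<Sum>j<l. z ^ j)"
    by (intro sum.cong refl) (simp only: z_def power_int_mult[symmetric] mult.commute power_int_of_nat[symmetric])
  also have "\<dots> = 0" using z1 zl by (simp add: geometric_sum)
  finally show ?thesis using False by simp
qed simp

text \<open>The normalised discrete Fourier matrix, with the sign in the exponent chosen so that
  column \<open>k\<close> is an eigenvector of the cyclic shift for the eigenvalue
  \<open>rou l ^ k\<close>.\<close>

definition dftm :: "nat \<Rightarrow> complex mat" where
  "dftm l = mat l l (\<lambda>(j,k). rou l powi (- (int j * int k)) / of_real (sqrt (real l)))"

lemma rou_nz [simp]: "rou l \<noteq> 0" by (simp add: rou_def)

lemma cnj_rou_powi: "cnj (rou l) powi k = rou l powi (- k)"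
  by (simp add: rou_def cis_power_int cis_cnj)

lemma unitary_dftm:
  assumes "l > 0" shows "unitary_mat l (dftm l)"
proof -
  have sq: "complex_of_real (sqrt (real l)) * complex_of_real (sqrt (real l)) = of_nat l"
    by (simp flip: of_real_mult)
  have aux: "(\<Sum>k<l. rou l powi (int k * (a - b)) / of_nat l) = (if a = b then 1 else 0)"
    if "a \<in> {0..<int l}" "b \<in> {0..<int l}" for a b
    using sum_rou_powi[OF assms, of "a - b"] that assms
    by (auto simp flip: sum_divide_distrib)
  have e1: "dftm l * adj (dftm l) = 1\<^sub>m l"
  proof (intro eq_matI)
    fix i j assume "i < dim_row (1\<^sub>m l)" "j < dim_col (1\<^sub>m l)"
    then have ij: "i < l" "j < l" by auto
    have "(dftm l * adj (dftm l)) $$ (i,j) = (\<Sum>k<l. rou l powi (int k * (int j - int i)) / of_nat l)"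
      using ij by (simp add: dftm_def adj_def scalar_prod_def lessThan_atLeast0 cnj_rou_powi sq
          flip: power_int_add) (simp add: algebra_simps)
    then show "(dftm l * adj (dftm l)) $$ (i,j) = 1\<^sub>m l $$ (i,j)"
      using aux[of "int j" "int i"] ij by auto
  qed (auto simp: dftm_def adj_def)
  have e2: "adj (dftm l) * dftm l = 1\<^sub>m l"
  proof (intro eq_matI)
    fix i j assume "i < dim_row (1\<^sub>m l)" "j < dim_col (1\<^sub>m l)"
    then have ij: "i < l" "j < l" by auto
    have "(adj (dftm l) * dftm l) $$ (i,j) = (\<Sum>k<l. rou l powi (int k * (int i - int j)) / of_nat l)"
      using ij by (simp add: dftm_def adj_def scalar_prod_def lessThan_atLeast0 cnj_rou_powi sq
          flip: power_int_add) (simp add: algebra_simps)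
    then show "(adj (dftm l) * dftm l) $$ (i,j) = 1\<^sub>m l $$ (i,j)"
      using aux[of "int i" "int j"] ij by auto
  qed (auto simp: dftm_def adj_def)
  show ?thesis using e1 e2 by (simp add: unitary_mat_def dftm_def)
qed

lemma permm_cycle_dft:
  assumes "l > 0" "\<And>j. j < l \<Longrightarrow> c j = (j + 1) mod l" "c permutes {..<l}"
  shows "permm l z c * dftm l = dftm l * diagm l (\<lambda>k. z * rou l ^ k)"
proof (intro eq_matI)
  fix i k assume "i < dim_row (dftm l * diagm l (\<lambda>k. z * rou l ^ k))" "k < dim_col (dftm l * diagm l (\<lambda>k. z * rou l ^ k))"
  then have ik: "i < l" "k < l" by (auto simp: dftm_def diagm_def)
  define j where "j = inv_into UNIV c i"
  have j: "j < l" "c j = i"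
    using permutes_in_image[OF permutes_inv[OF assms(3)], of i] ik permutes_inverses(1)[OF assms(3)]
    by (auto simp: j_def)
  have uniq: "i = c j' \<longleftrightarrow> j' = j" for j'
    using permutes_inv_eq[OF assms(3)] unfolding j_def by metis
  have "(permm l z c * dftm l) $$ (i,k) = z * dftm l $$ (j,k)"
  proof -
    have "(permm l z c * dftm l) $$ (i,k) = (\<Sum>m\<in>{0..<l}. (if i = c m then z else 0) * dftm l $$ (m,k))"
      using ik by (simp add: permm_def dftm_def scalar_prod_def)
    also have "\<dots> = (\<Sum>m\<in>{0..<l}. if m = j then z * dftm l $$ (j,k) else 0)"
      by (intro sum.cong refl) (auto simp: uniq)
    finally show ?thesis using j by simp
  qed
  also have "\<dots> = dftm l $$ (i,k) * (z * rou l ^ k)"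
  proof -
    \<comment> \<open>Passing from \<open>j\<close> to its image \<open>i\<close> costs one factor
      \<open>rou l ^ k\<close>; at the wrap-around from \<open>l - 1\<close> to 0 this still holds
      because \<open>rou l ^ l = 1\<close>.\<close>
    have "rou l powi (- (int i * int k)) * rou l ^ k = rou l powi (- (int j * int k))"
    proof (cases "j + 1 < l")
      case True
      then have "i = j + 1" using assms(2)[of j] j by simp
      then have "- (int i * int k) + int k = - (int j * int k)" by (simp add: algebra_simps)
      then show ?thesis by (simp only: power_int_of_nat[symmetric] power_int_add[OF disjI1[OF rou_nz], symmetric])
    next
      case False
      then have "j + 1 = l" using j by simp
      then have i0: "i = 0" using assms(2)[of j] j by simp
      have "rou l powi (int j * int k) * rou l ^ k = rou l powi (int l * int k)"
      proof -
        have "int l * int k = int j * int k + int k"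
          unfolding \<open>j + 1 = l\<close>[symmetric] by (simp add: algebra_simps)
        then show ?thesis by (simp only: power_int_of_nat[symmetric] power_int_add[OF disjI1[OF rou_nz], symmetric])
      qed
      also have "\<dots> = 1" using rou_pow_self[OF assms(1)] by (simp add: power_int_mult power_int_of_nat)
      finally show ?thesis using i0 by (simp add: power_int_minus field_simps)
    qed
    then show ?thesis using ik j by (simp add: dftm_def mult_ac)
  qed
  also have "\<dots> = (dftm l * diagm l (\<lambda>k. z * rou l ^ k)) $$ (i,k)"
  proof -
    have "(dftm l * diagm l (\<lambda>k. z * rou l ^ k)) $$ (i,k)
       = (\<Sum>m\<in>{0..<l}. dftm l $$ (i,m) * (if m = k then z * rou l ^ m else 0))"
      using ik by (simp add: diagm_def dftm_def scalar_prod_def)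
    also have "\<dots> = (\<Sum>m\<in>{0..<l}. if m = k then dftm l $$ (i,k) * (z * rou l ^ k) else 0)"
      by (intro sum.cong refl) auto
    finally show ?thesis using ik by simp
  qed
  finally show "(permm l z c * dftm l) $$ (i,k) = (dftm l * diagm l (\<lambda>k. z * rou l ^ k)) $$ (i,k)" .
qed (auto simp: permm_def diagm_def dftm_def)

section \<open>The trace of F as a class function\<close>

locale expfun =
  fixes d :: "nat \<Rightarrow> nat" and Fm :: "complex mat \<Rightarrow> complex mat" and tau :: "nat \<Rightarrow> nat \<Rightarrow> complex mat"
  assumes ef: "exponential_functor d Fm tau"
begin

definition T :: "complex mat \<Rightarrow> complex" where "T U = mtrace (Fm U)"
definition f :: "complex \<Rightarrow> complex" where "f z = T (scalm z)"

lemmas ef' = ef[unfolded exponential_functor_def]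
lemmas F_unitary = ef'[THEN conjunct1, rule_format]
lemmas F_one = ef'[THEN conjunct2, THEN conjunct1, rule_format]
lemmas F_mult = ef'[THEN conjunct2, THEN conjunct2, THEN conjunct1, rule_format]
lemmas F_adj = ef'[THEN conjunct2, THEN conjunct2, THEN conjunct2, THEN conjunct1, rule_format]
lemmas F_cont = ef'[THEN conjunct2, THEN conjunct2, THEN conjunct2, THEN conjunct2, THEN conjunct1, rule_format]

lemma tau_dim: "d (n + m) = d n * d m"
  and tau_unitary: "unitary_mat (d (n + m)) (tau n m)"
  using ef'[THEN conjunct2, THEN conjunct2, THEN conjunct2, THEN conjunct2, THEN conjunct2, THEN conjunct1] by blast+

lemmas tau_nat = ef'[THEN conjunct2, THEN conjunct2, THEN conjunct2, THEN conjunct2, THEN conjunct2, THEN conjunct2,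
    THEN conjunct1, rule_format]

lemma d0: "d 0 = 1"
  using ef' by (elim conjE)

text \<open>Compatibility of \<open>Fm\<close> with products and adjoints turns the values of
  \<open>T\<close> into traces of a Gram matrix.\<close>

lemma T_pd:
  assumes "finite I" "\<And>i. i \<in> I \<Longrightarrow> unitary_mat n (U i)"
  shows "0 \<le> Re (\<Sum>i\<in>I. \<Sum>j\<in>I. cnj (c i) * c j * T (adj (U i) * U j))"
    and "Im (\<Sum>i\<in>I. \<Sum>j\<in>I. cnj (c i) * c j * T (adj (U i) * U j)) = 0"
proof -
  have eq: "(\<Sum>i\<in>I. \<Sum>j\<in>I. cnj (c i) * c j * T (adj (U i) * U j))
     = (\<Sum>i\<in>I. \<Sum>j\<in>I. cnj (c i) * c j * mtrace (adj (Fm (U i)) * Fm (U j)))"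
    using assms by (intro sum.cong refl) (simp add: T_def F_mult[of n] F_adj[of n] unitary_adj)
  show "0 \<le> Re (\<Sum>i\<in>I. \<Sum>j\<in>I. cnj (c i) * c j * T (adj (U i) * U j))"
    "Im (\<Sum>i\<in>I. \<Sum>j\<in>I. cnj (c i) * c j * T (adj (U i) * U j)) = 0"
    unfolding eq using mtrace_gram_nonneg[of I "\<lambda>i. Fm (U i)" "d n" c] assms F_unitary unitary_carrier
    by blast+
qed

lemma T_conj:
  assumes "unitary_mat n V" "unitary_mat n U"
  shows "T (V * U * adj V) = T U"
proof -
  have c: "Fm U \<in> carrier_mat (d n) (d n)" "Fm V \<in> carrier_mat (d n) (d n)"
    using assms F_unitary unitary_carrier by blast+
  have u: "adj (Fm V) * Fm V = 1\<^sub>m (d n)"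
    using F_unitary[OF assms(1)] by (simp add: unitary_mat_def)
  have "T (V * U * adj V) = mtrace (Fm V * Fm U * adj (Fm V))"
    using assms by (simp add: T_def F_mult[of n] F_adj[of n] unitary_adj unitary_mult)
  also have "\<dots> = mtrace (adj (Fm V) * (Fm V * Fm U))"
    using c by (intro mtrace_mult_comm[of _ "d n" "d n"]) auto
  also have "adj (Fm V) * (Fm V * Fm U) = Fm U"
    using c u by (subst assoc_mult_mat[symmetric, of _ "d n" "d n" _ "d n" _ "d n"]) auto
  finally show ?thesis by (simp add: T_def)
qed

lemma unitary_dsum:
  assumes "unitary_mat n U" "unitary_mat m V" shows "unitary_mat (n + m) (dsum U V)"
proof -
  have c: "U \<in> carrier_mat n n" "V \<in> carrier_mat m m" using assms unitary_carrier by auto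
  have ad: "adj (dsum U V) = dsum (adj U) (adj V)"
    using c by (intro eq_matI) (auto simp: adj_def dsum_def)
  have mul: "dsum A B * dsum A' B' = dsum (A * A') (B * B')"
    if "A \<in> carrier_mat n n" "A' \<in> carrier_mat n n" "B \<in> carrier_mat m m" "B' \<in> carrier_mat m m" for A A' B B'
    using that unfolding dsum_def
    by (subst mult_four_block_mat[of _ n n _ m _ m _ _ n _ m]) auto
  have one: "dsum (1\<^sub>m n) (1\<^sub>m m) = 1\<^sub>m (n + m)"
    by (intro eq_matI) (auto simp: dsum_def)
  show ?thesis
    using assms c unfolding unitary_mat_def ad by (auto simp: mul one) (auto simp: dsum_def)
qed

text \<open>Naturality says that \<open>tau\<close> conjugates \<open>Fm (dsum U V)\<close> into
  \<open>kron (Fm U) (Fm V)\<close>, and conjugation by a unitary preserves the trace.\<close>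

lemma T_dsum:
  assumes "unitary_mat n U" "unitary_mat m V"
  shows "T (dsum U V) = T U * T V"
proof -
  define t where "t = tau n m"
  have c: "Fm U \<in> carrier_mat (d n) (d n)" "Fm V \<in> carrier_mat (d m) (d m)"
    "Fm (dsum U V) \<in> carrier_mat (d (n + m)) (d (n + m))" "t \<in> carrier_mat (d (n + m)) (d (n + m))"
    using assms F_unitary unitary_dsum[OF assms] tau_unitary unitary_carrier unfolding t_def by blast+
  have k: "kron (Fm U) (Fm V) \<in> carrier_mat (d (n + m)) (d (n + m))"
    using c by (auto simp: kron_def tau_dim)
  have u: "adj t * t = 1\<^sub>m (d (n + m))" "t * adj t = 1\<^sub>m (d (n + m))"
    using tau_unitary[of n m] by (auto simp: t_def unitary_mat_def)
  have "T (dsum U V) = mtrace (adj t * t * Fm (dsum U V))"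
    using c by (simp add: T_def u)
  also have "adj t * t * Fm (dsum U V) = adj t * (kron (Fm U) (Fm V) * t)"
    using c k tau_nat[OF assms] unfolding t_def[symmetric]
    by (subst assoc_mult_mat[of _ "d (n + m)" "d (n + m)" _ "d (n + m)" _ "d (n + m)"]) auto
  also have "mtrace \<dots> = mtrace (kron (Fm U) (Fm V) * t * adj t)"
    using c k by (intro mtrace_mult_comm[of _ "d (n + m)" "d (n + m)"]) auto
  also have "kron (Fm U) (Fm V) * t * adj t = kron (Fm U) (Fm V)"
    using c k u
    by (subst assoc_mult_mat[of _ "d (n + m)" "d (n + m)" _ "d (n + m)" _ "d (n + m)"]) auto
  also have "mtrace \<dots> = T U * T V"
    using c by (simp add: mtrace_kron T_def)
  finally show ?thesis .
qed

lemma T_one0: "T (1\<^sub>m 0) = 1"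
  by (simp add: T_def F_one d0 mtrace_def)

lemma T_diagm: "(\<And>i. i < n \<Longrightarrow> cmod (z i) = 1) \<Longrightarrow> T (diagm n z) = (\<Prod>i<n. f (z i))"
proof (induction n)
  case 0
  have "diagm 0 z = 1\<^sub>m 0" by (intro diagm_one) auto
  then show ?case by (simp add: T_one0)
next
  case (Suc n)
  have "T (diagm (Suc n) z) = T (diagm n z) * T (scalm (z n))"
    unfolding diagm_Suc by (rule T_dsum[of n _ 1]) (use Suc.prems in \<open>blast intro: unitary_diagm unitary_scalm less_SucI lessI\<close>)+
  then show ?case using Suc by (simp add: f_def)
qed

text \<open>The Fourier matrix diagonalises \<open>z\<close> times the cycle, with diagonal entries
  \<open>z * rou l ^ k\<close>.\<close>

lemma T_std_cycle:
  assumes "l > 0" "\<And>j. j < l \<Longrightarrow> c j = (j + 1) mod l" "c permutes {..<l}" "cmod z = 1"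
  shows "T (permm l z c) = (\<Prod>k<l. f (z * rou l ^ k))"
proof -
  have ud: "unitary_mat l (dftm l)" using assms by (simp add: unitary_dftm)
  then have cd: "dftm l \<in> carrier_mat l l" "dftm l * adj (dftm l) = 1\<^sub>m l" by (auto simp: unitary_mat_def)
  have "permm l z c = permm l z c * (dftm l * adj (dftm l))"
    using cd by (simp add: right_mult_one_mat[of _ l l])
  also have "\<dots> = permm l z c * dftm l * adj (dftm l)"
    using cd by (subst assoc_mult_mat[of _ l l _ l _ l]) auto
  also have "\<dots> = dftm l * diagm l (\<lambda>k. z * rou l ^ k) * adj (dftm l)"
    using permm_cycle_dft[OF assms(1-3)] by simp
  finally show ?thesis
    using T_conj[OF ud unitary_diagm[of l "\<lambda>k. z * rou l ^ k"]] assms(4)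
    by (simp add: norm_mult norm_power T_diagm)
qed

lemma T_cycle:
  assumes "distinct xs" "set xs \<subseteq> {..<N}" "xs \<noteq> []" "cmod z = 1"
  shows "T (permm N z (cycle_of_list xs)) = f z ^ (N - length xs) * (\<Prod>k<length xs. f (z * rou (length xs) ^ k))"
proof -
  define l where "l = length xs"
  have l: "l > 0" "l \<le> N"
    using assms card_mono[of "{..<N}" "set xs"] distinct_card[of xs] by (auto simp: l_def)
  define c where "c = cycle_of_list [0..<l]"
  have cperm: "c permutes {..<l}" using cycle_permutes[of "[0..<l]"] by (simp add: c_def lessThan_atLeast0)
  have cj: "c j = (j + 1) mod l" if "j < l" for j
  proof -
    have m: "map c [0..<l] = rotate1 [0..<l]"
      using cyclic_rotation[of "[0..<l]" 1] by (simp add: c_def)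
    have "c j = map c [0..<l] ! j" using that by simp
    also have "\<dots> = [0..<l] ! (Suc j mod length [0..<l])"
      unfolding m by (rule nth_rotate1) (use that in simp)
    finally show ?thesis using l by simp
  qed
  \<comment> \<open>The list \<open>ys\<close> starts with \<open>xs\<close> and continues with the
    remaining points; as a permutation \<open>p\<close> it conjugates the standard cycle on the
    first \<open>l\<close> points into the cycle along \<open>xs\<close>.\<close>
  define ys where "ys = xs @ filter (\<lambda>i. i \<notin> set xs) [0..<N]"
  have ys: "distinct ys" "set ys = {..<N}" using assms(1,2) by (auto simp: ys_def)
  then have lys: "length ys = N" by (metis card_lessThan distinct_card)
  define p where "p i = (if i < N then ys ! i else i)" for i
  have "bij_betw ((!) ys) {..<N} {..<N}" using bij_betw_nth[OF ys(1)] ys(2) lys by blast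
  then have "bij_betw p {..<N} {..<N}" by (subst bij_betw_cong[of _ _ "(!) ys"]) (simp_all add: p_def)
  then have pp: "p permutes {..<N}" by (rule bij_imp_permutes) (simp add: p_def)
  have mp: "map p [0..<l] = xs"
    using l by (intro nth_equalityI) (auto simp: l_def p_def ys_def nth_append)
  have conj: "p \<circ> c \<circ> inv_into UNIV p = cycle_of_list xs"
    unfolding c_def mp[symmetric] by (rule conjugation_of_cycle) (auto simp: permutes_bij[OF pp])
  have cpN: "c permutes {..<N}" using cperm l by (auto intro: permutes_subset)
  have "permm N 1 p * permm N z c * adj (permm N 1 p) = permm N z (cycle_of_list xs)"
    using cpN pp conj by (simp add: adj_permm permm_mult permutes_inv)
  then have "T (permm N z (cycle_of_list xs)) = T (permm N z c)"
    using T_conj[OF unitary_permm[OF pp, of 1] unitary_permm[OF cpN assms(4)]] by simp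
  also have "permm N z c = dsum (permm l z c) (diagm (N - l) (\<lambda>_. z))"
  proof (intro eq_matI)
    fix i j assume "i < dim_row (dsum (permm l z c) (diagm (N - l) (\<lambda>_. z)))"
      "j < dim_col (dsum (permm l z c) (diagm (N - l) (\<lambda>_. z)))"
    then have ij: "i < N" "j < N" using l by (auto simp: dsum_def permm_def diagm_def)
    have "c j < l" if "j < l" using permutes_in_image[OF cperm, of j] that by simp
    moreover have "c j = j" if "\<not> j < l" using permutes_not_in[OF cperm, of j] that by simp
    ultimately show "permm N z c $$ (i,j) = dsum (permm l z c) (diagm (N - l) (\<lambda>_. z)) $$ (i,j)"
      using ij l by (auto simp: dsum_def permm_def diagm_def)
  qed (use l in \<open>auto simp: dsum_def permm_def diagm_def\<close>)
  also have "T \<dots> = T (permm l z c) * T (diagm (N - l) (\<lambda>_. z))"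
    by (rule T_dsum[OF unitary_permm[OF cperm assms(4)] unitary_diagm]) (rule assms(4))
  also have "T (diagm (N - l) (\<lambda>_. z)) = f z ^ (N - l)"
    using assms(4) by (simp add: T_diagm)
  also have "T (permm l z c) = (\<Prod>k<l. f (z * rou l ^ k))"
    by (rule T_std_cycle[OF l(1) cj cperm assms(4)])
  also have "(\<Prod>k<l. f (z * rou l ^ k)) * f z ^ (N - l)
    = f z ^ (N - length xs) * (\<Prod>k<length xs. f (z * rou (length xs) ^ k))"
    by (simp only: l_def mult.commute)
  finally show ?thesis .
qed

end

section \<open>Laurent polynomials on the circle\<close>

definition laurent :: "(complex \<Rightarrow> complex) \<Rightarrow> bool" where
  "laurent g \<longleftrightarrow> (\<exists>p n. \<forall>z. z \<noteq> 0 \<longrightarrow> g z = poly p z / z ^ n)"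

lemma laurentI: "(\<And>z. z \<noteq> 0 \<Longrightarrow> g z = poly p z / z ^ n) \<Longrightarrow> laurent g"
  unfolding laurent_def by blast

lemma laurent_const: "laurent (\<lambda>_. c)"
  by (rule laurentI[of _ "[:c:]" 0]) simp

lemma laurent_add:
  assumes "laurent g" "laurent h" shows "laurent (\<lambda>z. g z + h z)"
proof -
  obtain p n where p: "\<And>z. z \<noteq> 0 \<Longrightarrow> g z = poly p z / z ^ n" using assms(1) unfolding laurent_def by blast
  obtain q m where q: "\<And>z. z \<noteq> 0 \<Longrightarrow> h z = poly q z / z ^ m" using assms(2) unfolding laurent_def by blast
  show ?thesis
    by (rule laurentI[of _ "p * monom 1 m + q * monom 1 n" "n + m"])
      (simp add: p q poly_monom power_add divide_simps)
qed

lemma laurent_mult: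
  assumes "laurent g" "laurent h" shows "laurent (\<lambda>z. g z * h z)"
proof -
  obtain p n where p: "\<And>z. z \<noteq> 0 \<Longrightarrow> g z = poly p z / z ^ n" using assms(1) unfolding laurent_def by blast
  obtain q m where q: "\<And>z. z \<noteq> 0 \<Longrightarrow> h z = poly q z / z ^ m" using assms(2) unfolding laurent_def by blast
  show ?thesis
    by (rule laurentI[of _ "p * q" "n + m"]) (simp add: p q power_add)
qed

lemma laurent_sum: "(\<And>i. i \<in> I \<Longrightarrow> laurent (g i)) \<Longrightarrow> laurent (\<lambda>z. \<Sum>i\<in>I. g i z)"
  by (induction I rule: infinite_finite_induct) (auto intro: laurent_const laurent_add)

lemma laurent_prod: "(\<And>i. i \<in> I \<Longrightarrow> laurent (g i)) \<Longrightarrow> laurent (\<lambda>z. \<Prod>i\<in>I. g i z)"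
  by (induction I rule: infinite_finite_induct) (auto intro: laurent_const laurent_mult)

lemma laurent_power: "laurent g \<Longrightarrow> laurent (\<lambda>z. g z ^ n)"
  by (induction n) (auto intro: laurent_const laurent_mult)

lemma laurent_powi: "laurent (\<lambda>z. z powi k)"
proof (cases "k \<ge> 0")
  case True
  then show ?thesis by (intro laurentI[of _ "monom 1 (nat k)" 0]) (simp add: poly_monom power_int_def)
next
  case False
  then show ?thesis by (intro laurentI[of _ "1" "nat (- k)"]) (simp add: power_int_def divide_simps)
qed

lemma laurent_scale:
  assumes "laurent g" "c \<noteq> 0" shows "laurent (\<lambda>z. g (z * c))"
proof -
  obtain p n where p: "\<And>z. z \<noteq> 0 \<Longrightarrow> g z = poly p z / z ^ n" using assms(1) unfolding laurent_def by blast
  show ?thesis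
    by (rule laurentI[of _ "smult (1 / c ^ n) (pcompose p [:0, c:])" n])
      (simp add: p assms poly_pcompose power_mult_distrib mult.commute)
qed

text \<open>The hypothesis makes the coefficients of \<open>L\<close> nonnegative.\<close>

lemma laurent_pos_Re_nonneg:
  assumes "laurent L"
    and re: "\<And>K M. M > 0 \<Longrightarrow> 0 \<le> Re (\<Sum>j<M. rou M powi (- (int j * K)) * L (rou M ^ j))"
    and "r > 0"
  shows "0 \<le> Re (L (of_real r))"
proof -
  obtain p n where p: "\<And>z. z \<noteq> 0 \<Longrightarrow> L z = poly p z / z ^ n" using assms(1) unfolding laurent_def by blast
  \<comment> \<open>More sample points than the degree: exponents up to \<open>degree p\<close> are
    then distinct modulo \<open>M\<close>, and the Fourier sum of frequency \<open>i - n\<close>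
    isolates the coefficient of index \<open>i\<close> of \<open>p\<close>.\<close>
  define M where "M = Suc (degree p)"
  have M: "M > 0" by (simp add: M_def)
  have pm: "rou M powi a * rou M powi b = rou M powi (a + b)" for a b
    by (simp add: power_int_add)
  have coeff: "0 \<le> Re (coeff p i)" if i: "i \<le> degree p" for i
  proof -
    have "(\<Sum>j<M. rou M powi (- (int j * (int i - int n))) * L (rou M ^ j))
      = (\<Sum>j<M. \<Sum>k\<le>degree p. coeff p k * rou M powi (int j * (int k - int i)))"
    proof (intro sum.cong refl)
      fix j assume "j \<in> {..<M}"
      have "L (rou M ^ j) = poly p (rou M ^ j) / rou M ^ (j * n)"
        by (simp add: p power_mult)
      also have "1 / rou M ^ (j * n) = rou M powi (- (int j * int n))"
        by (simp add: power_int_minus divide_inverse flip: power_int_of_nat)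
      then have "poly p (rou M ^ j) / rou M ^ (j * n) = poly p (rou M ^ j) * rou M powi (- (int j * int n))"
        by (simp add: divide_inverse)
      also have "poly p (rou M ^ j) = (\<Sum>k\<le>degree p. coeff p k * rou M powi (int j * int k))"
        unfolding poly_altdef by (intro sum.cong refl) (simp add: power_int_mult power_int_of_nat)
      finally have "rou M powi (- (int j * (int i - int n))) * L (rou M ^ j)
         = (\<Sum>k\<le>degree p. coeff p k * rou M powi (int j * int k)) *
           (rou M powi (- (int j * (int i - int n))) * rou M powi (- (int j * int n)))"
        by (simp only: mult_ac)
      also have "rou M powi (- (int j * (int i - int n))) * rou M powi (- (int j * int n)) = rou M powi (- (int j * int i))"
        unfolding pm by (simp add: algebra_simps)
      also have "(\<Sum>k\<le>degree p. coeff p k * rou M powi (int j * int k)) * rou M powi (- (int j * int i))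
        = (\<Sum>k\<le>degree p. coeff p k * (rou M powi (int j * int k) * rou M powi (- (int j * int i))))"
        by (simp only: sum_distrib_right mult.assoc)
      also have "\<dots> = (\<Sum>k\<le>degree p. coeff p k * rou M powi (int j * (int k - int i)))"
        by (simp only: pm) (simp add: right_diff_distrib)
      finally show "rou M powi (- (int j * (int i - int n))) * L (rou M ^ j)
         = (\<Sum>k\<le>degree p. coeff p k * rou M powi (int j * (int k - int i)))" .
    qed
    also have "\<dots> = (\<Sum>k\<le>degree p. coeff p k * (\<Sum>j<M. rou M powi (int j * (int k - int i))))"
      unfolding sum_distrib_left by (rule sum.swap)
    also have "\<dots> = (\<Sum>k\<le>degree p. if k = i then coeff p i * of_nat M else 0)"
    proof (intro sum.cong refl)
      fix k assume "k \<in> {..degree p}"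
      then have "\<bar>int k - int i\<bar> < int M" using i by (auto simp: M_def)
      then show "coeff p k * (\<Sum>j<M. rou M powi (int j * (int k - int i))) = (if k = i then coeff p i * of_nat M else 0)"
        by (subst sum_rou_powi[OF M]) auto
    qed
    also have "\<dots> = coeff p i * of_nat M" using i by simp
    finally have "0 \<le> Re (coeff p i * of_nat M)" using re[OF M, of "int i - int n"] by simp
    then show ?thesis using M by (simp add: zero_le_mult_iff)
  qed
  have "L (of_real r) = (\<Sum>i\<le>degree p. coeff p i * of_real (r ^ i)) / of_real (r ^ n)"
    using p[of "of_real r"] assms(3) by (simp add: poly_altdef)
  also have "\<dots> = (\<Sum>i\<le>degree p. coeff p i * of_real (r ^ i / r ^ n))"
    by (simp add: sum_divide_distrib)
  finally have "Re (L (of_real r)) = (\<Sum>i\<le>degree p. Re (coeff p i) * (r ^ i / r ^ n))"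
    by (simp del: of_real_divide of_real_power)
  also have "\<dots> \<ge> 0" using coeff assms(3) by (intro sum_nonneg) simp
  finally show ?thesis .
qed

text \<open>Exponents matter only modulo \<open>P\<close>, and a shift by \<open>j\<close> permutes
  the residues. It collapses a double sum over a cyclic group whose terms depend on the difference
  only.\<close>

lemma sum_rou_shift:
  assumes "P > 0"
  shows "(\<Sum>j'<P. h (rou P powi (int j' - int j))) = (\<Sum>k<P. h (rou P ^ k))"
proof -
  have per: "rou P powi a = rou P ^ nat (a mod int P)" for a
  proof -
    have "rou P powi (int P * (a div int P) + a mod int P) = rou P powi (a mod int P)"
      by (simp only: power_int_add[OF disjI1[OF rou_nz]] power_int_mult power_int_of_nat rou_pow_self[OF assms]
          power_int_1_left mult_1)
    then show ?thesis using assms by (simp add: power_int_def)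
  qed
  show ?thesis
  proof (rule sum.reindex_bij_witness[of _ "\<lambda>k. nat ((int k + int j) mod int P)" "\<lambda>j'. nat ((int j' - int j) mod int P)"])
    fix a assume "a \<in> {..<P}"
    then have "int a mod int P = int a" by simp
    moreover have "((int a - int j) mod int P + int j) mod int P = int a mod int P"
      by (simp add: mod_simps)
    ultimately show "nat ((int (nat ((int a - int j) mod int P)) + int j) mod int P) = a"
      using assms by simp
  next
    fix a assume "a \<in> {..<P}"
    then have "int a mod int P = int a" by simp
    moreover have "((int a + int j) mod int P - int j) mod int P = int a mod int P"
      by (simp add: mod_simps)
    ultimately show "nat ((int (nat ((int a + int j) mod int P)) - int j) mod int P) = a"
      using assms by simp
  qed (use assms in \<open>auto simp: per nat_less_iff\<close>)
qed

section \<open>Quotients of cycles with a common point\<close>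

lemma cycle_of_list_append:
  "cycle_of_list (xs @ y # zs) = cycle_of_list (xs @ [y]) \<circ> cycle_of_list (y # zs)"
proof (induction xs)
  case (Cons x xs)
  then show ?case by (cases xs) (simp_all add: comp_assoc)
qed simp

lemma cycle_of_list_rev_comp: "cycle_of_list (rev xs) \<circ> cycle_of_list xs = id"
proof (induction xs rule: cycle_of_list.induct)
  case (1 i j cs)
  have "cycle_of_list (rev (i # j # cs)) = cycle_of_list (rev (j # cs)) \<circ> transpose j i"
    using cycle_of_list_append[of "rev cs" j "[i]"] by simp
  then have "cycle_of_list (rev (i # j # cs)) \<circ> cycle_of_list (i # j # cs)
      = cycle_of_list (rev (j # cs)) \<circ> (transpose j i \<circ> transpose i j) \<circ> cycle_of_list (j # cs)"
    by (simp only: cycle_of_list.simps comp_assoc)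
  also have "transpose j i \<circ> transpose i j = id"
    by (simp add: transpose_commute[of j i])
  finally show ?case using 1 by simp
qed auto

lemma inv_cycle_of_list: "inv_into UNIV (cycle_of_list xs) = cycle_of_list (rev xs)"
  using cycle_of_list_rev_comp[of xs] cycle_of_list_rev_comp[of "rev xs"]
  by (intro inv_unique_comp) simp_all

text \<open>If \<open>x\<close>, \<open>xs\<close> and \<open>ys\<close> have no repetitions, the
  quotient is a single cycle whose length depends only on the sum of the two lengths. This is the
  source of the Hankel shape.\<close>

lemma inv_cycle_comp_disjoint:
  "inv_into UNIV (cycle_of_list (x # xs)) \<circ> cycle_of_list (x # ys) = cycle_of_list (rev xs @ x # ys)"
  unfolding inv_cycle_of_list using cycle_of_list_append[of "rev xs" x ys] by simp

text \<open>The common initial segment cancels up to its last point \<open>y\<close>, from which the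
  remaining cycle starts; hence the \<open>+ 1\<close> in its length.\<close>

lemma inv_cycle_comp_take:
  assumes "i \<le> j" "j \<le> length xs"
  shows "\<exists>ys. set ys \<subseteq> set (x # xs) \<and> (distinct (x # xs) \<longrightarrow> distinct ys) \<and> length ys = j - i + 1 \<and>
      inv_into UNIV (cycle_of_list (x # take i xs)) \<circ> cycle_of_list (x # take j xs) = cycle_of_list ys \<and>
      inv_into UNIV (cycle_of_list (x # take j xs)) \<circ> cycle_of_list (x # take i xs) = cycle_of_list (rev ys)"
proof -
  define as where "as = butlast (x # take i xs)"
  define y where "y = last (x # take i xs)"
  define zs where "zs = take (j - i) (drop i xs)"
  have a: "x # take i xs = as @ [y]" by (simp add: as_def y_def)
  have "take j xs = take i xs @ zs"
    using assms by (metis zs_def le_add_diff_inverse take_add)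
  then have b: "x # take j xs = as @ y # zs" using a by simp
  have c: "cycle_of_list (x # take j xs) = cycle_of_list (x # take i xs) \<circ> cycle_of_list (y # zs)"
    unfolding a b by (rule cycle_of_list_append)
  have i: "inv_into UNIV (cycle_of_list ws) \<circ> cycle_of_list ws = id" for ws :: "'a list"
    by (simp add: inv_cycle_of_list cycle_of_list_rev_comp)
  have e1: "inv_into UNIV (cycle_of_list (x # take i xs)) \<circ> cycle_of_list (x # take j xs) = cycle_of_list (y # zs)"
    unfolding c comp_assoc[symmetric] i by simp
  have "cycle_of_list (rev (x # take j xs)) \<circ> cycle_of_list (x # take i xs)
     = cycle_of_list (rev (y # zs)) \<circ> (cycle_of_list (rev (as @ [y])) \<circ> cycle_of_list (as @ [y]))"
  proof -
    have r: "rev (as @ y # zs) = rev zs @ y # rev as" "rev (as @ [y]) = y # rev as" "rev (y # zs) = rev zs @ [y]"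
      by simp_all
    show ?thesis unfolding a b r cycle_of_list_append[of "rev zs" y "rev as"] by (rule comp_assoc)
  qed
  then have e2: "inv_into UNIV (cycle_of_list (x # take j xs)) \<circ> cycle_of_list (x # take i xs) = cycle_of_list (rev (y # zs))"
    by (simp only: inv_cycle_of_list cycle_of_list_rev_comp comp_id)
  have "set (y # zs) \<subseteq> set (x # take j xs)" unfolding b by auto
  then have s: "set (y # zs) \<subseteq> set (x # xs)" using set_take_subset[of j xs] by auto
  have d: "distinct (y # zs)" if "distinct (x # xs)"
  proof -
    have "distinct (x # take j xs)" using that set_take_subset[of j xs] by auto
    then show ?thesis unfolding b by simp
  qed
  have "length (y # zs) = j - i + 1" using assms by (simp add: zs_def)
  then show ?thesis using e1 e2 s d by blast
qed

section \<open>Hankel positivity\<close>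

context expfun
begin

text \<open>Positive definiteness is tested on multiples of the cycles \<open>cyc m i\<close>
  through 0 and the first \<open>i\<close> points of block \<open>m\<close>, with coefficients
  \<open>q i\<close> that are the same in every block. The quotient of two such cycles has length
  one more than the distance of \<open>i\<close> and \<open>i'\<close> within a block, and length
  \<open>i + i' + 1\<close> between different blocks.\<close>

lemma hankel_block:
  fixes q :: "nat \<Rightarrow> complex" and D M :: nat
  assumes g: "laurent g" "\<And>z. cmod z = 1 \<Longrightarrow> f z = g z" and "r > 0" "M \<ge> 2"
  defines "cl \<equiv> \<lambda>l z. \<Prod>k<l. g (z * rou l ^ k)"
  defines "N \<equiv> 1 + M * D"
  shows "0 \<le> Re (\<Sum>m<M. \<Sum>m'<M. \<Sum>i\<le>D. \<Sum>i'\<le>D. cnj (q i) * q i' *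
     (if m = m' then g (of_real r) ^ (N - (nat \<bar>int i - int i'\<bar> + 1)) * cl (nat \<bar>int i - int i'\<bar> + 1) (of_real r)
      else g (of_real r) ^ (N - (i + i' + 1)) * cl (i + i' + 1) (of_real r)))"
proof -
  \<comment> \<open>The blocks are disjoint intervals of \<open>D\<close> points that avoid 0, the
    point shared by all cycles.\<close>
  define as where "as m = [1 + m * D ..< 1 + m * D + D]" for m
  define cyc where "cyc m i = cycle_of_list (0 # take i (as m))" for m i
  define len where "len m i m' i' = (if m = m' then nat \<bar>int i - int i'\<bar> + 1 else i + i' + 1)" for m m' i i' :: nat
  define E where "E z = (\<Sum>m<M. \<Sum>m'<M. \<Sum>i\<le>D. \<Sum>i'\<le>D. cnj (q i) * q i' *
      (g z ^ (N - len m i m' i') * cl (len m i m' i') z))" for z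
  have lcl: "laurent (cl l)" for l unfolding cl_def by (intro laurent_prod laurent_scale g) simp
  have lE: "laurent E" unfolding E_def
    by (intro laurent_sum laurent_mult laurent_const laurent_power g lcl)
  have N2: "1 + m * D + D \<le> N" if "m < M" for m
  proof -
    have "m * D + D = Suc m * D" by simp
    also have "\<dots> \<le> M * D" using that by (intro mult_le_mono) auto
    finally show ?thesis by (simp add: N_def)
  qed
  have dist: "distinct (0 # as m)" "set (0 # as m) \<subseteq> {..<N}" if "m < M" for m
    using N2[OF that] by (auto simp: as_def)
  have disj: "set (as m) \<inter> set (as m') = {}" if "m \<noteq> m'" for m m'
  proof -
    have "set (as m) \<inter> set (as m') = {}" if "m < m'" for m m'
    proof -
      have "Suc m * D \<le> m' * D" using that by (intro mult_le_mono) auto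
      then show ?thesis by (auto simp: as_def)
    qed
    then show ?thesis using that by (metis Int_commute nat_neq_iff)
  qed
  have perm: "cyc m i permutes {..<N}" if "m < M" for m i
    unfolding cyc_def using dist[OF that] set_take_subset[of i "as m"]
    by (intro permutes_subset[OF cycle_permutes]) auto
  have Tval: "T (permm N z (inv_into UNIV (cyc m i) \<circ> cyc m' i')) = g z ^ (N - len m i m' i') * cl (len m i m' i') z"
    if z: "cmod z = 1" and mi: "m < M" "m' < M" "i \<le> D" "i' \<le> D" for z m m' i i'
  proof -
    have "\<exists>xs. distinct xs \<and> set xs \<subseteq> {..<N} \<and> length xs = len m i m' i' \<and>
        inv_into UNIV (cyc m i) \<circ> cyc m' i' = cycle_of_list xs"
    proof (cases "m = m'")
      case False
      have "distinct (rev (take i (as m)) @ 0 # take i' (as m'))"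
        using dist[OF mi(1)] dist[OF mi(2)] disj[OF False] set_take_subset[of i "as m"] set_take_subset[of i' "as m'"]
        by auto
      moreover have "set (rev (take i (as m)) @ 0 # take i' (as m')) \<subseteq> {..<N}"
        using dist[OF mi(1)] dist[OF mi(2)] set_take_subset[of i "as m"] set_take_subset[of i' "as m'"]
        by auto
      moreover have "length (rev (take i (as m)) @ 0 # take i' (as m')) = len m i m' i'"
        using mi False by (simp add: as_def len_def)
      ultimately show ?thesis unfolding cyc_def inv_cycle_comp_disjoint by blast
    next
      case True
      have l: "length (as m) = D" by (simp add: as_def)
      have fin: ?thesis if "set ys \<subseteq> set (0 # as m)" "distinct ys" "length ys = len m i m' i'"
        "inv_into UNIV (cyc m i) \<circ> cyc m' i' = cycle_of_list ys" for ys
        using that dist(2)[OF mi(1)] by blast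
      show ?thesis
      proof (cases "i \<le> i'")
        case le: True
        then obtain ys where "set ys \<subseteq> set (0 # as m)" "distinct ys" "length ys = i' - i + 1"
           "inv_into UNIV (cyc m i) \<circ> cyc m i' = cycle_of_list ys"
          using inv_cycle_comp_take[of i i' "as m" 0] mi l dist(1)[OF mi(1)] unfolding cyc_def[symmetric] by auto
        moreover have "len m i m' i' = i' - i + 1" using True le by (simp add: len_def)
        ultimately show ?thesis using fin[of ys] True by simp
      next
        case False
        then obtain ys where "set ys \<subseteq> set (0 # as m)" "distinct ys" "length ys = i - i' + 1"
           "inv_into UNIV (cyc m i) \<circ> cyc m i' = cycle_of_list (rev ys)"
          using inv_cycle_comp_take[of i' i "as m" 0] mi l dist(1)[OF mi(1)] unfolding cyc_def[symmetric] by auto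
        moreover have "len m i m' i' = i - i' + 1" using True False by (simp add: len_def)
        ultimately show ?thesis using fin[of "rev ys"] True by simp
      qed
    qed
    then obtain xs where xs: "distinct xs" "set xs \<subseteq> {..<N}" "length xs = len m i m' i'"
        "inv_into UNIV (cyc m i) \<circ> cyc m' i' = cycle_of_list xs" by blast
    have "xs \<noteq> []" using xs(3) by (auto simp: len_def split: if_splits)
    then show ?thesis
      using T_cycle[OF xs(1,2) _ z] z unfolding xs(3,4) cl_def by (simp add: g(2) norm_mult norm_power)
  qed
  have "0 \<le> Re (E (of_real r))"
  proof (rule laurent_pos_Re_nonneg[OF lE _ \<open>r > 0\<close>])
    fix K :: int and P :: nat assume P: "P > 0"
    \<comment> \<open>Letting the scalar run over the \<open>P\<close>-th roots of unity, weighted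
      by a character of frequency \<open>K\<close>, turns the positive form into \<open>P\<close>
      times the Fourier sum of \<open>E\<close> required by
      \<open>laurent_pos_Re_nonneg\<close>.\<close>
    define I where "I = {..<P} \<times> {..<M} \<times> {..D}"
    define U where "U = (\<lambda>(j::nat,m,i). permm N (rou P ^ j) (cyc m i))"
    define c where "c = (\<lambda>(j::nat,m::nat,i). rou P powi (- (int j * K)) * q i)"
    have Uu: "unitary_mat N (U a)" if "a \<in> I" for a
      using that perm by (auto simp: U_def I_def norm_power intro!: unitary_permm)
    define h where "h z = z powi (- K) * E z" for z
    have term_eq: "cnj (c (j,m,i)) * c (j',m',i') * T (adj (U (j,m,i)) * U (j',m',i'))
       = (rou P powi (int j' - int j)) powi (- K) * (cnj (q i) * q i' *
          (g (rou P powi (int j' - int j)) ^ (N - len m i m' i') * cl (len m i m' i') (rou P powi (int j' - int j))))"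
      if mi: "m < M" "m' < M" "i \<le> D" "i' \<le> D" for j j' m m' i i'
    proof -
      have z: "cnj (rou P ^ j) * rou P ^ j' = rou P powi (int j' - int j)"
      proof -
        have "cnj (rou P ^ j) = rou P powi (- int j)"
          by (simp add: cnj_rou_powi flip: power_int_of_nat)
        then have "cnj (rou P ^ j) * rou P ^ j' = rou P powi (- int j + int j')"
          by (simp only: power_int_of_nat[symmetric] power_int_add[OF disjI1[OF rou_nz]])
        then show ?thesis by simp
      qed
      have "adj (U (j,m,i)) * U (j',m',i') = permm N (rou P powi (int j' - int j)) (inv_into UNIV (cyc m i) \<circ> cyc m' i')"
        using perm mi z by (simp add: U_def adj_permm permm_mult)
      moreover have "cmod (rou P powi (int j' - int j)) = 1" by (simp add: norm_power_int)
      moreover have "cnj (c (j,m,i)) * c (j',m',i') = (rou P powi (int j' - int j)) powi (- K) * (cnj (q i) * q i')"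
      proof -
        have "cnj (rou P powi (- (int j * K))) * rou P powi (- (int j' * K)) = rou P powi (int j * K + - (int j' * K))"
          by (simp only: complex_cnj_power_int cnj_rou_powi minus_minus power_int_add[OF disjI1[OF rou_nz]])
        also have "int j * K + - (int j' * K) = (int j' - int j) * (- K)" by (simp add: algebra_simps)
        finally have "cnj (rou P powi (- (int j * K))) * rou P powi (- (int j' * K)) = (rou P powi (int j' - int j)) powi (- K)"
          by (simp only: power_int_mult)
        moreover have "cnj (c (j,m,i)) * c (j',m',i')
            = (cnj (rou P powi (- (int j * K))) * rou P powi (- (int j' * K))) * (cnj (q i) * q i')"
          by (simp only: c_def prod.case complex_cnj_mult mult_ac)
        ultimately show ?thesis by simp
      qed
      ultimately show ?thesis using Tval[OF _ mi] by (simp only: mult.assoc)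
    qed
    have "(\<Sum>a\<in>I. \<Sum>b\<in>I. cnj (c a) * c b * T (adj (U a) * U b))
       = (\<Sum>j<P. \<Sum>m<M. \<Sum>i\<le>D. \<Sum>j'<P. \<Sum>m'<M. \<Sum>i'\<le>D.
            cnj (c (j,m,i)) * c (j',m',i') * T (adj (U (j,m,i)) * U (j',m',i')))"
      by (simp only: I_def sum.cartesian_product')
    also have "\<dots> = (\<Sum>j<P. \<Sum>m<M. \<Sum>i\<le>D. \<Sum>j'<P. \<Sum>m'<M. \<Sum>i'\<le>D.
          (rou P powi (int j' - int j)) powi (- K) * (cnj (q i) * q i' *
          (g (rou P powi (int j' - int j)) ^ (N - len m i m' i') * cl (len m i m' i') (rou P powi (int j' - int j)))))"
      by (intro sum.cong refl term_eq) auto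
    also have "\<dots> = (\<Sum>j<P. \<Sum>j'<P. \<Sum>m<M. \<Sum>m'<M. \<Sum>i\<le>D. \<Sum>i'\<le>D.
          (rou P powi (int j' - int j)) powi (- K) * (cnj (q i) * q i' *
          (g (rou P powi (int j' - int j)) ^ (N - len m i m' i') * cl (len m i m' i') (rou P powi (int j' - int j)))))"
      (is "(\<Sum>j<P. ?L j) = (\<Sum>j<P. ?R j)")
    proof (rule sum.cong[OF refl])
      have sw: "(\<Sum>m<M. \<Sum>i\<le>D. \<Sum>j'<P. \<Sum>m'<M. F m i j' m') = (\<Sum>j'<P. \<Sum>m<M. \<Sum>m'<M. \<Sum>i\<le>D. F m i j' m')"
        for F :: "nat \<Rightarrow> nat \<Rightarrow> nat \<Rightarrow> nat \<Rightarrow> complex"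
      proof -
        have "(\<Sum>m<M. \<Sum>i\<le>D. \<Sum>j'<P. \<Sum>m'<M. F m i j' m') = (\<Sum>m<M. \<Sum>j'<P. \<Sum>i\<le>D. \<Sum>m'<M. F m i j' m')"
          by (intro sum.cong refl sum.swap)
        also have "\<dots> = (\<Sum>j'<P. \<Sum>m<M. \<Sum>i\<le>D. \<Sum>m'<M. F m i j' m')" by (rule sum.swap)
        also have "\<dots> = (\<Sum>j'<P. \<Sum>m<M. \<Sum>m'<M. \<Sum>i\<le>D. F m i j' m')"
          by (intro sum.cong refl sum.swap)
        finally show ?thesis .
      qed
      show "?L j = ?R j" for j by (rule sw)
    qed
    also have "\<dots> = (\<Sum>j<P. \<Sum>j'<P. h (rou P powi (int j' - int j)))"
      by (simp only: h_def E_def sum_distrib_left)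
    also have "\<dots> = of_nat P * (\<Sum>k<P. h (rou P ^ k))"
      by (simp only: sum_rou_shift[OF P] sum_constant card_lessThan)
    also have "(\<Sum>k<P. h (rou P ^ k)) = (\<Sum>j<P. rou P powi (- (int j * K)) * E (rou P ^ j))"
    proof (intro sum.cong refl)
      fix j
      have "(rou P ^ j) powi (- K) = rou P powi (- (int j * K))"
        unfolding power_int_of_nat[symmetric] power_int_mult[symmetric] by simp
      then show "h (rou P ^ j) = rou P powi (- (int j * K)) * E (rou P ^ j)" by (simp only: h_def)
    qed
    finally have eq: "(\<Sum>a\<in>I. \<Sum>b\<in>I. cnj (c a) * c b * T (adj (U a) * U b))
       = of_nat P * (\<Sum>j<P. rou P powi (- (int j * K)) * E (rou P ^ j))" .
    have "0 \<le> Re (of_nat P * (\<Sum>j<P. rou P powi (- (int j * K)) * E (rou P ^ j)))"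
      unfolding eq[symmetric] by (rule T_pd(1)[OF _ Uu]) (auto simp: I_def)
    moreover have "Re (of_nat P * w) = real P * Re w" for w by simp
    ultimately show "0 \<le> Re (\<Sum>j<P. rou P powi (- (int j * K)) * E (rou P ^ j))"
      using P by (simp only: zero_le_mult_iff) auto
  qed
  also have "E (of_real r) = (\<Sum>m<M. \<Sum>m'<M. \<Sum>i\<le>D. \<Sum>i'\<le>D. cnj (q i) * q i' *
     (if m = m' then g (of_real r) ^ (N - (nat \<bar>int i - int i'\<bar> + 1)) * cl (nat \<bar>int i - int i'\<bar> + 1) (of_real r)
      else g (of_real r) ^ (N - (i + i' + 1)) * cl (i + i' + 1) (of_real r)))"
    unfolding E_def len_def by (intro sum.cong refl) auto
  finally show ?thesis .
qed

text \<open>In the block form each of the \<open>M\<close> rows of blocks has one diagonal block,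
  contributing \<open>B\<close>, and \<open>M - 1\<close> equal off-diagonal blocks, contributing
  \<open>?H\<close>. Neither depends on \<open>M\<close>, so a negative real part of
  \<open>?H\<close> would win for large \<open>M\<close>.\<close>

lemma hankel_nonneg:
  fixes q :: "nat \<Rightarrow> complex"
  assumes g: "laurent g" "\<And>z. cmod z = 1 \<Longrightarrow> f z = g z" and r: "r > 0"
    and G: "g (of_real r) = of_real G" "G > 0"
  shows "0 \<le> Re (\<Sum>i\<le>D. \<Sum>i'\<le>D. cnj (q i) * q i' *
      ((\<Prod>k<i + i' + 1. g (of_real r * rou (i + i' + 1) ^ k)) / of_real G ^ (i + i' + 1)))"
    (is "0 \<le> Re ?H")
proof (rule ccontr)
  assume neg: "\<not> 0 \<le> Re ?H"
  define c where "c l = (\<Prod>k<l. g (of_real r * rou l ^ k)) / of_real G ^ l" for l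
  define B where "B = (\<Sum>i\<le>D. \<Sum>i'\<le>D. cnj (q i) * q i' * c (nat \<bar>int i - int i'\<bar> + 1))"
  have H: "?H = (\<Sum>i\<le>D. \<Sum>i'\<le>D. cnj (q i) * q i' * c (i + i' + 1))" by (simp only: c_def)
  have main: "0 \<le> real (M - 1) * Re ?H + Re B" if M: "M \<ge> 2" for M
  proof -
    define N where "N = 1 + M * D"
    have NM: "i + i' + 1 \<le> N" if "i \<le> D" "i' \<le> D" for i i'
    proof -
      have "2 * D \<le> M * D" using M by (intro mult_le_mono) auto
      then show ?thesis using that unfolding N_def by linarith
    qed
    \<comment> \<open>Dividing by the matching power of \<open>G\<close> makes the entry independent
      of \<open>N\<close>, up to the common positive factor \<open>G ^ N\<close>.\<close>
    have pw: "g (of_real r) ^ (N - l) * (\<Prod>k<l. g (of_real r * rou l ^ k)) = of_real (G ^ N) * c l"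
      if "l \<le> N" for l
    proof -
      have "complex_of_real (G ^ N) = of_real G ^ (N - l) * of_real G ^ l"
        using that by (simp flip: power_add)
      then show ?thesis using G by (simp add: c_def)
    qed
    have "(\<Sum>m<M. \<Sum>m'<M. \<Sum>i\<le>D. \<Sum>i'\<le>D. cnj (q i) * q i' *
     (if m = m' then g (of_real r) ^ (N - (nat \<bar>int i - int i'\<bar> + 1)) *
          (\<Prod>k<nat \<bar>int i - int i'\<bar> + 1. g (of_real r * rou (nat \<bar>int i - int i'\<bar> + 1) ^ k))
      else g (of_real r) ^ (N - (i + i' + 1)) * (\<Prod>k<i + i' + 1. g (of_real r * rou (i + i' + 1) ^ k))))
     = (\<Sum>m<M. \<Sum>m'<M. of_real (G ^ N) * (if m = m' then B else ?H))"
    proof (intro sum.cong refl)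
      fix m m' :: nat
      have l1: "nat \<bar>int i - int i'\<bar> + 1 \<le> N" if "i \<le> D" "i' \<le> D" for i i' using NM[OF that] by linarith
      show "(\<Sum>i\<le>D. \<Sum>i'\<le>D. cnj (q i) * q i' *
     (if m = m' then g (of_real r) ^ (N - (nat \<bar>int i - int i'\<bar> + 1)) *
          (\<Prod>k<nat \<bar>int i - int i'\<bar> + 1. g (of_real r * rou (nat \<bar>int i - int i'\<bar> + 1) ^ k))
      else g (of_real r) ^ (N - (i + i' + 1)) * (\<Prod>k<i + i' + 1. g (of_real r * rou (i + i' + 1) ^ k))))
       = of_real (G ^ N) * (if m = m' then B else ?H)"
      proof (cases "m = m'")
        case True
        show ?thesis unfolding B_def if_P[OF True] sum_distrib_left
        proof (intro sum.cong refl)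
          fix i i' assume "i \<in> {..D}" "i' \<in> {..D}"
          then have le: "i \<le> D" "i' \<le> D" by simp_all
          show "cnj (q i) * q i' * (g (of_real r) ^ (N - (nat \<bar>int i - int i'\<bar> + 1)) *
              (\<Prod>k<nat \<bar>int i - int i'\<bar> + 1. g (of_real r * rou (nat \<bar>int i - int i'\<bar> + 1) ^ k)))
            = of_real (G ^ N) * (cnj (q i) * q i' * c (nat \<bar>int i - int i'\<bar> + 1))"
            unfolding pw[OF l1[OF le]] by (rule mult.left_commute)
        qed
      next
        case False
        show ?thesis unfolding H if_not_P[OF False] sum_distrib_left
        proof (intro sum.cong refl)
          fix i i' assume "i \<in> {..D}" "i' \<in> {..D}"
          then have le: "i \<le> D" "i' \<le> D" by simp_all
          show "cnj (q i) * q i' * (g (of_real r) ^ (N - (i + i' + 1)) *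
              (\<Prod>k<i + i' + 1. g (of_real r * rou (i + i' + 1) ^ k)))
            = of_real (G ^ N) * (cnj (q i) * q i' * c (i + i' + 1))"
            unfolding pw[OF NM[OF le]] by (rule mult.left_commute)
        qed
      qed
    qed
    also have "\<dots> = (\<Sum>m<M. of_real (G ^ N) * (B + of_nat (M - 1) * ?H))"
    proof (intro sum.cong refl)
      fix m assume m: "m \<in> {..<M}"
      have "(\<Sum>m'<M. of_real (G ^ N) * (if m = m' then B else ?H))
         = of_real (G ^ N) * B + (\<Sum>m'\<in>{..<M} - {m}. of_real (G ^ N) * ?H)"
      proof -
        have "(\<Sum>m'<M. of_real (G ^ N) * (if m = m' then B else ?H))
         = of_real (G ^ N) * (if m = m then B else ?H) + (\<Sum>m'\<in>{..<M} - {m}. of_real (G ^ N) * (if m = m' then B else ?H))"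
          by (rule sum.remove) (use m in simp_all)
        also have "(\<Sum>m'\<in>{..<M} - {m}. of_real (G ^ N) * (if m = m' then B else ?H))
          = (\<Sum>m'\<in>{..<M} - {m}. of_real (G ^ N) * ?H)"
          by (intro sum.cong refl) auto
        finally show ?thesis by (simp only: if_True refl)
      qed
      also have "(\<Sum>m'\<in>{..<M} - {m}. of_real (G ^ N) * ?H) = of_nat (M - 1) * (of_real (G ^ N) * ?H)"
        using m by (simp only: sum_constant card_Diff_singleton card_lessThan)
      also have "of_real (G ^ N) * B + \<dots> = of_real (G ^ N) * (B + of_nat (M - 1) * ?H)"
        by (simp only: distrib_left mult.left_commute)
      finally show "(\<Sum>m'<M. of_real (G ^ N) * (if m = m' then B else ?H))
         = of_real (G ^ N) * (B + of_nat (M - 1) * ?H)" .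
    qed
    also have "\<dots> = of_real (real M * G ^ N) * (B + of_nat (M - 1) * ?H)"
      by (simp only: sum_constant card_lessThan of_real_mult of_real_of_nat_eq mult.assoc)
    finally have "0 \<le> Re (of_real (real M * G ^ N) * (B + of_nat (M - 1) * ?H))"
      using hankel_block[OF g r M, of q D] unfolding N_def[symmetric] by (simp only:)
    moreover have re: "Re (of_real x * y) = x * Re y" for x y by simp
    moreover have "real M * G ^ N > 0" using G M by simp
    ultimately have "0 \<le> Re (B + of_nat (M - 1) * ?H)"
      unfolding re zero_le_mult_iff by linarith
    moreover have "Re (of_nat n * y) = real n * Re y" for n y by simp
    ultimately show ?thesis by (simp only: plus_complex.sel add.commute)
  qed
  obtain n :: nat where n: "Re B < real n * (- Re ?H)"
    using neg reals_Archimedean3[of "- Re ?H"] by (meson neg_0_less_iff_less not_le)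
  have "real n * (- Re ?H) \<le> real (n + 2 - 1) * (- Re ?H)"
    by (rule mult_right_mono) (use neg in linarith)+
  then show False using n main[of "n + 2"] by linarith
qed

end

section \<open>The nonzero roots of F are negative\<close>

text \<open>For \<open>y = 1\<close> both sides are monic of degree \<open>l\<close> in
  \<open>x\<close> and agree at the \<open>l\<close> roots of unity; the general case follows by
  homogeneity.\<close>

lemma prod_rou_diff:
  assumes "l > 0"
  shows "(\<Prod>k<l. x - rou l ^ k * y) = x ^ l - y ^ l"
proof -
  define p where "p = (\<Prod>k<l. [:- (rou l ^ k), 1:])"
  have inj: "inj_on (\<lambda>k. rou l ^ k) {..<l}"
  proof (rule inj_onI)
    fix a b assume ab: "a \<in> {..<l}" "b \<in> {..<l}" "rou l ^ a = rou l ^ b"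
    have "rou l powi (int a - int b) = 1"
      using ab(3) by (simp add: power_int_diff)
    moreover have "\<bar>int a - int b\<bar> < int l" using ab by auto
    ultimately show "a = b" using rou_pow_eq_1[OF assms, of "int a - int b"] by simp
  qed
  have degp: "degree p = l" "lead_coeff p = 1"
    unfolding p_def by (subst degree_prod_eq_sum_degree) (auto simp: lead_coeff_prod)
  have "p = monom 1 l - [:1:]"
  proof (rule poly_eqI_degree_lead_coeff[where n = l and A = "(\<lambda>k. rou l ^ k) ` {..<l}"])
    fix z assume "z \<in> (\<lambda>k. rou l ^ k) ` {..<l}"
    then obtain k where k: "k < l" "z = rou l ^ k" by auto
    have "z ^ l = 1" unfolding k power_mult[symmetric] mult.commute[of k]
      by (simp add: power_mult rou_pow_self[OF assms])
    moreover have "poly p z = 0" using k by (auto simp: p_def poly_prod)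
    ultimately show "poly p z = poly (monom 1 l - [:1:]) z" by (simp add: poly_monom)
  next
    show "coeff p l = coeff (monom 1 l - [:1:]) l" using degp assms by (simp add: coeff_pCons split: nat.splits)
    show "degree (monom 1 l - [:1:] :: complex poly) \<le> l"
      by (intro degree_diff_le) (auto simp: degree_monom_le)
  qed (use degp inj in \<open>auto simp: card_image\<close>)
  then have key: "(\<Prod>k<l. z - rou l ^ k) = z ^ l - 1" for z
  proof -
    assume "p = monom 1 l - [:1:]"
    then have "poly p z = poly (monom 1 l - [:1:]) z" by simp
    then show ?thesis by (simp add: p_def poly_prod poly_monom)
  qed
  show ?thesis
  proof (cases "y = 0")
    case False
    have "(\<Prod>k<l. x - rou l ^ k * y) = (\<Prod>k<l. y * (x / y - rou l ^ k))"
      using False by (intro prod.cong refl) (simp add: field_simps)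
    also have "\<dots> = y ^ l * ((x / y) ^ l - 1)" by (simp add: prod.distrib key)
    also have "\<dots> = x ^ l - y ^ l" using False by (simp add: field_simps)
    finally show ?thesis .
  qed (use assms in simp)
qed

lemma prod_powi_distrib: "(\<Prod>k\<in>K. (h k :: complex) powi a) = (\<Prod>k\<in>K. h k) powi a"
  by (induction K rule: infinite_finite_induct) (auto simp: power_int_mult_distrib)

lemma poly_interpolation_exists:
  fixes v :: "'a::field \<Rightarrow> 'a"
  assumes "finite S" shows "\<exists>Q. \<forall>x\<in>S. poly Q x = v x"
  using assms
proof induction
  case (insert a S)
  then obtain Q where Q: "\<forall>x\<in>S. poly Q x = v x" by blast
  define L where "L = (\<Prod>y\<in>S. [:- y, 1:])"
  have L0: "poly L a \<noteq> 0" using insert by (auto simp: L_def poly_prod)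
  have LS: "poly L x = 0" if "x \<in> S" for x using that insert by (auto simp: L_def poly_prod)
  show ?case
    by (rule exI[of _ "Q + smult ((v a - poly Q a) / poly L a) L"]) (use L0 LS Q in auto)
qed simp

text \<open>The Hankel form of the moment sequence of a point mass at \<open>x\<close>. It is a
  squared modulus for real \<open>x\<close>; for nonreal \<open>x\<close> it couples the values of
  \<open>Q\<close> at \<open>x\<close> and at its conjugate, which can be prescribed
  independently.\<close>

lemma sum_cnj_coeff:
  "(\<Sum>i\<le>degree Q. \<Sum>j\<le>degree Q. cnj (coeff Q i) * coeff Q j * x ^ (i + j)) = cnj (poly Q (cnj x)) * poly Q x"
proof -
  have c: "cnj (poly Q (cnj x)) = (\<Sum>i\<le>degree Q. cnj (coeff Q i) * x ^ i)"
    by (simp add: poly_altdef)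
  show ?thesis
    unfolding c unfolding poly_altdef[of Q x] sum_product
    by (intro sum.cong refl) (simp only: power_add mult_ac)
qed

definition lpoly :: "(int \<Rightarrow> nat) \<Rightarrow> 'a::field_char_0 \<Rightarrow> 'a" where
  "lpoly \<chi> z = (\<Sum>k\<in>{k. \<chi> k \<noteq> 0}. of_nat (\<chi> k) * z powi k)"

lemma laurent_lpoly: "laurent (lpoly \<chi>)"
  unfolding lpoly_def by (intro laurent_sum laurent_mult laurent_const laurent_powi)

lemma lpoly_pos:
  assumes "finite {k. \<chi> k \<noteq> 0}" "{k. \<chi> k \<noteq> 0} \<noteq> {}" "r > 0"
  obtains G where "lpoly \<chi> (of_real r :: complex) = of_real G" "G > 0"
proof
  show "lpoly \<chi> (of_real r :: complex) = of_real (\<Sum>k\<in>{k. \<chi> k \<noteq> 0}. real (\<chi> k) * r powi k)"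
    by (simp add: lpoly_def)
  show "0 < (\<Sum>k\<in>{k. \<chi> k \<noteq> 0}. real (\<chi> k) * r powi k)"
    using assms by (intro sum_pos) auto
qed

context expfun
begin

text \<open>Positive real roots are impossible since the coefficients are nonnegative. For a nonreal
  root, the products over circles of radius \<open>r\<close> are signed power sums of numbers
  \<open>\<delta> X\<close>, one for each subset \<open>X\<close> of the roots, and a suitable
  \<open>Q\<close> makes the resulting Hankel form strictly negative.\<close>

lemma roots_negative:
  assumes fin: "finite {k. \<chi> k \<noteq> 0}" and ne: "{k. \<chi> k \<noteq> 0} \<noteq> {}"
    and fg: "\<And>z. cmod z = 1 \<Longrightarrow> f z = lpoly \<chi> z"
    and root: "lpoly \<chi> \<rho> = 0" "\<rho> \<noteq> 0"
  shows "Im \<rho> = 0 \<and> Re \<rho> < 0"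
proof (cases "Im \<rho> = 0")
  case True
  then have re: "\<rho> = of_real (Re \<rho>)" by (simp add: complex_eq_iff)
  have "\<not> 0 < Re \<rho>"
  proof
    assume "0 < Re \<rho>"
    then obtain G where "lpoly \<chi> (of_real (Re \<rho>) :: complex) = of_real G" "G > 0" using lpoly_pos[OF fin ne] by blast
    then show False using root(1) re by simp
  qed
  moreover have "Re \<rho> \<noteq> 0" using root(2) re by auto
  ultimately show ?thesis using True by linarith
next
  case False
  define lo where "lo = Min {k. \<chi> k \<noteq> 0}"
  have lo: "\<chi> lo \<noteq> 0" "\<And>k. \<chi> k \<noteq> 0 \<Longrightarrow> lo \<le> k"
    using Min_in[OF fin ne] Min_le[OF fin] by (auto simp: lo_def)
  \<comment> \<open>Removing the lowest power leaves a polynomial with nonzero constant coefficient,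
    so that none of its roots is 0.\<close>
  define P where "P = (\<Sum>k\<in>{k. \<chi> k \<noteq> 0}. monom (of_nat (\<chi> k) :: complex) (nat (k - lo)))"
  have gP: "lpoly \<chi> (z :: complex) = z powi lo * poly P z" if "z \<noteq> 0" for z
    unfolding lpoly_def P_def poly_sum poly_monom sum_distrib_left
  proof (intro sum.cong refl)
    fix k assume "k \<in> {k. \<chi> k \<noteq> 0}"
    then have "int (nat (k - lo)) = k - lo" using lo(2)[of k] by simp
    then have "z powi lo * z ^ nat (k - lo) = z powi k"
      using that by (simp flip: power_int_of_nat power_int_add)
    then show "of_nat (\<chi> k) * z powi k = z powi lo * (of_nat (\<chi> k) * z ^ nat (k - lo))"
      by (simp add: mult_ac)
  qed
  have P0: "poly P 0 = of_nat (\<chi> lo)"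
  proof -
    have "poly P 0 = (\<Sum>k\<in>{k. \<chi> k \<noteq> 0}. if k = lo then of_nat (\<chi> lo) else 0)"
      unfolding P_def poly_sum poly_monom
    proof (intro sum.cong refl)
      fix k assume "k \<in> {k. \<chi> k \<noteq> 0}"
      then have "lo \<le> k" using lo(2) by simp
      then show "of_nat (\<chi> k) * 0 ^ nat (k - lo) = (if k = lo then of_nat (\<chi> lo) else 0 :: complex)"
        by (cases "k = lo") (simp_all add: power_0_left)
    qed
    also have "\<dots> = of_nat (\<chi> lo)" using fin lo by simp
    finally show ?thesis .
  qed
  obtain A xs where fact: "smult A (\<Prod>x\<leftarrow>xs. [:- x, 1:]) = P"
    using fundamental_theorem_algebra_factorized[of P] by blast
  define n where "n = length xs"
  define rt where "rt i = xs ! i" for i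
  have polyP: "poly P z = A * (\<Prod>i<n. z - rt i)" for z
    unfolding fact[symmetric] by (simp add: poly_prod_list poly_prod prod.list_conv_set_nth n_def rt_def lessThan_atLeast0 o_def)
  have rt0: "rt i \<noteq> 0" if "i < n" for i
  proof
    assume "rt i = 0"
    then have "(\<Prod>i<n. 0 - rt i) = 0" using that by (intro prod_zero) auto
    then have "poly P 0 = 0" by (simp only: polyP mult_zero_right)
    then show False using P0 lo(1) by simp
  qed
  obtain i0 where i0: "i0 < n" "rt i0 = \<rho>"
  proof -
    have "poly P \<rho> = 0" using gP[OF root(2)] root by simp
    moreover have "A \<noteq> 0" using polyP[of 0] P0 lo(1) by auto
    ultimately have "(\<Prod>i<n. \<rho> - rt i) = 0" using polyP[of \<rho>] by simp
    then have "\<exists>i<n. \<rho> - rt i = 0" by (simp add: prod_zero_iff Bex_def)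
    then show ?thesis using that by auto
  qed
  define m where "m = Min ((\<lambda>i. cmod (rt i)) ` {..<n})"
  have m: "m > 0" "\<And>i. i < n \<Longrightarrow> m \<le> cmod (rt i)"
  proof -
    have "m \<in> (\<lambda>i. cmod (rt i)) ` {..<n}" unfolding m_def by (rule Min_in) (use i0 in auto)
    then show "m > 0" using rt0 by auto
    show "m \<le> cmod (rt i)" if "i < n" for i unfolding m_def by (rule Min_le) (use that in auto)
  qed
  \<comment> \<open>Two inequalities fix this choice: \<open>r < m\<close> makes
    \<open>r / cmod \<rho>\<close> smaller than 1, and \<open>r * cmod \<rho> < m\<^sup>2\<close>
    makes it larger than \<open>(r / m)\<^sup>2\<close>. They separate one omitted root from none
    and from several.\<close>
  define r where "r = m\<^sup>2 / (2 * cmod \<rho>)"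
  have mrho: "m \<le> cmod \<rho>" using m(2)[of i0] i0 by simp
  have r: "r > 0" "r * cmod \<rho> < m\<^sup>2" "r < m"
  proof -
    show "r > 0" "r * cmod \<rho> < m\<^sup>2" using m(1) root(2) by (auto simp: r_def field_simps)
    have "m\<^sup>2 \<le> m * cmod \<rho>" using m(1) mrho by (simp add: power2_eq_square)
    then have "r \<le> m / 2" using root(2) by (simp add: r_def divide_simps)
    then show "r < m" using m(1) by simp
  qed
  obtain G where G: "lpoly \<chi> (of_real r :: complex) = of_real G" "G > 0" using lpoly_pos[OF fin ne r(1)] by blast
  \<comment> \<open>The sign \<open>(-1) powi lo\<close>, left over from the factor
    \<open>z powi lo\<close> because the product of the points of the circle is minus the
    \<open>l\<close>-th power of \<open>- r\<close>.\<close>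
  define s where "s = (if even lo then 1 else -1 :: real)"
  have ss: "s * s = 1" by (simp add: s_def)
  define \<delta> where "\<delta> X = A * (- of_real r) powi lo * (\<Prod>i\<in>X. - rt i) * (- of_real r) ^ (n - card X) / of_real G" for X
  have cl: "(\<Prod>k<l. lpoly \<chi> (of_real r * rou l ^ k)) / of_real G ^ l = of_real s * (\<Sum>X\<in>Pow {..<n}. (-1) ^ (n - card X) * \<delta> X ^ l)"
    if l: "l > 0" for l
  proof -
    \<comment> \<open>The product of all points \<open>r * rou l ^ k\<close>. It appears in the
      factor \<open>z powi lo\<close> and again in each root factor, so that expanding the product
      over the roots yields the sum over subsets \<open>X\<close>.\<close>
    define e where "e = - ((- of_real r) ^ l :: complex)"
    have "(\<Prod>k<l. lpoly \<chi> (of_real r * rou l ^ k))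
       = (\<Prod>k<l. (of_real r * rou l ^ k) powi lo * (A * (\<Prod>i<n. of_real r * rou l ^ k - rt i)))"
      using r by (intro prod.cong refl) (simp add: gP polyP)
    also have "\<dots> = (\<Prod>k<l. of_real r * rou l ^ k) powi lo * A ^ l * (\<Prod>i<n. \<Prod>k<l. of_real r * rou l ^ k - rt i)"
      unfolding prod.distrib prod_powi_distrib by (simp add: prod.swap[of _ "{..<l}"] mult.assoc)
    also have "(\<Prod>k<l. of_real r * rou l ^ k) = e"
      using prod_rou_diff[OF l, of 0 "- of_real r"] l by (simp add: e_def mult.commute)
    also have "(\<lambda>i. \<Prod>k<l. of_real r * rou l ^ k - rt i) = (\<lambda>i. (- rt i) ^ l + e)"
    proof
      fix i
      have "(\<Prod>k<l. of_real r * rou l ^ k - rt i) = (\<Prod>k<l. - rt i - rou l ^ k * (- of_real r))"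
        by (intro prod.cong refl) (simp add: mult.commute)
      also have "\<dots> = (- rt i) ^ l - (- of_real r) ^ l" by (rule prod_rou_diff[OF l])
      finally show "(\<Prod>k<l. of_real r * rou l ^ k - rt i) = (- rt i) ^ l + e"
        by (simp add: e_def)
    qed
    also have "(\<Prod>i<n. (- rt i) ^ l + e) = (\<Sum>X\<in>Pow {..<n}. (\<Prod>i\<in>X. (- rt i) ^ l) * (\<Prod>i\<in>{..<n} - X. e))"
      by (rule prod_add) simp
    also have "\<dots> = (\<Sum>X\<in>Pow {..<n}. (-1) ^ (n - card X) * ((\<Prod>i\<in>X. - rt i) * (- of_real r) ^ (n - card X)) ^ l)"
    proof (intro sum.cong refl)
      fix X assume "X \<in> Pow {..<n}"
      then have "card ({..<n} - X) = n - card X" by (simp add: card_Diff_subset finite_subset)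
      moreover have "e ^ j = (-1) ^ j * ((- of_real r) ^ j) ^ l" for j
        by (simp add: e_def power_minus[of "(- of_real r) ^ l"] power_mult[symmetric] mult.commute)
      ultimately show "(\<Prod>i\<in>X. (- rt i) ^ l) * (\<Prod>i\<in>{..<n} - X. e) = (-1) ^ (n - card X) * ((\<Prod>i\<in>X. - rt i) * (- of_real r) ^ (n - card X)) ^ l"
        by (simp add: prod_power_distrib power_mult_distrib)
    qed
    also have "e powi lo = of_real s * ((- of_real r) powi lo) ^ l"
    proof -
      have "e powi lo = (-1) powi lo * ((- of_real r) ^ l) powi lo"
        unfolding power_int_mult_distrib[symmetric] by (simp add: e_def)
      also have "((- of_real r :: complex) ^ l) powi lo = ((- of_real r) powi lo) ^ l"
        unfolding power_int_of_nat[symmetric] power_int_mult[symmetric] by (simp only: mult.commute)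
      finally show ?thesis by (simp add: s_def power_int_minus_left)
    qed
    finally have "(\<Prod>k<l. lpoly \<chi> (of_real r * rou l ^ k)) = of_real s * ((- of_real r) powi lo) ^ l * A ^ l *
        (\<Sum>X\<in>Pow {..<n}. (-1) ^ (n - card X) * ((\<Prod>i\<in>X. - rt i) * (- of_real r) ^ (n - card X)) ^ l)" .
    then show ?thesis
      unfolding \<delta>_def sum_distrib_left sum_divide_distrib
      by (simp add: power_mult_distrib power_divide sum_distrib_left sum_divide_distrib mult_ac)
  qed
  define \<delta>I where "\<delta>I = \<delta> {..<n}"
  \<comment> \<open>The value for the full set is real, because \<open>A\<close> times the product
    of the \<open>- rt i\<close> is the constant coefficient \<open>\<chi> lo\<close>. A nonreal
    \<open>\<rho>\<close> therefore gives a nonreal \<open>\<delta>1\<close>.\<close>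
  have \<delta>I: "\<delta>I = of_real ((- r) powi lo * real (\<chi> lo) / G)"
  proof -
    have "A * (\<Prod>i<n. - rt i) = of_nat (\<chi> lo)" using polyP[of 0] P0 by simp
    then have "\<delta>I = (- of_real r) powi lo * of_nat (\<chi> lo) / of_real G"
      unfolding \<delta>I_def \<delta>_def by (simp add: mult.commute mult.left_commute)
    then show ?thesis by simp
  qed
  have \<delta>I0: "\<delta>I \<noteq> 0" using r(1) lo(1) G unfolding \<delta>I by simp
  have \<delta>X: "\<delta> X = \<delta>I * (\<Prod>i\<in>{..<n} - X. of_real r / rt i)" if "X \<subseteq> {..<n}" for X
  proof -
    have fX: "finite X" using that finite_subset by blast
    have "(\<Prod>i<n. - rt i) = (\<Prod>i\<in>{..<n} - X. - rt i) * (\<Prod>i\<in>X. - rt i)"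
      using that by (intro prod.subset_diff) auto
    moreover have "(\<Prod>i\<in>{..<n} - X. of_real r / rt i) * (\<Prod>i\<in>{..<n} - X. - rt i) = (- of_real r) ^ (n - card X)"
    proof -
      have "(\<Prod>i\<in>{..<n} - X. of_real r / rt i) * (\<Prod>i\<in>{..<n} - X. - rt i) = (\<Prod>i\<in>{..<n} - X. - of_real r)"
        unfolding prod.distrib[symmetric] using rt0 by (intro prod.cong refl) auto
      then show ?thesis using that fX by (simp add: card_Diff_subset)
    qed
    ultimately show ?thesis unfolding \<delta>I_def \<delta>_def by (simp add: mult_ac)
  qed
  define \<delta>1 where "\<delta>1 = \<delta>I * (of_real r / \<rho>)"
  have cnj1: "cnj \<delta>1 = \<delta>I * (of_real r / cnj \<rho>)" unfolding \<delta>1_def \<delta>I by simp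
  have \<delta>1ne: "\<delta>1 \<noteq> cnj \<delta>1" "\<delta>1 \<noteq> 0"
  proof -
    have "\<rho> \<noteq> cnj \<rho>" using False by (auto simp: complex_eq_iff)
    then show "\<delta>1 \<noteq> cnj \<delta>1" unfolding cnj1 using \<delta>I0 r(1) root(2) by (auto simp: \<delta>1_def field_simps)
    show "\<delta>1 \<noteq> 0" using \<delta>I0 r(1) root(2) by (auto simp: \<delta>1_def)
  qed
  \<comment> \<open>The modulus of \<open>\<delta> X\<close> relative to \<open>\<delta>I\<close> is
    the product of \<open>r / cmod (rt i)\<close> over the omitted roots. By the choice of
    \<open>r\<close> it can equal \<open>r / cmod \<rho>\<close> only if exactly one root is
    omitted, so all relevant terms have the sign -1.\<close>
  have card1: "n - card X = 1" if X: "X \<subseteq> {..<n}" and "\<delta> X = \<delta>1 \<or> \<delta> X = cnj \<delta>1" for X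
  proof -
    define k where "k = card ({..<n} - X)"
    have "cmod (\<delta> X) = cmod \<delta>1" using that(2) by auto
    then have "cmod \<delta>I * (\<Prod>i\<in>{..<n} - X. r / cmod (rt i)) = cmod \<delta>I * (r / cmod \<rho>)"
      using r(1) unfolding \<delta>X[OF X] \<delta>1_def norm_mult norm_divide prod_norm[symmetric] by simp
    then have eq: "(\<Prod>i\<in>{..<n} - X. r / cmod (rt i)) = r / cmod \<rho>" using \<delta>I0
      by (simp only: mult_left_cancel[of "cmod \<delta>I"] norm_eq_zero not_False_eq_True)
    have "k \<noteq> 0"
    proof
      assume "k = 0"
      then have "{..<n} - X = {}" unfolding k_def by (rule card_eq_0_iff[THEN iffD1, THEN disjE]) auto
      then have "r / cmod \<rho> = 1" using eq by (simp only: prod.empty)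
      then have "r = cmod \<rho>" using root(2) by (simp add: field_simps)
      then show False using r(3) mrho by simp
    qed
    moreover have "\<not> k \<ge> 2"
    proof
      assume k: "k \<ge> 2"
      have "(\<Prod>i\<in>{..<n} - X. r / cmod (rt i)) \<le> (\<Prod>i\<in>{..<n} - X. r / m)"
        using m r(1) by (intro prod_mono) (auto intro!: divide_left_mono mult_pos_pos simp: rt0)
      also have "\<dots> = (r / m) ^ k" by (simp add: k_def)
      also have "\<dots> \<le> (r / m) ^ 2" using k m(1) r by (intro power_decreasing) auto
      also have "\<dots> < r / cmod \<rho>" using m(1) r root(2) by (simp add: field_simps power2_eq_square)
      finally show False using eq by simp
    qed
    ultimately have "k = 1" by linarith
    then show ?thesis using X by (simp add: k_def card_Diff_subset finite_subset)
  qed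
  \<comment> \<open>With the values 1 at \<open>\<delta>1\<close> and \<open>w\<close> at its
    conjugate, every term with \<open>\<delta> X\<close> equal to either point becomes minus the
    squared modulus of \<open>\<delta>1\<close>; \<open>Q\<close> vanishes at all other
    points.\<close>
  define w where "w = of_real s * \<delta>1"
  obtain Q where Q: "\<forall>x\<in>\<delta> ` Pow {..<n} \<union> {\<delta>1, cnj \<delta>1}. poly Q x = (if x = \<delta>1 then 1 else if x = cnj \<delta>1 then w else 0)"
    using poly_interpolation_exists[of "\<delta> ` Pow {..<n} \<union> {\<delta>1, cnj \<delta>1}"
        "\<lambda>x. if x = \<delta>1 then 1 else if x = cnj \<delta>1 then w else 0"] by auto
  have Q1: "poly Q \<delta>1 = 1" "poly Q (cnj \<delta>1) = w" using Q \<delta>1ne by auto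
  define t where "t X = of_real s * ((-1) ^ (n - card X) * (\<delta> X * (cnj (poly Q (cnj (\<delta> X))) * poly Q (\<delta> X))))" for X
  have "0 \<le> Re (\<Sum>i\<le>degree Q. \<Sum>i'\<le>degree Q. cnj (coeff Q i) * coeff Q i' *
      ((\<Prod>k<i + i' + 1. lpoly \<chi> (of_real r * rou (i + i' + 1) ^ k)) / of_real G ^ (i + i' + 1)))"
    by (rule hankel_nonneg[OF laurent_lpoly fg r(1) G])
  also have "(\<Sum>i\<le>degree Q. \<Sum>i'\<le>degree Q. cnj (coeff Q i) * coeff Q i' *
      ((\<Prod>k<i + i' + 1. lpoly \<chi> (of_real r * rou (i + i' + 1) ^ k)) / of_real G ^ (i + i' + 1)))
    = (\<Sum>i\<le>degree Q. \<Sum>i'\<le>degree Q. \<Sum>X\<in>Pow {..<n}. (of_real s * (-1) ^ (n - card X) * \<delta> X) *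
        (cnj (coeff Q i) * coeff Q i' * \<delta> X ^ (i + i')))"
    by (subst cl) (simp_all add: sum_distrib_left mult_ac)
  also have "\<dots> = (\<Sum>X\<in>Pow {..<n}. \<Sum>i\<le>degree Q. \<Sum>i'\<le>degree Q. (of_real s * (-1) ^ (n - card X) * \<delta> X) *
        (cnj (coeff Q i) * coeff Q i' * \<delta> X ^ (i + i')))"
  proof -
    have "(\<Sum>i\<le>a. \<Sum>i'\<le>a. \<Sum>X\<in>Y. F i i' X) = (\<Sum>X\<in>Y. \<Sum>i\<le>a. \<Sum>i'\<le>a. F i i' X)"
      for a :: nat and Y and F :: "nat \<Rightarrow> nat \<Rightarrow> nat set \<Rightarrow> complex"
    proof -
      have "(\<Sum>i\<le>a. \<Sum>i'\<le>a. \<Sum>X\<in>Y. F i i' X) = (\<Sum>i\<le>a. \<Sum>X\<in>Y. \<Sum>i'\<le>a. F i i' X)"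
        by (intro sum.cong refl sum.swap)
      also have "\<dots> = (\<Sum>X\<in>Y. \<Sum>i\<le>a. \<Sum>i'\<le>a. F i i' X)" by (rule sum.swap)
      finally show ?thesis .
    qed
    then show ?thesis .
  qed
  also have "\<dots> = (\<Sum>X\<in>Pow {..<n}. t X)"
    unfolding sum_distrib_left[symmetric] sum_cnj_coeff t_def by (simp only: mult.assoc sum_distrib_left)
  finally have "0 \<le> (\<Sum>X\<in>Pow {..<n}. Re (t X))" by simp
  also have "\<dots> \<le> (\<Sum>X\<in>Pow {..<n}. if X = {..<n} - {i0} then - (cmod \<delta>1)\<^sup>2 else 0)"
  proof (rule sum_mono)
    fix X assume X: "X \<in> Pow {..<n}"
    have sq: "Re (\<delta>1 * cnj \<delta>1) = (cmod \<delta>1)\<^sup>2" by (metis Re_complex_of_real complex_norm_square)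
    have b1: "Re (t X) = - (cmod \<delta>1)\<^sup>2" if c: "\<delta> X = \<delta>1 \<or> \<delta> X = cnj \<delta>1"
    proof -
      have c1: "n - card X = 1" using card1[OF _ c] X by auto
      have "t X = - (of_real (s * s) * (\<delta>1 * cnj \<delta>1))"
      proof (rule disjE[OF c])
        assume e: "\<delta> X = \<delta>1"
        show ?thesis unfolding t_def c1 e Q1 w_def by (simp add: mult_ac)
      next
        assume e: "\<delta> X = cnj \<delta>1"
        show ?thesis unfolding t_def c1 e complex_cnj_cnj Q1 w_def by (simp add: mult_ac)
      qed
      then have "t X = - (\<delta>1 * cnj \<delta>1)" by (simp only: ss of_real_1 mult_1)
      then show ?thesis using sq by simp
    qed
    show "Re (t X) \<le> (if X = {..<n} - {i0} then - (cmod \<delta>1)\<^sup>2 else 0)"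
    proof (cases "\<delta> X = \<delta>1 \<or> \<delta> X = cnj \<delta>1")
      case True
      then show ?thesis using b1 by simp
    next
      case nc: False
      then have "poly Q (\<delta> X) = 0" using Q X by auto
      then have "t X = 0" by (simp add: t_def)
      moreover have "X \<noteq> {..<n} - {i0}"
      proof
        assume "X = {..<n} - {i0}"
        moreover from this have "{..<n} - X = {i0}" using i0 by auto
        ultimately have "\<delta> X = \<delta>1" using \<delta>X[of X] i0 by (simp add: \<delta>1_def)
        then show False using nc by simp
      qed
      ultimately show ?thesis by simp
    qed
  qed
  also have "\<dots> = - (cmod \<delta>1)\<^sup>2" by (subst sum.delta) auto
  finally show ?thesis using \<delta>1ne by simp
qed

end

section \<open>Existence of the character\<close>

lemma upper_triangular_pow_diag:
  fixes B :: "complex mat"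
  assumes "B \<in> carrier_mat n n" "upper_triangular B"
  shows "(\<forall>i<n. \<forall>k<i. (B ^\<^sub>m j) $$ (i,k) = 0) \<and> (\<forall>i<n. (B ^\<^sub>m j) $$ (i,i) = (B $$ (i,i)) ^ j)"
proof (induction j)
  case 0
  then show ?case using assms(1) by auto
next
  case (Suc j)
  have c: "B ^\<^sub>m j \<in> carrier_mat n n" using assms(1) by simp
  have ut: "B $$ (i,k) = 0" if "k < i" "i < n" for i k
    using assms that by (auto simp: upper_triangular_def)
  have entry: "(B ^\<^sub>m Suc j) $$ (i,k) = (\<Sum>m\<in>{0..<n}. (B ^\<^sub>m j) $$ (i,m) * B $$ (m,k))"
    if "i < n" "k < n" for i k
    using that c assms(1) by (simp add: scalar_prod_def)
  have z: "(B ^\<^sub>m Suc j) $$ (i,k) = 0" if "i < n" "k < i" for i k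
    unfolding entry[OF that(1) less_trans[OF that(2,1)]]
  proof (intro sum.neutral ballI)
    fix m assume m: "m \<in> {0..<n}"
    show "(B ^\<^sub>m j) $$ (i,m) * B $$ (m,k) = 0"
      using Suc that m ut[of k m] by (cases "m < i") auto
  qed
  have dg: "(B ^\<^sub>m Suc j) $$ (i,i) = (B $$ (i,i)) ^ Suc j" if "i < n" for i
  proof -
    have "(B ^\<^sub>m Suc j) $$ (i,i) = (\<Sum>m\<in>{0..<n}. if m = i then (B $$ (i,i)) ^ j * B $$ (i,i) else 0)"
      unfolding entry[OF that that]
    proof (intro sum.cong refl)
      fix m assume m: "m \<in> {0..<n}"
      show "(B ^\<^sub>m j) $$ (i,m) * B $$ (m,i) = (if m = i then (B $$ (i,i)) ^ j * B $$ (i,i) else 0)"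
        using Suc that m ut[of i m] by (cases m i rule: linorder_cases) auto
    qed
    then show ?thesis using that by simp
  qed
  show ?case using z dg by blast
qed

text \<open>Schur triangularisation; the numbers \<open>ev i\<close> are the diagonal entries. One
  choice serves all powers \<open>j\<close>, and a power of \<open>U\<close> equal to the identity
  makes them roots of unity.\<close>

lemma mtrace_pow_eigenvalues:
  assumes U: "U \<in> carrier_mat n n"
  obtains ev :: "nat \<Rightarrow> complex" where "\<And>j. mtrace (U ^\<^sub>m j) = (\<Sum>i<n. ev i ^ j)"
    and "\<And>M i. U ^\<^sub>m M = 1\<^sub>m n \<Longrightarrow> i < n \<Longrightarrow> ev i ^ M = 1"
proof -
  obtain es where "char_poly U = (\<Prod>a\<leftarrow>es. [:- a, 1:])" using char_poly_factorized[OF U] by blast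
  then obtain B where B: "B \<in> carrier_mat n n" "upper_triangular B" "similar_mat U B"
    using schur_decomposition_exists[OF U] by blast
  obtain P Q where w: "similar_mat_wit U B P Q" using B(3) unfolding similar_mat_def by blast
  note wd = similar_mat_witD2[OF U w]
  have pw: "U ^\<^sub>m j = P * B ^\<^sub>m j * Q" for j by (rule similar_mat_wit_pow_id[OF w])
  have tr: "mtrace (U ^\<^sub>m j) = (\<Sum>i<n. (B $$ (i,i)) ^ j)" for j
  proof -
    have Bj: "B ^\<^sub>m j \<in> carrier_mat n n" using B by simp
    have "mtrace (U ^\<^sub>m j) = mtrace (Q * (P * B ^\<^sub>m j))"
      unfolding pw by (rule mtrace_mult_comm[of _ n n]) (use wd Bj in auto)
    also have "Q * (P * B ^\<^sub>m j) = B ^\<^sub>m j"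
      using wd Bj by (subst assoc_mult_mat[symmetric, of _ n n _ n _ n]) auto
    also have "mtrace (B ^\<^sub>m j) = (\<Sum>i<n. (B $$ (i,i)) ^ j)"
      using Bj upper_triangular_pow_diag[OF B(1,2), of j] by (auto simp: mtrace_def intro!: sum.cong)
    finally show ?thesis .
  qed
  have "(B $$ (i,i)) ^ M = 1" if "U ^\<^sub>m M = 1\<^sub>m n" "i < n" for M i
  proof -
    have Bj: "B ^\<^sub>m M \<in> carrier_mat n n" using B by simp
    have "B ^\<^sub>m M = Q * (P * B ^\<^sub>m M * Q) * P"
    proof -
      have "P * B ^\<^sub>m M * Q * P = P * B ^\<^sub>m M"
        using wd Bj by (subst assoc_mult_mat[of _ n n _ n _ n]) auto
      moreover have "Q * (P * B ^\<^sub>m M * Q) * P = Q * (P * B ^\<^sub>m M * Q * P)"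
        by (rule assoc_mult_mat[of _ n n _ n _ n]) (use wd Bj in auto)
      ultimately have "Q * (P * B ^\<^sub>m M * Q) * P = Q * (P * B ^\<^sub>m M)" by (simp only:)
      also have "\<dots> = B ^\<^sub>m M"
        using wd Bj by (subst assoc_mult_mat[symmetric, of _ n n _ n _ n]) auto
      finally show ?thesis by simp
    qed
    also have "\<dots> = 1\<^sub>m n" unfolding pw[symmetric] that(1) using wd by simp
    finally show ?thesis using upper_triangular_pow_diag[OF B(1,2), of M] that(2) by auto
  qed
  with tr show ?thesis using that[of "\<lambda>i. B $$ (i,i)"] by blast
qed

lemma rou_2_pow:
  assumes "n \<le> m" shows "rou (2 ^ m) ^ (2 ^ (m - n)) = rou (2 ^ n)"
proof -
  have "(2::real) ^ m = 2 ^ (m - n) * 2 ^ n" using assms by (simp flip: power_add)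
  then show ?thesis by (simp add: rou_def DeMoivre)
qed

text \<open>Exponents are centred at 0 so that a small rotation corresponds to a small exponent; the
  bound starts the doubling argument in \<open>weights_bounded\<close>.\<close>

lemma root_unity_centered:
  assumes "m > 0" "z ^ (2 ^ m) = 1"
  shows "\<exists>k. \<bar>k\<bar> \<le> 2 ^ (m - 1) \<and> z = rou (2 ^ m) powi k"
proof -
  obtain j where j: "j < 2 ^ m" "z = cis (2 * pi * real j / real (2 ^ m))"
    using bij_betw_imp_surj_on[OF bij_betw_roots_unity[of "2 ^ m"]] assms(2) by force
  have z: "z = rou (2 ^ m) powi int j"
    unfolding j rou_def power_int_of_nat DeMoivre by (simp add: field_simps)
  have mm: "(2::int) ^ m = 2 * 2 ^ (m - 1)" using assms(1) by (cases m) auto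
  show ?thesis
  proof (cases "int j \<le> 2 ^ (m - 1)")
    case True
    then show ?thesis using z by (intro exI[of _ "int j"]) auto
  next
    case False
    have "rou (2 ^ m) powi (int j - 2 ^ m) = rou (2 ^ m) powi int j / rou (2 ^ m) powi int (2 ^ m)"
      by (simp add: power_int_diff)
    also have "rou (2 ^ m) powi int (2 ^ m) = 1"
      unfolding power_int_of_nat by (rule rou_pow_self) simp
    finally have "z = rou (2 ^ m) powi (int j - 2 ^ m)" using z by simp
    moreover have "int j < 2 ^ m" using j(1) by (metis of_nat_less_iff of_nat_numeral of_nat_power)
    then have "\<bar>int j - 2 ^ m\<bar> \<le> 2 ^ (m - 1)" using False mm by linarith
    ultimately show ?thesis by blast
  qed
qed

text \<open>The distance bound keeps every exponent other than \<open>K\<close> in a residue class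
  modulo \<open>M\<close> different from that of \<open>K\<close>.\<close>

lemma lpoly_fourier:
  assumes "finite {k. \<chi> k \<noteq> 0}" "M > 0" "\<And>k. \<chi> k \<noteq> 0 \<Longrightarrow> \<bar>k - K\<bar> < int M"
  shows "(\<Sum>j<M. rou M powi (- (int j * K)) * lpoly \<chi> (rou M ^ j)) = of_nat M * of_nat (\<chi> K)"
proof -
  have "(\<Sum>j<M. rou M powi (- (int j * K)) * lpoly \<chi> (rou M ^ j))
     = (\<Sum>j<M. \<Sum>k\<in>{k. \<chi> k \<noteq> 0}. of_nat (\<chi> k) * rou M powi (int j * (k - K)))"
  proof (intro sum.cong refl)
    fix j
    have "rou M powi (- (int j * K)) * (rou M ^ j) powi k = rou M powi (int j * (k - K))" for k
    proof -
      have "(rou M ^ j) powi k = rou M powi (int j * k)"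
        by (simp only: power_int_of_nat[symmetric] power_int_mult)
      moreover have "- (int j * K) + int j * k = int j * (k - K)" by (simp add: algebra_simps)
      ultimately show ?thesis by (simp only: power_int_add[OF disjI1[OF rou_nz], symmetric])
    qed
    then show "rou M powi (- (int j * K)) * lpoly \<chi> (rou M ^ j)
      = (\<Sum>k\<in>{k. \<chi> k \<noteq> 0}. of_nat (\<chi> k) * rou M powi (int j * (k - K)))"
      unfolding lpoly_def sum_distrib_left by (intro sum.cong refl) (simp only: mult.left_commute)
  qed
  also have "\<dots> = (\<Sum>k\<in>{k. \<chi> k \<noteq> 0}. of_nat (\<chi> k) * (\<Sum>j<M. rou M powi (int j * (k - K))))"
    unfolding sum_distrib_left by (rule sum.swap)
  also have "\<dots> = (\<Sum>k\<in>{k. \<chi> k \<noteq> 0}. if k = K then of_nat (\<chi> K) * of_nat M else 0)"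
  proof (intro sum.cong refl)
    fix k assume "k \<in> {k. \<chi> k \<noteq> 0}"
    then show "of_nat (\<chi> k) * (\<Sum>j<M. rou M powi (int j * (k - K))) = (if k = K then of_nat (\<chi> K) * of_nat M else 0)"
      using sum_rou_powi[OF assms(2) assms(3), of k] by auto
  qed
  also have "\<dots> = of_nat M * of_nat (\<chi> K)" using assms(1) by (simp add: mult.commute)
  finally show ?thesis .
qed

lemma lpoly_unique:
  assumes "finite {k. \<chi> k \<noteq> 0}" "finite {k. \<chi>' k \<noteq> 0}" "\<And>z :: complex. cmod z = 1 \<Longrightarrow> lpoly \<chi> z = lpoly \<chi>' z"
  shows "\<chi> = \<chi>'"
proof
  fix K
  \<comment> \<open>Larger than the distance from \<open>K\<close> to every exponent of either
    function; inserting 0 keeps the maximum defined when both are zero.\<close>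
  define M where "M = Suc (nat (Max (insert 0 ((\<lambda>k. \<bar>k - K\<bar>) ` ({k. \<chi> k \<noteq> 0} \<union> {k. \<chi>' k \<noteq> 0})))))"
  have M: "\<bar>k - K\<bar> < int M" if "\<chi> k \<noteq> 0 \<or> \<chi>' k \<noteq> 0" for k
  proof -
    have "\<bar>k - K\<bar> \<le> Max (insert 0 ((\<lambda>k. \<bar>k - K\<bar>) ` ({k. \<chi> k \<noteq> 0} \<union> {k. \<chi>' k \<noteq> 0})))"
      by (rule Max_ge) (use assms that in auto)
    then show ?thesis unfolding M_def by linarith
  qed
  have "M > 0" by (simp add: M_def)
  have "(of_nat M * of_nat (\<chi> K) :: complex) = of_nat M * of_nat (\<chi>' K)"
  proof -
    have "(of_nat M * of_nat (\<chi> K) :: complex) = (\<Sum>j<M. rou M powi (- (int j * K)) * lpoly \<chi> (rou M ^ j))"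
      by (rule lpoly_fourier[OF assms(1) \<open>M > 0\<close> M[OF disjI1], symmetric])
    also have "\<dots> = (\<Sum>j<M. rou M powi (- (int j * K)) * lpoly \<chi>' (rou M ^ j))"
      by (intro sum.cong refl) (simp add: assms(3) norm_power)
    also have "\<dots> = of_nat M * of_nat (\<chi>' K)"
      by (rule lpoly_fourier[OF assms(2) \<open>M > 0\<close> M[OF disjI2]])
    finally show ?thesis .
  qed
  then have "(of_nat (\<chi> K) :: complex) = of_nat (\<chi>' K)" using \<open>M > 0\<close> by simp
  then show "\<chi> K = \<chi>' K" by (simp only: of_nat_eq_iff)
qed

context expfun
begin

lemma scalm_one: "scalm 1 = 1\<^sub>m 1"
  by (intro eq_matI) (auto simp: scalm_def)

lemma scalm_mult: "scalm a * scalm b = scalm (a * b)"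
  by (simp add: scalm_diagm diagm_mult)

lemma F_scalm_carrier: "cmod z = 1 \<Longrightarrow> Fm (scalm z) \<in> carrier_mat (d 1) (d 1)"
  using F_unitary[of 1 "scalm z"] unitary_scalm unitary_carrier by blast

lemma F_scalm_pow:
  assumes "cmod z = 1" shows "Fm (scalm z) ^\<^sub>m j = Fm (scalm (z ^ j))"
proof (induction j)
  case 0
  have "Fm (scalm 1) = 1\<^sub>m (d 1)" unfolding scalm_one by (rule F_one)
  then show ?case using F_scalm_carrier[OF assms] by auto
next
  case (Suc j)
  have "Fm (scalm (z ^ j)) * Fm (scalm z) = Fm (scalm (z ^ j) * scalm z)"
    by (rule F_mult[symmetric]) (use assms in \<open>auto intro!: unitary_scalm simp: norm_power simp del: One_nat_def\<close>)
  then show ?case using Suc by (simp add: scalm_mult mult.commute)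
qed

lemma f_one: "f 1 = of_nat (d 1)"
  unfolding f_def T_def scalm_one F_one by (simp add: mtrace_def)

lemma f_continuous:
  assumes z: "cmod z = 1" and e: "e > 0"
  shows "\<exists>\<delta>>0. \<forall>w. cmod w = 1 \<and> cmod (w - z) < \<delta> \<longrightarrow> cmod (f w - f z) < e"
proof -
  \<comment> \<open>A bound on each diagonal entry; adding 1 to \<open>d 1\<close> excludes division
    by 0 and gives the strict inequality for the trace.\<close>
  define e' where "e' = e / (real (d 1) + 1)"
  have "e' > 0" using e by (simp add: e'_def)
  obtain \<delta> where \<delta>: "\<delta> > 0" "\<forall>V. unitary_mat 1 V \<and>
      (\<forall>i<1. \<forall>j<1. cmod (V $$ (i,j) - scalm z $$ (i,j)) < \<delta>) \<longrightarrow>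
      (\<forall>i<d 1. \<forall>j<d 1. cmod (Fm V $$ (i,j) - Fm (scalm z) $$ (i,j)) < e')"
    using F_cont[OF unitary_scalm[OF z] \<open>e' > 0\<close>] by (elim exE conjE) (rule that)
  have "cmod (f w - f z) < e" if w: "cmod w = 1" "cmod (w - z) < \<delta>" for w
  proof -
    have "\<forall>i<d 1. \<forall>j<d 1. cmod (Fm (scalm w) $$ (i,j) - Fm (scalm z) $$ (i,j)) < e'"
    proof -
      have "\<forall>i<1. \<forall>j<1. cmod (scalm w $$ (i,j) - scalm z $$ (i,j)) < \<delta>"
        using w(2) by (simp add: scalm_def)
      then show ?thesis using \<delta>(2)[THEN spec, THEN mp, OF conjI, OF unitary_scalm[OF w(1)]] by blast
    qed
    then have "(\<Sum>i<d 1. cmod (Fm (scalm w) $$ (i,i) - Fm (scalm z) $$ (i,i))) \<le> (\<Sum>i<d 1. e')"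
      by (intro sum_mono less_imp_le) auto
    also have "\<dots> = real (d 1) * e'" by simp
    also have "\<dots> < (real (d 1) + 1) * e'" using \<open>e' > 0\<close> by simp
    also have "\<dots> = e" by (simp add: e'_def)
    finally have lt: "(\<Sum>i<d 1. cmod (Fm (scalm w) $$ (i,i) - Fm (scalm z) $$ (i,i))) < e" .
    have eq: "f w - f z = (\<Sum>i<d 1. Fm (scalm w) $$ (i,i) - Fm (scalm z) $$ (i,i))"
      using F_scalm_carrier[OF w(1)] F_scalm_carrier[OF z]
      by (simp add: f_def T_def mtrace_def sum_subtractf)
    show ?thesis unfolding eq by (rule le_less_trans[OF norm_sum lt])
  qed
  then show ?thesis using \<delta>(1) by blast
qed

text \<open>\<open>F\<close> of a primitive root of unity of order \<open>2 ^ m\<close> has order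
  dividing \<open>2 ^ m\<close>, so its eigenvalues are powers of that root, and the same exponents
  serve all its powers.\<close>

lemma f_dyadic:
  assumes "m > 0"
  obtains \<kappa> :: "nat \<Rightarrow> int" where "\<And>i. i < d 1 \<Longrightarrow> \<bar>\<kappa> i\<bar> \<le> 2 ^ (m - 1)"
    "\<And>j. f (rou (2 ^ m) ^ j) = (\<Sum>i<d 1. (rou (2 ^ m) ^ j) powi \<kappa> i)"
proof -
  let ?U = "Fm (scalm (rou (2 ^ m)))"
  obtain ev where l: "\<And>j. mtrace (?U ^\<^sub>m j) = (\<Sum>i<d 1. ev i ^ j)"
    "\<And>M i. ?U ^\<^sub>m M = 1\<^sub>m (d 1) \<Longrightarrow> i < d 1 \<Longrightarrow> ev i ^ M = 1"
    using mtrace_pow_eigenvalues[OF F_scalm_carrier[OF cmod_rou[of "2 ^ m"]]] by blast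
  have "?U ^\<^sub>m (2 ^ m) = 1\<^sub>m (d 1)"
    by (simp add: F_scalm_pow rou_pow_self scalm_one F_one del: One_nat_def)
  then have "\<forall>i. \<exists>k. i < d 1 \<longrightarrow> \<bar>k\<bar> \<le> 2 ^ (m - 1) \<and> ev i = rou (2 ^ m) powi k"
    using root_unity_centered[OF assms] l(2) by blast
  from choice[OF this] obtain \<kappa> where \<kappa>: "\<And>i. i < d 1 \<Longrightarrow> \<bar>\<kappa> i\<bar> \<le> 2 ^ (m - 1) \<and> ev i = rou (2 ^ m) powi \<kappa> i"
    by blast
  have "f (rou (2 ^ m) ^ j) = (\<Sum>i<d 1. (rou (2 ^ m) ^ j) powi \<kappa> i)" for j
  proof -
    have "f (rou (2 ^ m) ^ j) = (\<Sum>i<d 1. ev i ^ j)"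
      using l(1)[of j] by (simp add: F_scalm_pow f_def T_def)
    also have "\<dots> = (\<Sum>i<d 1. (rou (2 ^ m) ^ j) powi \<kappa> i)"
    proof (intro sum.cong refl)
      fix i assume "i \<in> {..<d 1}"
      then have "ev i = rou (2 ^ m) powi \<kappa> i" using \<kappa> by simp
      then show "ev i ^ j = (rou (2 ^ m) ^ j) powi \<kappa> i"
        by (simp only: power_int_of_nat[symmetric] power_int_mult[symmetric] mult.commute)
    qed
    finally show ?thesis .
  qed
  then show ?thesis using that \<kappa> by blast
qed

text \<open>The weights occurring on the dyadic roots of unity are bounded independently of the level,
  since a large weight would make the trace oscillate near the identity.\<close>

lemma weights_bounded:
  obtains m0 :: nat where "m0 > 0" "\<And>m \<kappa> i. m \<ge> m0 \<Longrightarrow>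
     (\<And>i. i < d 1 \<Longrightarrow> \<bar>\<kappa> i\<bar> \<le> 2 ^ (m - 1)) \<Longrightarrow>
     (\<And>j. f (rou (2 ^ m) ^ j) = (\<Sum>i<d 1. (rou (2 ^ m) ^ j) powi \<kappa> i)) \<Longrightarrow> i < d 1 \<Longrightarrow> \<bar>\<kappa> i\<bar> \<le> 2 ^ m0"
proof -
  obtain \<delta> where \<delta>: "\<delta> > 0" "\<And>w. cmod w = 1 \<Longrightarrow> cmod (w - 1) < \<delta> \<Longrightarrow> cmod (f w - f 1) < 1"
    using f_continuous[of 1 1] by auto
  have "isCont cis 0" unfolding cis_conv_exp[abs_def] by (intro continuous_intros)
  then obtain \<eta> where \<eta>: "\<eta> > 0" "\<And>t. \<bar>t\<bar> < \<eta> \<Longrightarrow> cmod (cis t - 1) < \<delta>"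
  proof -
    have "cis \<midarrow>0\<rightarrow> cis 0" using \<open>isCont cis 0\<close> by (simp only: isCont_def)
    from LIM_D[OF this \<delta>(1)] obtain \<eta> where \<eta>: "\<eta> > 0"
      "\<forall>x. x \<noteq> 0 \<and> norm (x - 0) < \<eta> \<longrightarrow> cmod (cis x - cis 0) < \<delta>" by blast
    have "cmod (cis t - 1) < \<delta>" if "\<bar>t\<bar> < \<eta>" for t
      using \<eta>(2)[rule_format, of t] that \<delta>(1) by (cases "t = 0") simp_all
    then show ?thesis using that \<eta>(1) by blast
  qed
  obtain m1 :: nat where m1: "2 * pi / \<eta> < 2 ^ m1"
    using real_arch_pow[of 2 "2 * pi / \<eta>"] by auto
  define m0 where "m0 = Suc m1"
  have m0: "2 * pi / 2 ^ m0 < \<eta>"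
  proof -
    have "2 * pi < 2 ^ m1 * \<eta>" using m1 \<eta>(1) by (simp add: field_simps)
    also have "\<dots> \<le> 2 ^ m0 * \<eta>" using \<eta>(1) by (simp add: m0_def)
    finally show ?thesis by (simp add: field_simps)
  qed
  have "\<bar>\<kappa> i\<bar> \<le> 2 ^ m0" if m: "m \<ge> m0" and kb: "\<And>i. i < d 1 \<Longrightarrow> \<bar>\<kappa> i\<bar> \<le> 2 ^ (m - 1)"
     and fk: "\<And>j. f (rou (2 ^ m) ^ j) = (\<Sum>i<d 1. (rou (2 ^ m) ^ j) powi \<kappa> i)" and i: "i < d 1" for m \<kappa> i
  proof (rule ccontr)
    assume "\<not> \<bar>\<kappa> i\<bar> \<le> 2 ^ m0"
    then have big: "\<bar>\<kappa> i\<bar> > 2 ^ m0" by simp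
    \<comment> \<open>Doublings of the basic rotation under which the chosen weight does not pass
      half a turn. The largest one brings it beyond a quarter turn, while a weight above
      \<open>2 ^ m0\<close> forces \<open>s < m - m0\<close>, so the rotation itself is still close
      to 1.\<close>
    define S where "S = {s::nat. \<bar>\<kappa> i\<bar> * 2 ^ s \<le> 2 ^ (m - 1)}"
    have Sb: "s < m - m0" if "s \<in> S" for s
    proof (rule ccontr)
      assume "\<not> s < m - m0"
      then have "(2::int) ^ (m - m0) \<le> 2 ^ s" by (intro power_increasing) auto
      then have "2 ^ m0 * 2 ^ (m - m0) < \<bar>\<kappa> i\<bar> * 2 ^ s"
        by (intro mult_less_le_imp_less big) simp_all
      also have "\<dots> \<le> 2 ^ (m - 1)" using that by (simp add: S_def)
      also have "\<dots> \<le> (2::int) ^ m" by (intro power_increasing) auto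
      also have "\<dots> = 2 ^ m0 * 2 ^ (m - m0)" using m by (simp flip: power_add)
      finally show False by simp
    qed
    have "S \<subseteq> {..m - m0}" using Sb by (blast intro: less_imp_le)
    then have finS: "finite S" by (rule finite_subset) simp
    have "0 \<in> S" using kb[OF i] by (simp add: S_def)
    define s where "s = Max S"
    have s: "s \<in> S" "Suc s \<notin> S"
    proof -
      show "s \<in> S" unfolding s_def by (rule Max_in[OF finS]) (use \<open>0 \<in> S\<close> in blast)
      show "Suc s \<notin> S" using Max_ge[OF finS, of "Suc s"] unfolding s_def[symmetric] by auto
    qed
    have mpos: "m > 0" using m by (simp add: m0_def)
    have mm: "(2::real) ^ m = 2 * 2 ^ (m - 1)" using mpos by (cases m) auto
    \<comment> \<open>The angle of the chosen eigenvalue in turns. It lies between 1/4 and 1/2, so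
      the eigenvalue has real part at most 0.\<close>
    define x where "x = \<bar>real_of_int (\<kappa> i)\<bar> * 2 ^ s / 2 ^ m"
    have xle: "x \<le> 1 / 2"
    proof -
      have "\<bar>\<kappa> i\<bar> * 2 ^ s \<le> 2 ^ (m - 1)" using s(1) by (simp add: S_def)
      then have "real_of_int (\<bar>\<kappa> i\<bar> * 2 ^ s) \<le> real_of_int (2 ^ (m - 1))" by (simp only: of_int_le_iff)
      then show ?thesis by (simp add: x_def mm)
    qed
    have xge: "x \<ge> 1 / 4"
    proof -
      have "2 ^ (m - 1) \<le> \<bar>\<kappa> i\<bar> * 2 ^ Suc s" using s(2) by (simp add: S_def)
      then have "real_of_int (2 ^ (m - 1)) \<le> real_of_int (\<bar>\<kappa> i\<bar> * 2 ^ Suc s)" by (simp only: of_int_le_iff)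
      then show ?thesis by (simp add: x_def mm)
    qed
    have pw: "rou (2 ^ m) ^ (2 ^ s) = cis (2 * pi * 2 ^ s / 2 ^ m)"
      by (simp add: rou_def DeMoivre mult_ac)
    have "Re ((rou (2 ^ m) ^ (2 ^ s)) powi \<kappa> i) = cos (2 * pi * x)"
    proof -
      have "(rou (2 ^ m) ^ (2 ^ s)) powi \<kappa> i = cis (2 * pi * (real_of_int (\<kappa> i) * 2 ^ s / 2 ^ m))"
        unfolding pw by (simp add: cis_power_int mult_ac)
      also have "Re \<dots> = cos \<bar>2 * pi * (real_of_int (\<kappa> i) * 2 ^ s / 2 ^ m)\<bar>"
        by (simp only: cis.sel cos_abs_real)
      also have "\<bar>2 * pi * (real_of_int (\<kappa> i) * 2 ^ s / 2 ^ m)\<bar> = 2 * pi * x"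
        by (simp add: x_def abs_mult)
      finally show ?thesis .
    qed
    also have "\<dots> \<le> cos (pi / 2)"
    proof (rule cos_monotone_0_pi_le)
      have "2 * pi * (1 / 4) \<le> 2 * pi * x" using xge by (intro mult_left_mono) auto
      then show "pi / 2 \<le> 2 * pi * x" by simp
      have "2 * pi * x \<le> 2 * pi * (1 / 2)" using xle by (intro mult_left_mono) auto
      then show "2 * pi * x \<le> pi" by simp
    qed simp
    finally have re0: "Re ((rou (2 ^ m) ^ (2 ^ s)) powi \<kappa> i) \<le> 0" by simp
    have "cmod (f (rou (2 ^ m) ^ (2 ^ s)) - f 1) < 1"
    proof (rule \<delta>(2))
      show "cmod (rou (2 ^ m) ^ 2 ^ s) = 1" by (simp add: norm_power)
      have "2 ^ s * 2 ^ m0 \<le> (2::real) ^ m"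
      proof -
        have "s + m0 \<le> m" using Sb[OF s(1)] by simp
        then have "(2::real) ^ (s + m0) \<le> 2 ^ m" by (intro power_increasing) auto
        then show ?thesis by (simp add: power_add)
      qed
      then have "2 * pi * (2 ^ s * 2 ^ m0) \<le> 2 * pi * 2 ^ m" by (intro mult_left_mono) auto
      then have "2 * pi * 2 ^ s / 2 ^ m \<le> 2 * pi / 2 ^ m0" by (simp add: field_simps)
      then have "\<bar>2 * pi * 2 ^ s / 2 ^ m\<bar> < \<eta>" using m0 by simp
      then show "cmod (rou (2 ^ m) ^ 2 ^ s - 1) < \<delta>" unfolding pw by (rule \<eta>(2))
    qed
    \<comment> \<open>One of the \<open>d 1\<close> eigenvalues contributes at most 0 and the others
      at most 1. The trace drops by at least 1 from \<open>f 1\<close>, against the choice of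
      \<open>\<delta>\<close>.\<close>
    moreover have "Re (f (rou (2 ^ m) ^ (2 ^ s))) \<le> real (d 1) - 1"
    proof -
      have "Re (f (rou (2 ^ m) ^ (2 ^ s))) = (\<Sum>i'<d 1. Re ((rou (2 ^ m) ^ (2 ^ s)) powi \<kappa> i'))"
        by (simp only: fk Re_sum)
      also have "\<dots> \<le> (\<Sum>i'<d 1. if i' = i then 0 else 1)"
      proof (rule sum_mono)
        fix i'
        have "Re ((rou (2 ^ m) ^ (2 ^ s)) powi \<kappa> i') \<le> cmod ((rou (2 ^ m) ^ (2 ^ s)) powi \<kappa> i')"
          by (rule complex_Re_le_cmod)
        also have "\<dots> = 1" by (simp add: norm_power_int norm_power)
        finally show "Re ((rou (2 ^ m) ^ (2 ^ s)) powi \<kappa> i') \<le> (if i' = i then 0 else 1)" using re0 by auto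
      qed
      also have "\<dots> = (\<Sum>i'<d 1. 1 - (if i' = i then 1 else 0))" by (intro sum.cong refl) auto
      also have "\<dots> = real (d 1) - 1" using i by (simp add: sum_subtractf)
      finally show ?thesis .
    qed
    moreover have "Re (f 1 - f (rou (2 ^ m) ^ (2 ^ s))) \<le> cmod (f 1 - f (rou (2 ^ m) ^ (2 ^ s)))"
      by (rule complex_Re_le_cmod)
    ultimately show False by (simp add: f_one norm_minus_commute)
  qed
  moreover have "m0 > 0" by (simp add: m0_def)
  ultimately show ?thesis using that by blast
qed

text \<open>A compactness argument: bounded exponents leave finitely many tuples, so one of them
  occurs at infinitely many levels and hence, by passing to powers, at every level. Density of the
  dyadic roots of unity and continuity of \<open>f\<close> extend the formula to the circle.\<close>

lemma f_character:
  obtains \<kappa> :: "nat \<Rightarrow> int" where "\<And>z. cmod z = 1 \<Longrightarrow> f z = (\<Sum>i<d 1. z powi \<kappa> i)"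
proof -
  obtain m0 :: nat where m0: "m0 > 0" "\<And>m \<kappa> i. m \<ge> m0 \<Longrightarrow>
     (\<And>i. i < d 1 \<Longrightarrow> \<bar>\<kappa> i\<bar> \<le> 2 ^ (m - 1)) \<Longrightarrow>
     (\<And>j. f (rou (2 ^ m) ^ j) = (\<Sum>i<d 1. (rou (2 ^ m) ^ j) powi \<kappa> i)) \<Longrightarrow> i < d 1 \<Longrightarrow> \<bar>\<kappa> i\<bar> \<le> 2 ^ m0"
    using weights_bounded by blast
  define B where "B = {\<kappa> :: nat \<Rightarrow> int. \<forall>i. (i \<in> {..<d 1} \<longrightarrow> \<kappa> i \<in> {- (2 ^ m0)..2 ^ m0}) \<and> (i \<notin> {..<d 1} \<longrightarrow> \<kappa> i = 0)}"
  define R where "R = (\<lambda>m (\<kappa>::nat \<Rightarrow> int). \<forall>j. f (rou (2 ^ m) ^ j) = (\<Sum>i<d 1. (rou (2 ^ m) ^ j) powi \<kappa> i))"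
  have "\<exists>\<kappa>\<in>B. \<not> finite {m \<in> {m0..}. R m \<kappa>}"
  proof (rule pigeonhole_infinite_rel)
    show "\<not> finite {m0..}" by (rule infinite_Ici)
    show "finite B" unfolding B_def by (rule finite_set_of_finite_funs) auto
    show "\<forall>m\<in>{m0..}. \<exists>\<kappa>\<in>B. R m \<kappa>"
    proof
      fix m assume m: "m \<in> {m0..}"
      then have "m > 0" using m0(1) by simp
      then obtain \<kappa> where \<kappa>: "\<And>i. i < d 1 \<Longrightarrow> \<bar>\<kappa> i\<bar> \<le> 2 ^ (m - 1)"
          "\<And>j. f (rou (2 ^ m) ^ j) = (\<Sum>i<d 1. (rou (2 ^ m) ^ j) powi \<kappa> i)"
        using f_dyadic by blast
      have "\<bar>\<kappa> i\<bar> \<le> 2 ^ m0" if "i < d 1" for i using m0(2)[OF _ \<kappa> that] m by simp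
      then have "(\<lambda>i. if i < d 1 then \<kappa> i else 0) \<in> B" by (auto simp: B_def abs_le_iff minus_le_iff)
      moreover have "R m (\<lambda>i. if i < d 1 then \<kappa> i else 0)" using \<kappa>(2) by (simp add: R_def)
      ultimately show "\<exists>\<kappa>\<in>B. R m \<kappa>" by blast
    qed
  qed
  then obtain \<kappa> where inf: "infinite {m \<in> {m0..}. R m \<kappa>}" by blast
  have dy: "f (rou (2 ^ n) ^ j) = (\<Sum>i<d 1. (rou (2 ^ n) ^ j) powi \<kappa> i)" for n j
  proof -
    obtain m where m: "m \<ge> n" "R m \<kappa>"
      using inf unfolding infinite_nat_iff_unbounded_le by blast
    have "rou (2 ^ n) ^ j = rou (2 ^ m) ^ (2 ^ (m - n) * j)"
      by (simp add: rou_2_pow[OF m(1)] power_mult)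
    then show ?thesis using m(2) unfolding R_def by simp
  qed
  have "f z = (\<Sum>i<d 1. z powi \<kappa> i)" if z: "cmod z = 1" for z
  proof -
    \<comment> \<open>The shift by a full turn makes the angle nonnegative, so that
      \<open>nat\<close> of the floor below loses nothing.\<close>
    define t where "t = Arg z + 2 * pi"
    have t: "t \<ge> 0" using Arg_bounded[of z] by (simp add: t_def)
    have zt: "z = cis t"
    proof -
      have "z \<noteq> 0" using z by auto
      then have "cis (Arg z) = z" using z by (simp add: cis_Arg sgn_eq)
      moreover have "cis t = cis (Arg z) * cis (2 * pi)" by (simp only: t_def cis_mult)
      ultimately show ?thesis by (simp add: complex_eq_iff)
    qed
    define j where "j n = nat \<lfloor>t * 2 ^ n / (2 * pi)\<rfloor>" for n :: nat
    define w where "w n = rou (2 ^ n) ^ j n" for n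
    have wc: "w n = cis (real (j n) * (2 * pi / 2 ^ n))" for n
      by (simp add: w_def rou_def DeMoivre)
    have lim: "(\<lambda>n. real (j n) * (2 * pi / 2 ^ n)) \<longlonglongrightarrow> t"
    proof (rule tendsto_sandwich)
      have jb: "t * 2 ^ n / (2 * pi) - 1 \<le> real (j n)" "real (j n) \<le> t * 2 ^ n / (2 * pi)" for n
      proof -
        have "0 \<le> t * 2 ^ n / (2 * pi)" using t by simp
        then have "real (j n) = of_int \<lfloor>t * 2 ^ n / (2 * pi)\<rfloor>" by (simp add: j_def)
        then show "t * 2 ^ n / (2 * pi) - 1 \<le> real (j n)" "real (j n) \<le> t * 2 ^ n / (2 * pi)" by linarith+
      qed
      show "\<forall>\<^sub>F n in sequentially. t - 2 * pi / 2 ^ n \<le> real (j n) * (2 * pi / 2 ^ n)"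
      proof (intro always_eventually allI)
        fix n
        have "(t * 2 ^ n / (2 * pi) - 1) * (2 * pi / 2 ^ n) \<le> real (j n) * (2 * pi / 2 ^ n)"
          by (intro mult_right_mono jb) auto
        moreover have "(t * 2 ^ n / (2 * pi) - 1) * (2 * pi / 2 ^ n) = t - 2 * pi / 2 ^ n"
          by (simp add: field_simps)
        ultimately show "t - 2 * pi / 2 ^ n \<le> real (j n) * (2 * pi / 2 ^ n)" by (simp only:)
      qed
      show "\<forall>\<^sub>F n in sequentially. real (j n) * (2 * pi / 2 ^ n) \<le> t"
      proof (intro always_eventually allI)
        fix n
        have "real (j n) * (2 * pi / 2 ^ n) \<le> t * 2 ^ n / (2 * pi) * (2 * pi / 2 ^ n)"
          by (intro mult_right_mono jb) auto
        then show "real (j n) * (2 * pi / 2 ^ n) \<le> t" by simp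
      qed
      have "(\<lambda>n. 2 * pi * (1 / 2) ^ n) \<longlonglongrightarrow> 2 * pi * 0"
        by (intro tendsto_mult tendsto_const LIMSEQ_power_zero) auto
      then have "(\<lambda>n. t - 2 * pi * (1 / 2) ^ n) \<longlonglongrightarrow> t - 2 * pi * 0"
        by (intro tendsto_diff tendsto_const)
      then show "(\<lambda>n. t - 2 * pi / 2 ^ n) \<longlonglongrightarrow> t" by (simp add: power_one_over)
    qed simp
    have wl: "w \<longlonglongrightarrow> z"
    proof -
      have "isCont cis t" unfolding cis_conv_exp[abs_def] by (intro continuous_intros)
      from isCont_tendsto_compose[OF this lim] show ?thesis by (simp only: wc[abs_def] zt)
    qed
    have w1: "cmod (w n) = 1" for n by (simp add: w_def norm_power)
    have fl: "(\<lambda>n. f (w n)) \<longlonglongrightarrow> f z"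
    proof (rule LIMSEQ_I)
      fix e :: real assume "e > 0"
      then obtain \<delta> where \<delta>: "\<delta> > 0" "\<And>w. cmod w = 1 \<Longrightarrow> cmod (w - z) < \<delta> \<Longrightarrow> cmod (f w - f z) < e"
        using f_continuous[OF z] by blast
      obtain n0 where "\<forall>n\<ge>n0. cmod (w n - z) < \<delta>" using LIMSEQ_D[OF wl \<delta>(1)] by blast
      then show "\<exists>n0. \<forall>n\<ge>n0. cmod (f (w n) - f z) < e" using \<delta>(2) w1 by blast
    qed
    have "z \<noteq> 0" using z by auto
    then have gl: "(\<lambda>n. \<Sum>i<d 1. (w n) powi \<kappa> i) \<longlonglongrightarrow> (\<Sum>i<d 1. z powi \<kappa> i)"
      by (intro tendsto_sum tendsto_power_int wl)
    have "f (w n) = (\<Sum>i<d 1. (w n) powi \<kappa> i)" for n unfolding w_def by (rule dy)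
    then show ?thesis using LIMSEQ_unique[OF fl] gl by simp
  qed
  then show ?thesis using that by blast
qed

text \<open>Counting equal exponents in \<open>f_character\<close> gives existence and
  \<open>lpoly_unique\<close> gives uniqueness, so the definite description in \<open>Fchar\<close>
  denotes the character.\<close>

lemma Fchar_props:
  shows finite_Fchar: "finite {k. Fchar Fm k \<noteq> 0}"
    and f_Fchar: "cmod z = 1 \<Longrightarrow> f z = lpoly (Fchar Fm) z"
proof -
  obtain \<kappa> :: "nat \<Rightarrow> int" where \<kappa>: "\<And>z. cmod z = 1 \<Longrightarrow> f z = (\<Sum>i<d 1. z powi \<kappa> i)"
    using f_character by blast
  define \<chi> where "\<chi> k = card {i. i < d 1 \<and> \<kappa> i = k}" for k
  have supp: "{k. \<chi> k \<noteq> 0} = \<kappa> ` {..<d 1}"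
    by (auto simp: \<chi>_def card_eq_0_iff)
  have fin: "finite {k. \<chi> k \<noteq> 0}" unfolding supp by simp
  have l: "f z = lpoly \<chi> z" if z: "cmod z = 1" for z
  proof -
    have "lpoly \<chi> z = (\<Sum>k\<in>\<kappa> ` {..<d 1}. \<Sum>i\<in>{i \<in> {..<d 1}. \<kappa> i = k}. z powi \<kappa> i)"
      unfolding lpoly_def supp by (intro sum.cong refl) (simp add: \<chi>_def)
    also have "\<dots> = (\<Sum>i<d 1. z powi \<kappa> i)" by (rule sum.image_gen[symmetric]) simp
    finally show ?thesis using \<kappa>[OF z] by simp
  qed
  define Pr where "Pr = (\<lambda>\<chi>. finite {k. \<chi> k \<noteq> 0} \<and> (\<forall>z. cmod z = 1 \<longrightarrow>
      mtrace (Fm (mat 1 1 (\<lambda>_. z))) = (\<Sum>k\<in>{k. \<chi> k \<noteq> 0}. of_nat (\<chi> k) * z powi k)))"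
  have Pr_iff: "Pr c \<longleftrightarrow> finite {k. c k \<noteq> 0} \<and> (\<forall>z. cmod z = 1 \<longrightarrow> f z = lpoly c z)" for c
    by (simp only: Pr_def f_def T_def scalm_def lpoly_def)
  have "Pr \<chi>" unfolding Pr_iff using fin l by blast
  moreover have "c = \<chi>" if "Pr c" for c
    using that unfolding Pr_iff by (intro lpoly_unique) (use fin l in auto)
  ultimately have "Pr (THE c. Pr c)" by (rule theI)
  then have "Pr (Fchar Fm)" unfolding Fchar_def Pr_def .
  then show "finite {k. Fchar Fm k \<noteq> 0}" "cmod z = 1 \<Longrightarrow> f z = lpoly (Fchar Fm) z"
    unfolding Pr_iff by blast+
qed

end

section \<open>Ring homomorphisms and evaluation in two variables\<close>

definition rhom :: "('a::comm_ring_1 \<Rightarrow> 'b::comm_ring_1) \<Rightarrow> bool" where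
  "rhom h \<longleftrightarrow> h 1 = 1 \<and> (\<forall>x y. h (x + y) = h x + h y) \<and> (\<forall>x y. h (x * y) = h x * h y)"

lemma rhomI: "h 1 = 1 \<Longrightarrow> (\<And>x y. h (x + y) = h x + h y) \<Longrightarrow> (\<And>x y. h (x * y) = h x * h y) \<Longrightarrow> rhom h"
  by (simp add: rhom_def)

lemma
  assumes "rhom h"
  shows rhom_1: "h 1 = 1" and rhom_add: "h (x + y) = h x + h y" and rhom_mult: "h (x * y) = h x * h y"
  using assms by (simp_all add: rhom_def)

lemma rhom_0: assumes "rhom h" shows "h 0 = 0"
  using rhom_add[OF assms, of 0 0] by simp

lemma rhom_minus: assumes "rhom h" shows "h (- x) = - h x"
  using rhom_add[OF assms, of x "- x"] rhom_0[OF assms] by (simp add: eq_neg_iff_add_eq_0 add.commute)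

lemma rhom_diff: assumes "rhom h" shows "h (x - y) = h x - h y"
  using rhom_add[OF assms, of x "- y"] rhom_minus[OF assms, of y] by simp

lemma rhom_sum: assumes "rhom h" shows "h (\<Sum>i\<in>I. g i) = (\<Sum>i\<in>I. h (g i))"
  by (induction I rule: infinite_finite_induct) (simp_all add: rhom_0[OF assms] rhom_add[OF assms])

lemma rhom_power: assumes "rhom h" shows "h (x ^ n) = h x ^ n"
  by (induction n) (simp_all add: rhom_1[OF assms] rhom_mult[OF assms])

lemma rhom_of_nat: assumes "rhom h" shows "h (of_nat n) = of_nat n"
  by (induction n) (simp_all add: rhom_0[OF assms] rhom_1[OF assms] rhom_add[OF assms])

definition ev1 :: "('a::comm_ring_1 \<Rightarrow> 'b::comm_ring_1) \<Rightarrow> 'b \<Rightarrow> 'a poly \<Rightarrow> 'b" where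
  "ev1 h a p = poly (map_poly h p) a"

lemma ev1_pCons:
  assumes "rhom h" shows "ev1 h a (pCons c p) = h c + a * ev1 h a p"
proof (cases "c = 0 \<and> p = 0")
  case True
  then show ?thesis by (simp add: ev1_def rhom_0[OF assms])
next
  case False
  have "map_poly h (pCons c p) = pCons (h c) (map_poly h p)"
    by (rule poly_eqI) (simp add: coeff_map_poly coeff_pCons rhom_0[OF assms] split: nat.splits)
  then show ?thesis by (simp add: ev1_def)
qed

lemma ev1_0: "ev1 h a 0 = 0" by (simp add: ev1_def)

lemma rhom_ev1:
  assumes "rhom h" shows "rhom (ev1 h a)"
proof (rule rhomI)
  note s = ev1_pCons[OF assms] ev1_0 rhom_0[OF assms] rhom_1[OF assms] rhom_add[OF assms] rhom_mult[OF assms]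
  show "ev1 h a 1 = 1" by (simp add: one_pCons s)
  show add: "ev1 h a (p + q) = ev1 h a p + ev1 h a q" for p q
    by (induction p q rule: poly_induct2)
      (simp_all add: s algebra_simps)
  have smult: "ev1 h a (smult c p) = h c * ev1 h a p" for c p
    by (induction p) (simp_all add: s algebra_simps)
  show "ev1 h a (p * q) = ev1 h a p * ev1 h a q" for p q
    by (induction p) (simp_all add: s add smult algebra_simps)
qed

lemma ev1_monom: assumes "rhom h" shows "ev1 h a (monom c n) = h c * a ^ n"
  by (induction n) (simp_all add: monom_0 monom_Suc ev1_pCons[OF assms] ev1_0 rhom_0[OF assms] mult_ac)

definition ev2 :: "(rat \<Rightarrow> 'b::comm_ring_1) \<Rightarrow> 'b \<Rightarrow> 'b \<Rightarrow> rat poly poly \<Rightarrow> 'b" where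
  "ev2 h a b = ev1 (ev1 h a) b"

lemma rhom_ev2: "rhom h \<Longrightarrow> rhom (ev2 h a b)"
  unfolding ev2_def by (intro rhom_ev1)

text \<open>The monomial t_1^i t_2^j: the variable of the coefficient polynomials is t_1, the outer
  variable is t_2, as in \<open>tv\<close>.\<close>

definition mon :: "nat \<Rightarrow> nat \<Rightarrow> rat poly poly" where
  "mon i j = monom (monom 1 i) j"

lemma mon_mult: "mon i j * mon i' j' = mon (i + i') (j + j')"
  by (simp add: mon_def mult_monom)

lemma mon_power: "mon i j ^ n = mon (n * i) (n * j)"
  by (induction n) (simp_all add: mon_mult, simp add: mon_def monom_0 one_pCons)

lemma mon_0 [simp]: "mon 0 0 = 1"
  by (simp add: mon_def monom_0 one_pCons)

lemma mon_nz [simp]: "mon i j \<noteq> 0"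
  by (simp add: mon_def)

lemma ev2_mon: assumes "rhom h" shows "ev2 h a b (mon i j) = a ^ i * b ^ j"
  by (simp add: ev2_def mon_def ev1_monom[OF assms] ev1_monom[OF rhom_ev1[OF assms]] rhom_1[OF assms])

lemma rhom_of_rat: "rhom (of_rat :: rat \<Rightarrow> 'a::field_char_0)"
  by (intro rhomI) (simp_all add: of_rat_add of_rat_mult)

lemma coeff_mon: "coeff (mon i j) m = (if j = m then monom 1 i else 0)"
  by (simp add: mon_def)

lemma of_nat_poly_mult: "of_nat c * (p :: 'a::comm_ring_1 poly) = smult (of_nat c) p"
  by (simp add: of_nat_poly)

lemma prime_elem_dvd_mon:
  assumes "prime_elem H" "H dvd mon i j"
  shows "H dvd mon 1 0 \<or> H dvd mon 0 1"
proof -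
  have "mon i j = mon 1 0 ^ i * mon 0 1 ^ j" by (simp add: mon_power mon_mult)
  then have "H dvd mon 1 0 ^ i \<or> H dvd mon 0 1 ^ j"
    using assms prime_elem_dvd_multD[OF assms(1)] by simp
  then show ?thesis using prime_elem_dvd_power[OF assms(1)] by blast
qed

text \<open>F(t_i) multiplied by (t_1 t_2)^n to clear negative exponents; for \<open>i = 3\<close>
  the power t_3^k = (t_1 t_2)^(-k) lowers both exponents. It has this meaning when \<open>n\<close>
  bounds all weights in absolute value, so that \<open>nat\<close> truncates nothing.\<close>

definition pf :: "(int \<Rightarrow> nat) \<Rightarrow> nat \<Rightarrow> nat \<Rightarrow> rat poly poly" where
  "pf \<chi> n i = (\<Sum>k\<in>{k. \<chi> k \<noteq> 0}. of_nat (\<chi> k) *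
     (if i = 1 then mon (nat (int n + k)) n else if i = 2 then mon n (nat (int n + k))
      else mon (nat (int n - k)) (nat (int n - k))))"

lemma powi_nat_shift:
  fixes x :: "'a::field"
  assumes "x \<noteq> 0" "\<bar>k\<bar> \<le> int n"
  shows "x ^ nat (int n + k) = x ^ n * x powi k" "x ^ nat (int n - k) = x ^ n * x powi (- k)"
proof -
  have "x powi (int (nat (int n + k))) = x powi (int n + k)" using assms by simp
  then show "x ^ nat (int n + k) = x ^ n * x powi k"
    by (simp only: power_int_of_nat power_int_add[OF disjI1[OF assms(1)]])
  have "x powi (int (nat (int n - k))) = x powi (int n + - k)" using assms by simp
  then show "x ^ nat (int n - k) = x ^ n * x powi (- k)"
    by (simp only: power_int_of_nat power_int_add[OF disjI1[OF assms(1)]])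
qed

lemma ev2_pf:
  fixes x y :: "'a::field"
  assumes h: "rhom h" and n: "\<And>k. \<chi> k \<noteq> 0 \<Longrightarrow> \<bar>k\<bar> \<le> int n" and xy: "x \<noteq> 0" "y \<noteq> 0"
  shows "ev2 h x y (pf \<chi> n i) = (x * y) ^ n *
     (\<Sum>k\<in>{k. \<chi> k \<noteq> 0}. of_nat (\<chi> k) * (if i = 1 then x else if i = 2 then y else inverse (x * y)) powi k)"
  unfolding pf_def sum_distrib_left rhom_sum[OF rhom_ev2[OF h]]
proof (intro sum.cong refl)
  fix k assume "k \<in> {k. \<chi> k \<noteq> 0}"
  then have k: "\<bar>k\<bar> \<le> int n" using n by simp
  have "inverse (x * y) powi k = x powi (- k) * y powi (- k)"
    using xy by (simp add: power_int_minus power_int_mult_distrib power_int_inverse)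
  then show "ev2 h x y (of_nat (\<chi> k) * (if i = 1 then mon (nat (int n + k)) n else if i = 2 then mon n (nat (int n + k))
      else mon (nat (int n - k)) (nat (int n - k))))
    = (x * y) ^ n * (of_nat (\<chi> k) * (if i = 1 then x else if i = 2 then y else inverse (x * y)) powi k)"
    using powi_nat_shift[OF xy(1) k] powi_nat_shift[OF xy(2) k]
    by (simp add: rhom_mult[OF rhom_ev2[OF h]] rhom_of_nat[OF rhom_ev2[OF h]] ev2_mon[OF h] power_mult_distrib mult_ac)
qed

text \<open>\<open>pd1\<close> and \<open>pd2\<close> are the differences of the \<open>pf\<close>
  freed from the monomial factor that a large \<open>n\<close> brings along. With \<open>b\<close>
  chosen tightly, setting a variable to 0 still yields information.\<close>

definition pd1 :: "(int \<Rightarrow> nat) \<Rightarrow> nat \<Rightarrow> rat poly poly" where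
  "pd1 \<chi> b = (\<Sum>k\<in>{k. \<chi> k \<noteq> 0}. of_nat (\<chi> k) * (mon (nat (int b + k)) b - mon b (nat (int b + k))))"

definition pd2 :: "(int \<Rightarrow> nat) \<Rightarrow> nat \<Rightarrow> rat poly poly" where
  "pd2 \<chi> b = (\<Sum>k\<in>{k. \<chi> k \<noteq> 0}. of_nat (\<chi> k) * (mon b (nat (int b + k)) - mon (nat (int b - k)) (nat (int b - k))))"

lemma pf_diff_12:
  assumes "\<And>k. \<chi> k \<noteq> 0 \<Longrightarrow> - int b \<le> k" "b \<le> n"
  shows "pf \<chi> n 1 - pf \<chi> n 2 = mon (n - b) (n - b) * pd1 \<chi> b"
  unfolding pf_def pd1_def sum_subtractf[symmetric] sum_distrib_left
proof (intro sum.cong refl)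
  fix k assume "k \<in> {k. \<chi> k \<noteq> 0}"
  then have "- int b \<le> k" using assms(1) by simp
  then have e: "nat (int n + k) = (n - b) + nat (int b + k)" using assms(2) by simp
  have "mon (n - b) (n - b) * mon (nat (int b + k)) b = mon (nat (int n + k)) n"
    "mon (n - b) (n - b) * mon b (nat (int b + k)) = mon n (nat (int n + k))"
    unfolding mon_mult e using assms(2) by simp_all
  then show "of_nat (\<chi> k) * (if (1::nat) = 1 then mon (nat (int n + k)) n else if (1::nat) = 2 then mon n (nat (int n + k))
       else mon (nat (int n - k)) (nat (int n - k))) -
     of_nat (\<chi> k) * (if (2::nat) = 1 then mon (nat (int n + k)) n else if (2::nat) = 2 then mon n (nat (int n + k))
       else mon (nat (int n - k)) (nat (int n - k)))
    = mon (n - b) (n - b) * (of_nat (\<chi> k) * (mon (nat (int b + k)) b - mon b (nat (int b + k))))"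
    by (simp add: algebra_simps)
qed

lemma pf_diff_23:
  assumes "\<And>k. \<chi> k \<noteq> 0 \<Longrightarrow> - int b \<le> k" "\<And>k. \<chi> k \<noteq> 0 \<Longrightarrow> k \<le> int b" "b \<le> n"
  shows "pf \<chi> n 2 - pf \<chi> n 3 = mon (n - b) (n - b) * pd2 \<chi> b"
  unfolding pf_def pd2_def sum_subtractf[symmetric] sum_distrib_left
proof (intro sum.cong refl)
  fix k assume "k \<in> {k. \<chi> k \<noteq> 0}"
  then have "- int b \<le> k" "k \<le> int b" using assms(1,2) by simp_all
  then have e: "nat (int n + k) = (n - b) + nat (int b + k)" "nat (int n - k) = (n - b) + nat (int b - k)"
    using assms(3) by simp_all
  have "mon (n - b) (n - b) * mon (nat (int b - k)) (nat (int b - k)) = mon (nat (int n - k)) (nat (int n - k))"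
    "mon (n - b) (n - b) * mon b (nat (int b + k)) = mon n (nat (int n + k))"
    unfolding mon_mult e using assms(3) by simp_all
  then show "of_nat (\<chi> k) * (if (2::nat) = 1 then mon (nat (int n + k)) n else if (2::nat) = 2 then mon n (nat (int n + k))
       else mon (nat (int n - k)) (nat (int n - k))) -
     of_nat (\<chi> k) * (if (3::nat) = 1 then mon (nat (int n + k)) n else if (3::nat) = 2 then mon n (nat (int n + k))
       else mon (nat (int n - k)) (nat (int n - k)))
    = mon (n - b) (n - b) * (of_nat (\<chi> k) * (mon b (nat (int b + k)) - mon (nat (int b - k)) (nat (int b - k))))"
    by (simp add: algebra_simps)
qed

text \<open>Away from \<open>m = b\<close> only the terms t_1^b t_2^(b+k) contribute. The top
  coefficient in t_2, and for positive \<open>b\<close> also the constant one, is thus a scalar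
  times t_1^b.\<close>

lemma coeff_pd1:
  assumes "finite {k. \<chi> k \<noteq> 0}" "\<And>k. \<chi> k \<noteq> 0 \<Longrightarrow> - int b \<le> k" "m \<noteq> b"
  shows "coeff (pd1 \<chi> b) m = - monom (of_nat (\<chi> (int m - int b))) b"
proof -
  have "coeff (pd1 \<chi> b) m = (\<Sum>k\<in>{k. \<chi> k \<noteq> 0}. if k = int m - int b then - monom (of_nat (\<chi> (int m - int b))) b else 0)"
    unfolding pd1_def coeff_sum
  proof (intro sum.cong refl)
    fix k assume "k \<in> {k. \<chi> k \<noteq> 0}"
    then have "- int b \<le> k" using assms(2) by simp
    then have "nat (int b + k) = m \<longleftrightarrow> k = int m - int b" by auto
    then show "coeff (of_nat (\<chi> k) * (mon (nat (int b + k)) b - mon b (nat (int b + k)))) m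
      = (if k = int m - int b then - monom (of_nat (\<chi> (int m - int b))) b else 0)"
      using assms(3) by (auto simp: of_nat_poly_mult coeff_mon smult_monom of_nat_poly)
  qed
  also have "\<dots> = - monom (of_nat (\<chi> (int m - int b))) b"
    using assms(1) by (auto simp: sum.delta)
  finally show ?thesis .
qed

text \<open>After t_1 is fixed to \<open>a\<close>, the surviving leading coefficient keeps the
  degree in t_2 positive, so the other coordinate of a zero can be solved for.\<close>

lemma complex_root_exists:
  assumes "degree H > 0" "ev1 of_rat a (lead_coeff H) \<noteq> (0::complex)"
  obtains y where "ev2 of_rat a y H = (0::complex)"
proof -
  define q where "q = map_poly (ev1 of_rat a :: _ \<Rightarrow> complex) H"
  have "coeff q (degree H) \<noteq> 0" using assms(2) by (simp add: q_def coeff_map_poly ev1_0)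
  then have "degree q \<ge> degree H" by (rule le_degree)
  then have "degree q \<noteq> 0" using assms(1) by simp
  then have "\<not> constant (poly q)" by (simp add: constant_degree)
  then obtain y where "poly q y = 0" using fundamental_theorem_of_algebra by blast
  then show ?thesis using that by (simp add: ev2_def ev1_def q_def)
qed

lemma ev2_at_0: assumes "rhom h" shows "ev2 h a 0 H = ev1 h a (coeff H 0)"
  by (cases H) (simp add: ev2_def ev1_pCons[OF rhom_ev1[OF assms]])

text \<open>A prime \<open>H\<close> that divides no monomial involves t_2, so it has a zero with
  t_1 prescribed; at this zero both differences vanish.\<close>

theorem common_prime_divisor_monomial:
  assumes fin: "finite {k. \<chi> k \<noteq> 0}" and a: "\<chi> a \<noteq> 0" "a > 0" "\<And>k. \<chi> k \<noteq> 0 \<Longrightarrow> k \<le> a"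
    and n: "\<And>k. \<chi> k \<noteq> 0 \<Longrightarrow> \<bar>k\<bar> \<le> int n"
    and neg: "\<And>\<rho>. lpoly \<chi> \<rho> = 0 \<Longrightarrow> \<rho> \<noteq> 0 \<Longrightarrow> Im \<rho> = 0 \<and> Re \<rho> < 0"
    and H: "prime_elem H" "H dvd pf \<chi> n 1 - pf \<chi> n 2" "H dvd pf \<chi> n 2 - pf \<chi> n 3"
  shows "H dvd mon 1 0 \<or> H dvd mon 0 1"
proof (rule ccontr)
  assume nm: "\<not> ?thesis"
  define lo where "lo = Min {k. \<chi> k \<noteq> 0}"
  have lo: "\<chi> lo \<noteq> 0" "\<And>k. \<chi> k \<noteq> 0 \<Longrightarrow> lo \<le> k"
    using Min_in[OF fin] Min_le[OF fin] a by (auto simp: lo_def)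
  \<comment> \<open>The smallest exponent clearing the negative weights. It is 0 exactly when there
    are none, which is the final case distinction.\<close>
  define b where "b = nat (- lo)"
  have b: "\<And>k. \<chi> k \<noteq> 0 \<Longrightarrow> - int b \<le> k" "b \<le> n"
  proof -
    show "- int b \<le> k" if "\<chi> k \<noteq> 0" for k using lo(2)[OF that] by (simp add: b_def)
    show "b \<le> n" using n[OF lo(1)] by (simp add: b_def)
  qed
  have Hd1: "H dvd pd1 \<chi> b"
  proof -
    have "H dvd mon (n - b) (n - b) * pd1 \<chi> b" using H(2) pf_diff_12[OF b] by simp
    then show ?thesis using prime_elem_dvd_multD[OF H(1)] prime_elem_dvd_mon[OF H(1)] nm by blast
  qed
  then obtain E where E: "pd1 \<chi> b = H * E" by (elim dvdE)
  define N where "N = b + nat a"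
  have N: "N \<noteq> b" "int N - int b = a" using a by (auto simp: N_def)
  have cN: "coeff (pd1 \<chi> b) N = - monom (of_nat (\<chi> a)) b"
    using coeff_pd1[OF fin b(1) N(1)] N(2) by simp
  have cN0: "coeff (pd1 \<chi> b) N \<noteq> 0" using cN a by simp
  have "degree (pd1 \<chi> b) \<le> N"
  proof (rule degree_le, intro allI impI)
    fix i assume i: "i > N"
    then have "\<chi> (int i - int b) = 0" using a(3)[of "int i - int b"] N(2) by fastforce
    moreover have "i \<noteq> b" using i by (simp add: N_def)
    ultimately show "coeff (pd1 \<chi> b) i = 0" using coeff_pd1[OF fin b(1), of i] by simp
  qed
  moreover have "degree (pd1 \<chi> b) \<ge> N" using cN0 by (rule le_degree)
  ultimately have dN: "degree (pd1 \<chi> b) = N" by simp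
  have lc: "lead_coeff H * lead_coeff E = - monom (of_nat (\<chi> a)) b"
    using lead_coeff_mult[of H E] dN cN unfolding E[symmetric] by simp
  \<comment> \<open>A factor free of t_2 would divide the leading coefficient of \<open>pd1\<close>
    in t_2, a nonzero scalar times t_1^b, and so would be a unit or divide a monomial.\<close>
  have degH: "degree H > 0"
  proof (rule ccontr)
    assume "\<not> degree H > 0"
    then obtain c where c: "H = [:c:]" by (auto elim: degree_eq_zeroE)
    have "[:- monom (of_nat (\<chi> a)) b:] = H * [:lead_coeff E:]" using lc by (simp add: c mult.commute)
    then have "H dvd [:- monom (of_nat (\<chi> a)) b:]" by (rule dvdI)
    also have "[:- monom (of_nat (\<chi> a)) b:] = [:[:- of_nat (\<chi> a):]:] * mon b 0"
      by (simp add: mon_def monom_0 smult_monom minus_monom)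
    finally have "H dvd [:[:- of_nat (\<chi> a):]:] \<or> H dvd mon b 0" by (rule prime_elem_dvd_multD[OF H(1)])
    moreover have "\<not> H dvd [:[:- of_nat (\<chi> a):]:]"
    proof
      assume "H dvd [:[:- of_nat (\<chi> a):]:]"
      moreover have "[:[:- of_nat (\<chi> a) :: rat:]:] dvd 1"
        using a by (simp add: is_unit_const_poly_iff is_unit_poly_iff)
      ultimately have "H dvd 1" by (rule dvd_trans)
      then show False using H(1) by (simp add: prime_elem_def)
    qed
    ultimately show False using prime_elem_dvd_mon[OF H(1)] nm by blast
  qed
  have lcev: "ev1 of_rat x (lead_coeff H) \<noteq> (0::complex)" if "x \<noteq> 0 \<or> b = 0" for x
  proof
    assume "ev1 of_rat x (lead_coeff H) = (0::complex)"
    then have "ev1 of_rat x (- monom (of_nat (\<chi> a)) b) = (0::complex)"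
      unfolding lc[symmetric] rhom_mult[OF rhom_ev1[OF rhom_of_rat]] by simp
    then show False using that a
      by (auto simp: rhom_minus[OF rhom_ev1[OF rhom_of_rat]] ev1_monom[OF rhom_of_rat])
  qed
  have evH: "ev2 of_rat x y p = (0::complex)" if "ev2 of_rat x y H = (0::complex)" "H dvd p" for x y p
    using that by (auto simp: rhom_mult[OF rhom_ev2[OF rhom_of_rat]] elim!: dvdE)
  show False
  proof (cases "b = 0")
    case True
    \<comment> \<open>Here F may be a single power and have no nonzero root. At t_1 = 0 every term
      of \<open>pd2 \<chi> c\<close> vanishes except the one from the top weight, whatever the value
      of t_2, and this term is not 0.\<close>
    then obtain y where y: "ev2 of_rat 0 y H = (0::complex)" using complex_root_exists[OF degH lcev] by blast
    define c where "c = nat a"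
    have c: "\<And>k. \<chi> k \<noteq> 0 \<Longrightarrow> - int c \<le> k" "\<And>k. \<chi> k \<noteq> 0 \<Longrightarrow> k \<le> int c" "c \<le> n" "c > 0"
    proof -
      show "- int c \<le> k" if "\<chi> k \<noteq> 0" for k using b(1)[OF that] True by (simp add: c_def)
      show "k \<le> int c" if "\<chi> k \<noteq> 0" for k using a(3)[OF that] by (simp add: c_def)
      show "c \<le> n" using n[OF a(1)] by (simp add: c_def)
      show "c > 0" using a(2) by (simp add: c_def)
    qed
    have "H dvd mon (n - c) (n - c) * pd2 \<chi> c" using H(3) pf_diff_23[OF c(1-3)] by simp
    then have "H dvd pd2 \<chi> c"
      using prime_elem_dvd_multD[OF H(1)] prime_elem_dvd_mon[OF H(1)] nm by blast
    then have "ev2 of_rat 0 y (pd2 \<chi> c) = (0::complex)" by (rule evH[OF y])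
    also have "ev2 of_rat 0 y (pd2 \<chi> c) = (\<Sum>k\<in>{k. \<chi> k \<noteq> 0}. if k = a then - of_nat (\<chi> a) else 0)"
      unfolding pd2_def rhom_sum[OF rhom_ev2[OF rhom_of_rat]]
    proof (intro sum.cong refl)
      fix k assume "k \<in> {k. \<chi> k \<noteq> 0}"
      then have "k \<le> a" using a by simp
      then show "ev2 of_rat 0 y (of_nat (\<chi> k) * (mon c (nat (int c + k)) - mon (nat (int c - k)) (nat (int c - k))))
        = (if k = a then - of_nat (\<chi> a) else (0::complex))"
        using c(4) a(2) by (auto simp: rhom_mult[OF rhom_ev2[OF rhom_of_rat]] rhom_diff[OF rhom_ev2[OF rhom_of_rat]]
            rhom_of_nat[OF rhom_ev2[OF rhom_of_rat]] ev2_mon[OF rhom_of_rat] c_def power_0_left)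
    qed
    also have "\<dots> = - of_nat (\<chi> a)" using fin a by simp
    finally show False using a by simp
  next
    case False
    then have b0: "b > 0" "lo = - int b" by (auto simp: b_def)
    define P where "P = (\<Sum>k\<in>{k. \<chi> k \<noteq> 0}. monom (of_nat (\<chi> k) :: complex) (nat (int b + k)))"
    have P: "poly P z = z ^ b * lpoly \<chi> z" if "z \<noteq> 0" for z
      unfolding P_def lpoly_def poly_sum poly_monom sum_distrib_left
    proof (intro sum.cong refl)
      fix k assume "k \<in> {k. \<chi> k \<noteq> 0}"
      then have "int (nat (int b + k)) = int b + k" using b(1)[of k] by simp
      then have "z ^ nat (int b + k) = z ^ b * z powi k"
        using that by (simp only: power_int_of_nat[symmetric] power_int_add[OF disjI1[OF that]])
      then show "of_nat (\<chi> k) * z ^ nat (int b + k) = z ^ b * (of_nat (\<chi> k) * z powi k)" by simp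
    qed
    have cP: "coeff P m = of_nat (\<chi> (int m - int b))" for m
    proof -
      have "coeff P m = (\<Sum>k\<in>{k. \<chi> k \<noteq> 0}. if k = int m - int b then of_nat (\<chi> (int m - int b)) else 0)"
        unfolding P_def coeff_sum
      proof (intro sum.cong refl)
        fix k assume "k \<in> {k. \<chi> k \<noteq> 0}"
        then have "- int b \<le> k" using b(1) by simp
        then have "nat (int b + k) = m \<longleftrightarrow> k = int m - int b" by auto
        then show "coeff (monom (of_nat (\<chi> k)) (nat (int b + k))) m = (if k = int m - int b then of_nat (\<chi> (int m - int b)) else (0::complex))"
          by auto
      qed
      then show ?thesis using fin by (auto simp: sum.delta)
    qed
    have "degree P \<ge> N" using cP[of N] N a by (intro le_degree) simp
    then have "degree P \<noteq> 0" using N_def a b0 by simp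
    then have "\<not> constant (poly P)" by (simp add: constant_degree)
    then obtain \<rho> where "poly P \<rho> = 0" using fundamental_theorem_of_algebra by blast
    moreover have "poly P 0 \<noteq> 0" using cP[of 0] lo(1) b0 by (simp add: poly_0_coeff_0)
    ultimately have \<rho>0: "\<rho> \<noteq> 0" by auto
    then have "\<rho> ^ b * lpoly \<chi> \<rho> = 0" using P[of \<rho>] \<open>poly P \<rho> = 0\<close> by simp
    then have \<rho>: "\<rho> \<noteq> 0" "lpoly \<chi> \<rho> = 0" using \<rho>0 by simp_all
    obtain y where y: "ev2 of_rat \<rho> y H = (0::complex)" using complex_root_exists[OF degH lcev] \<rho>(1) by blast
    \<comment> \<open>The coefficient of t_2^0 in \<open>pd1\<close> is a nonzero multiple of t_1^b,
      which does not vanish at \<open>\<rho>\<close>.\<close>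
    have y0: "y \<noteq> 0"
    proof
      assume "y = 0"
      then have "ev1 of_rat \<rho> (coeff (pd1 \<chi> b) 0) = (0::complex)"
        using evH[OF y Hd1] ev2_at_0[OF rhom_of_rat, of \<rho> "pd1 \<chi> b"] by simp
      moreover have "coeff (pd1 \<chi> b) 0 = - monom (of_nat (\<chi> lo)) b"
        using coeff_pd1[OF fin b(1), of 0] b0 by simp
      ultimately show False using \<rho>(1) lo(1)
        by (simp add: rhom_minus[OF rhom_ev1[OF rhom_of_rat]] ev1_monom[OF rhom_of_rat])
    qed
    define z where "z = inverse (\<rho> * y)"
    have e: "ev2 of_rat \<rho> y (pf \<chi> n i) = (\<rho> * y) ^ n * lpoly \<chi> (if i = 1 then \<rho> else if i = 2 then y else z)" for i
      using ev2_pf[OF rhom_of_rat n \<rho>(1) y0] by (simp add: lpoly_def z_def)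
    have "lpoly \<chi> \<rho> = lpoly \<chi> y" "lpoly \<chi> y = lpoly \<chi> z"
      using evH[OF y H(2)] evH[OF y H(3)] \<rho>(1) y0
      by (simp_all add: rhom_diff[OF rhom_ev2[OF rhom_of_rat]] e)
    then have r: "lpoly \<chi> y = 0" "lpoly \<chi> z = 0" using \<rho> by simp_all
    have "z \<noteq> 0" using \<rho> y0 by (simp add: z_def)
    then have im: "Im \<rho> = 0 \<and> Re \<rho> < 0" "Im y = 0 \<and> Re y < 0" "Im z = 0 \<and> Re z < 0"
      using neg \<rho> y0 r by blast+
    have "\<rho> * y * z = 1" unfolding z_def by (rule right_inverse) (use \<rho> y0 in simp)
    then have "Re (\<rho> * y * z) = 1" by simp
    moreover have "Re (\<rho> * y * z) = Re \<rho> * Re y * Re z" using im by simp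
    moreover have "Re \<rho> * Re y * Re z < 0"
      using im by (intro mult_pos_neg mult_neg_neg) auto
    ultimately show False by simp
  qed
qed

section \<open>Laurent polynomials inside the fraction field\<close>

declare One_nat_def [simp del]

lemma tv_1: "tv 1 = to_fract (mon 1 0)" and tv_2: "tv 2 = to_fract (mon 0 1)"
  by (simp_all add: tv_def to_fract_def mon_def monom_0 monom_Suc one_pCons One_nat_def)

lemma tv_3: "tv 3 = inverse (tv 1 * tv 2)"
  by (simp add: tv_def)

lemma tv_nz [simp]: "tv i \<noteq> 0"
proof -
  have "tv 1 \<noteq> 0" "tv 2 \<noteq> 0" unfolding tv_1 tv_2 by simp_all
  moreover have "tv i = inverse (tv 1 * tv 2)" if "i \<noteq> 1" "i \<noteq> 2" using that by (simp add: tv_def)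
  ultimately show ?thesis by (cases "i = 1 \<or> i = 2") auto
qed

lemma tv_prod: "tv 1 * tv 2 = to_fract (mon 1 1)"
  unfolding tv_1 tv_2 to_fract_mult[symmetric] mon_mult by simp

lemma scal_to_fract: "scal c = to_fract [:[:c:]:]"
  by (simp add: scal_def to_fract_def)

lemma rhom_scal: "rhom scal"
  by (intro rhomI) (simp_all add: scal_to_fract one_pCons[symmetric] flip: to_fract_add to_fract_mult)

text \<open>The embedding into the fraction field is itself an evaluation, so \<open>ev2_pf\<close>
  applies to it as well as to complex points.\<close>

lemma ev2_scal_tv: "ev2 scal (tv 1) (tv 2) p = to_fract p"
proof -
  have 1: "ev1 scal (tv 1) q = to_fract [:q:]" for q
  proof (induction q)
    case (pCons c q)
    have "[:pCons c q:] = [:[:c:]:] + mon 1 0 * [:q:]"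
      by (simp add: mon_def monom_0 monom_Suc One_nat_def)
    then have "to_fract [:pCons c q:] = scal c + tv 1 * to_fract [:q:]"
      unfolding tv_1 scal_to_fract to_fract_mult[symmetric] to_fract_add[symmetric] by (simp only:)
    then show ?case using pCons by (simp add: ev1_pCons[OF rhom_scal])
  qed (simp add: ev1_0)
  show ?thesis
  proof (induction p)
    case (pCons q p)
    have "mon 0 1 = [:0, 1:]"
      by (simp add: mon_def monom_0 monom_Suc One_nat_def one_pCons[symmetric])
    then have "pCons q p = [:q:] + mon 0 1 * p" by simp
    then have "to_fract (pCons q p) = to_fract [:q:] + tv 2 * to_fract p"
      unfolding tv_2 to_fract_mult[symmetric] to_fract_add[symmetric] by (simp only:)
    then show ?case using pCons by (simp add: ev2_def ev1_pCons[OF rhom_ev1[OF rhom_scal]] 1)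
  qed (simp add: ev2_def ev1_0)
qed


lemma lmon_mult: "lmon e * lmon e' = lmon (\<lambda>i. e i + e' i)"
  by (simp add: lmon_def power_int_add mult_ac)

lemma RQ_I: "finite S \<Longrightarrow> (\<Sum>e\<in>S. scal (c e) * lmon e) \<in> RQ"
  unfolding RQ_def by blast

lemma RQ_E:
  assumes "r \<in> RQ" obtains S c where "finite S" "r = (\<Sum>e\<in>S. scal (c e) * lmon e)"
  using assms unfolding RQ_def by blast

lemma scal_0 [simp]: "scal 0 = 0" by (rule rhom_0[OF rhom_scal])

lemma RQ_add:
  assumes "r \<in> RQ" "r' \<in> RQ" shows "r + r' \<in> RQ"
proof -
  obtain S c where S: "finite S" "r = (\<Sum>e\<in>S. scal (c e) * lmon e)" using assms(1) by (rule RQ_E)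
  obtain S' c' where S': "finite S'" "r' = (\<Sum>e\<in>S'. scal (c' e) * lmon e)" using assms(2) by (rule RQ_E)
  have "r = (\<Sum>e\<in>S \<union> S'. scal (if e \<in> S then c e else 0) * lmon e)"
    unfolding S(2) by (rule sum.mono_neutral_cong_left) (use S S' in auto)
  moreover have "r' = (\<Sum>e\<in>S \<union> S'. scal (if e \<in> S' then c' e else 0) * lmon e)"
    unfolding S'(2) by (rule sum.mono_neutral_cong_left) (use S S' in auto)
  ultimately have "r + r' = (\<Sum>e\<in>S \<union> S'. scal ((if e \<in> S then c e else 0) + (if e \<in> S' then c' e else 0)) * lmon e)"
    by (simp only: sum.distrib[symmetric] rhom_add[OF rhom_scal] distrib_right)
  then show ?thesis using RQ_I[of "S \<union> S'"] S S' by simp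
qed

lemma RQ_0: "0 \<in> RQ" using RQ_I[of "{}"] by simp

lemma RQ_term_mult:
  assumes "r \<in> RQ" shows "scal a * lmon e0 * r \<in> RQ"
proof -
  obtain S c where S: "finite S" "r = (\<Sum>e\<in>S. scal (c e) * lmon e)" using assms by (rule RQ_E)
  define sh where "sh = (\<lambda>(e::nat \<Rightarrow> int) i. e0 i + e i)"
  \<comment> \<open>Different exponent functions may name the same monomial, as t_1 t_2 t_3 = 1; the
    reindexing therefore takes place on exponent functions, where the shift is injective.\<close>
  have inj: "inj_on sh S" by (auto simp: inj_on_def sh_def fun_eq_iff)
  have "scal a * lmon e0 * r = (\<Sum>e\<in>S. scal (a * c e) * lmon (sh e))"
    unfolding S(2) sum_distrib_left sh_def lmon_mult[symmetric] rhom_mult[OF rhom_scal]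
    by (intro sum.cong refl) (simp add: mult_ac)
  also have "\<dots> = (\<Sum>e\<in>sh ` S. scal (a * c (the_inv_into S sh e)) * lmon e)"
    by (simp add: sum.reindex[OF inj] the_inv_into_f_f[OF inj])
  finally show ?thesis using RQ_I[of "sh ` S" "\<lambda>e. a * c (the_inv_into S sh e)"] S by simp
qed

lemma RQ_mult:
  assumes "r \<in> RQ" "r' \<in> RQ" shows "r * r' \<in> RQ"
proof -
  obtain S c where S: "finite S" "r = (\<Sum>e\<in>S. scal (c e) * lmon e)" using assms(1) by (rule RQ_E)
  have "(\<Sum>e\<in>S. scal (c e) * lmon e * r') \<in> RQ"
    using S(1) by induction (auto intro: RQ_0 RQ_add RQ_term_mult[OF assms(2)])
  then show ?thesis unfolding S(2) sum_distrib_right .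
qed

lemma RQ_lmon: "lmon e \<in> RQ"
  using RQ_I[of "{e}" "\<lambda>_. 1"] by (simp add: rhom_1[OF rhom_scal])

lemma RQ_scal: "scal c \<in> RQ"
  using RQ_I[of "{\<lambda>_. 0}" "\<lambda>_. c"] by (simp add: lmon_def)

lemma RQ_tv: "tv i powi k \<in> RQ"
proof -
  have "tv i powi k = lmon (\<lambda>j. if i = 1 then (if j = 1 then k else 0) else if i = 2 then (if j = 2 then k else 0)
     else if j = 3 then k else 0)"
    by (auto simp: lmon_def tv_def)
  then show ?thesis using RQ_lmon by simp
qed

lemma RQ_1: "1 \<in> RQ" using RQ_scal[of 1] by (simp add: rhom_1[OF rhom_scal])

lemma RQ_power: "r \<in> RQ \<Longrightarrow> r ^ n \<in> RQ"
  by (induction n) (auto intro: RQ_1 RQ_mult)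

lemma RQ_sum: "(\<And>i. i \<in> I \<Longrightarrow> g i \<in> RQ) \<Longrightarrow> (\<Sum>i\<in>I. g i) \<in> RQ"
  by (induction I rule: infinite_finite_induct) (auto intro: RQ_0 RQ_add)

lemma RQ_of_nat: "of_nat n \<in> RQ"
  by (induction n) (auto intro: RQ_0 RQ_1 RQ_add)

lemma RQ_uminus: "r \<in> RQ \<Longrightarrow> - r \<in> RQ"
  using RQ_mult[OF RQ_scal[of "-1"], of r] by (simp add: rhom_minus[OF rhom_scal] rhom_1[OF rhom_scal])

lemma RQ_to_fract: "to_fract p \<in> RQ"
proof -
  have tv: "tv i \<in> RQ" for i using RQ_tv[of i 1] by simp
  have 1: "ev1 scal (tv 1) q \<in> RQ" for q
    by (induction q) (auto simp: ev1_0 ev1_pCons[OF rhom_scal] intro!: RQ_0 RQ_add RQ_mult RQ_scal tv)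
  have "ev1 (ev1 scal (tv 1)) (tv 2) p \<in> RQ"
    by (induction p) (auto simp: ev1_0 ev1_pCons[OF rhom_ev1[OF rhom_scal]] intro!: RQ_0 RQ_add RQ_mult 1 tv)
  then show ?thesis unfolding ev2_scal_tv[of p, symmetric] ev2_def .
qed

text \<open>Evaluation of Laurent polynomials, as a relation between an element of the fraction field
  and a function on the complex torus.\<close>

definition evrel :: "rf \<Rightarrow> (complex \<Rightarrow> complex \<Rightarrow> complex) \<Rightarrow> bool" where
  "evrel r g \<longleftrightarrow> (\<exists>j p. r * to_fract (mon 1 1) ^ j = to_fract p \<and>
     (\<forall>x y. x \<noteq> 0 \<longrightarrow> y \<noteq> 0 \<longrightarrow> ev2 of_rat x y p = (x * y) ^ j * g x y))"

lemmas rhomC = rhom_ev2[OF rhom_of_rat[where 'a=complex]]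

lemma evrelI: "r * to_fract (mon 1 1) ^ j = to_fract p \<Longrightarrow>
   (\<And>x y. x \<noteq> 0 \<Longrightarrow> y \<noteq> 0 \<Longrightarrow> ev2 of_rat x y p = (x * y) ^ j * g x y) \<Longrightarrow> evrel r g"
  unfolding evrel_def by blast

lemma evrel_add:
  assumes "evrel r g" "evrel r' g'" shows "evrel (r + r') (\<lambda>x y. g x y + g' x y)"
proof -
  obtain j p where 1: "r * to_fract (mon 1 1) ^ j = to_fract p"
    "\<And>x y. x \<noteq> 0 \<Longrightarrow> y \<noteq> 0 \<Longrightarrow> ev2 of_rat x y p = (x * y) ^ j * g x y" using assms(1) unfolding evrel_def by blast
  obtain j' p' where 2: "r' * to_fract (mon 1 1) ^ j' = to_fract p'"
    "\<And>x y. x \<noteq> 0 \<Longrightarrow> y \<noteq> 0 \<Longrightarrow> ev2 of_rat x y p' = (x * y) ^ j' * g' x y" using assms(2) unfolding evrel_def by blast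
  have pw: "to_fract (mon 1 1) ^ k = to_fract (mon k k)" for k
    by (induction k) (simp_all add: mon_mult One_nat_def flip: to_fract_mult)
  show ?thesis
  proof (rule evrelI[of _ "j + j'" "p * mon j' j' + p' * mon j j"])
    have "(r + r') * to_fract (mon 1 1) ^ (j + j') = r * to_fract (mon 1 1) ^ j * to_fract (mon 1 1) ^ j'
        + r' * to_fract (mon 1 1) ^ j' * to_fract (mon 1 1) ^ j"
      by (simp add: algebra_simps power_add)
    then show "(r + r') * to_fract (mon 1 1) ^ (j + j') = to_fract (p * mon j' j' + p' * mon j j)"
      unfolding 1(1) 2(1) by (simp add: pw)
    show "ev2 of_rat x y (p * mon j' j' + p' * mon j j) = (x * y) ^ (j + j') * (g x y + g' x y)"
      if "x \<noteq> 0" "y \<noteq> 0" for x y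
      by (simp add: rhom_add[OF rhomC] rhom_mult[OF rhomC] ev2_mon[OF rhom_of_rat] 1(2)[OF that] 2(2)[OF that]
          algebra_simps power_add power_mult_distrib)
  qed
qed

lemma evrel_mult:
  assumes "evrel r g" "evrel r' g'" shows "evrel (r * r') (\<lambda>x y. g x y * g' x y)"
proof -
  obtain j p where 1: "r * to_fract (mon 1 1) ^ j = to_fract p"
    "\<And>x y. x \<noteq> 0 \<Longrightarrow> y \<noteq> 0 \<Longrightarrow> ev2 of_rat x y p = (x * y) ^ j * g x y" using assms(1) unfolding evrel_def by blast
  obtain j' p' where 2: "r' * to_fract (mon 1 1) ^ j' = to_fract p'"
    "\<And>x y. x \<noteq> 0 \<Longrightarrow> y \<noteq> 0 \<Longrightarrow> ev2 of_rat x y p' = (x * y) ^ j' * g' x y" using assms(2) unfolding evrel_def by blast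
  show ?thesis
  proof (rule evrelI[of _ "j + j'" "p * p'"])
    have "r * r' * to_fract (mon 1 1) ^ (j + j') = (r * to_fract (mon 1 1) ^ j) * (r' * to_fract (mon 1 1) ^ j')"
      by (simp add: power_add mult_ac)
    then show "r * r' * to_fract (mon 1 1) ^ (j + j') = to_fract (p * p')"
      unfolding 1(1) 2(1) by simp
    show "ev2 of_rat x y (p * p') = (x * y) ^ (j + j') * (g x y * g' x y)"
      if "x \<noteq> 0" "y \<noteq> 0" for x y
      by (simp add: rhom_mult[OF rhomC] 1(2)[OF that] 2(2)[OF that] power_add mult_ac)
  qed
qed

definition tev :: "nat \<Rightarrow> complex \<Rightarrow> complex \<Rightarrow> complex" where
  "tev i x y = (if i = 1 then x else if i = 2 then y else inverse (x * y))"

lemma evrel_tv: "evrel (tv i) (tev i)"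
proof -
  consider "i = 1" | "i = 2" | "i \<noteq> 1" "i \<noteq> 2" by blast
  then show ?thesis
  proof cases
    case 1
    then show ?thesis using tv_1
      by (intro evrelI[of _ 0 "mon 1 0"]) (simp_all add: tev_def ev2_mon[OF rhom_of_rat])
  next
    case 2
    then show ?thesis using tv_2
      by (intro evrelI[of _ 0 "mon 0 1"]) (simp_all add: tev_def ev2_mon[OF rhom_of_rat])
  next
    case 3
    then have t: "tv i = inverse (tv 1 * tv 2)" by (simp add: tv_def)
    have "tv 1 * tv 2 \<noteq> 0" by simp
    then have "tv i * (tv 1 * tv 2) = 1" unfolding t by (rule left_inverse)
    then have "tv i * to_fract (mon 1 1) ^ 1 = to_fract 1"
      unfolding tv_prod[symmetric] by (simp only: power_one_right to_fract_1)
    then show ?thesis using 3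
      by (intro evrelI[of _ 1 1]) (simp_all add: tev_def rhom_1[OF rhomC] field_simps)
  qed
qed

lemma evrel_scal: "evrel (scal c) (\<lambda>_ _. of_rat c)"
  by (intro evrelI[of _ 0 "[:[:c:]:]"])
    (simp_all add: scal_to_fract ev2_def ev1_pCons[OF rhom_of_rat] ev1_pCons[OF rhom_ev1[OF rhom_of_rat]] ev1_0)

text \<open>First \<open>x\<close> is chosen away from 0 and from the roots of the leading
  coefficient in t_2, then \<open>y\<close> away from 0 and the roots of the remaining
  polynomial.\<close>

lemma ev2_nonzero:
  assumes "p \<noteq> 0" obtains x y :: complex where "x \<noteq> 0" "y \<noteq> 0" "ev2 of_rat x y p \<noteq> 0"
proof -
  have fin: "\<exists>x. x \<noteq> 0 \<and> poly q x \<noteq> 0" if "q \<noteq> 0" for q :: "complex poly"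
  proof -
    have "finite ({x. poly q x = 0} \<union> {0})" using poly_roots_finite[OF that] by simp
    then have "\<exists>x. x \<notin> {x. poly q x = 0} \<union> {0}" by (rule ex_new_if_finite[OF infinite_UNIV_char_0])
    then show ?thesis by auto
  qed
  have "map_poly of_rat (lead_coeff p) \<noteq> (0 :: complex poly)"
  proof
    assume "map_poly of_rat (lead_coeff p) = (0 :: complex poly)"
    then have "coeff (map_poly of_rat (lead_coeff p) :: complex poly) (degree (lead_coeff p)) = 0" by simp
    then show False using assms by (simp add: coeff_map_poly)
  qed
  then obtain x :: complex where x: "x \<noteq> 0" "ev1 of_rat x (lead_coeff p) \<noteq> 0" using fin unfolding ev1_def by blast
  have "map_poly (ev1 of_rat x) p \<noteq> (0 :: complex poly)"
  proof
    assume "map_poly (ev1 of_rat x) p = (0 :: complex poly)"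
    then have "coeff (map_poly (ev1 of_rat x) p :: complex poly) (degree p) = 0" by simp
    then show False using x by (simp add: coeff_map_poly ev1_0)
  qed
  then obtain y :: complex where "y \<noteq> 0" "ev2 of_rat x y p \<noteq> 0" using fin unfolding ev2_def ev1_def by blast
  then show ?thesis using that x by blast
qed

section \<open>The Weyl group action on the fraction field\<close>

definition sub :: "(nat \<Rightarrow> nat) \<Rightarrow> rat poly poly \<Rightarrow> rf" where
  "sub w = ev2 scal (tv (w 1)) (tv (w 2))"

lemma rhom_sub: "rhom (sub w)"
  unfolding sub_def by (rule rhom_ev2[OF rhom_scal])

lemma evrel_sub: "evrel (sub w p) (\<lambda>x y. ev2 of_rat (tev (w 1) x y) (tev (w 2) x y) p)"
proof -
  have s0: "evrel 0 (\<lambda>_ _. 0)" using evrel_scal[of 0] by simp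
  have 1: "evrel (ev1 scal (tv (w 1)) q) (\<lambda>x y. ev1 of_rat (tev (w 1) x y) q)" for q
  proof (induction q)
    case (pCons c q)
    show ?case unfolding ev1_pCons[OF rhom_scal] ev1_pCons[OF rhom_of_rat]
      by (rule evrel_add[OF evrel_scal evrel_mult[OF evrel_tv pCons.IH]])
  qed (simp add: ev1_0 s0)
  show ?thesis unfolding sub_def ev2_def
  proof (induction p)
    case (pCons q p)
    show ?case unfolding ev1_pCons[OF rhom_ev1[OF rhom_scal]] ev1_pCons[OF rhom_ev1[OF rhom_of_rat]]
      by (rule evrel_add[OF 1 evrel_mult[OF evrel_tv pCons.IH]])
  qed (simp add: ev1_0 s0)
qed

lemma perm3_cases:
  assumes "w permutes {1,2,3::nat}"
  shows "(w 1, w 2, w 3) \<in> {(1,2,3),(1,3,2),(2,1,3),(2,3,1),(3,1,2),(3,2,1)}"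
proof -
  have "w 1 \<in> {1,2,3}" "w 2 \<in> {1,2,3}" "w 3 \<in> {1,2,3}"
    using permutes_in_image[OF assms] by blast+
  moreover have "w 1 \<noteq> w 2" "w 1 \<noteq> w 3" "w 2 \<noteq> w 3"
    by (simp_all add: inj_eq[OF permutes_inj[OF assms]])
  ultimately show ?thesis by (elim insertE emptyE) simp_all
qed

text \<open>The substitution corresponds to a permutation of the complex torus, and a nonzero
  polynomial is nonzero at some point of the torus. Injectivity is what lets the action extend to
  fractions.\<close>

lemma sub_nonzero:
  assumes w: "w permutes {1,2,3}" and p: "p \<noteq> 0" shows "sub w p \<noteq> 0"
proof
  assume s: "sub w p = 0"
  obtain j q where q: "sub w p * to_fract (mon 1 1) ^ j = to_fract q"
    "\<And>x y. x \<noteq> 0 \<Longrightarrow> y \<noteq> 0 \<Longrightarrow> ev2 of_rat x y q = (x * y) ^ j * ev2 of_rat (tev (w 1) x y) (tev (w 2) x y) p"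
    using evrel_sub[of w p] unfolding evrel_def by blast
  have "q = 0" using q(1) s by simp
  then have z: "ev2 of_rat (tev (w 1) x y) (tev (w 2) x y) p = 0" if "x \<noteq> 0" "y \<noteq> 0" for x y
    using q(2)[OF that] that by (simp add: rhom_0[OF rhomC])
  obtain X Y :: complex where XY: "X \<noteq> 0" "Y \<noteq> 0" "ev2 of_rat X Y p \<noteq> 0" using ev2_nonzero[OF p] by blast
  \<comment> \<open>The three torus coordinates are \<open>X\<close>, \<open>Y\<close> and
    \<open>inverse (X * Y)\<close> in the order given by \<open>w\<close>; the witness reads off
    those at the places 1 and 2.\<close>
  have "\<exists>x y. x \<noteq> 0 \<and> y \<noteq> 0 \<and> tev (w 1) x y = X \<and> tev (w 2) x y = Y"
  proof -
    have "tev (w 1) (if w 1 = 1 then X else if w 2 = 1 then Y else inverse (X * Y))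
         (if w 1 = 2 then X else if w 2 = 2 then Y else inverse (X * Y)) = X"
      "tev (w 2) (if w 1 = 1 then X else if w 2 = 1 then Y else inverse (X * Y))
         (if w 1 = 2 then X else if w 2 = 2 then Y else inverse (X * Y)) = Y"
      using perm3_cases[OF w] XY by (auto simp: tev_def field_simps)
    moreover have "(if w 1 = 1 then X else if w 2 = 1 then Y else inverse (X * Y)) \<noteq> 0"
      "(if w 1 = 2 then X else if w 2 = 2 then Y else inverse (X * Y)) \<noteq> 0" using XY by auto
    ultimately show ?thesis by blast
  qed
  then show False using z XY(3) by blast
qed

text \<open>The extension of \<open>sub w\<close> to fractions through a chosen representative;
  \<open>sg_Fract\<close> shows that the choice does not matter.\<close>

definition sg :: "(nat \<Rightarrow> nat) \<Rightarrow> rf \<Rightarrow> rf" where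
  "sg w r = (case (SOME ab. snd ab \<noteq> 0 \<and> r = Fract (fst ab) (snd ab)) of (a,b) \<Rightarrow> sub w a / sub w b)"

lemma sg_Fract:
  assumes w: "w permutes {1,2,3}" and b: "b \<noteq> 0"
  shows "sg w (Fract a b) = sub w a / sub w b"
proof -
  define ab where "ab = (SOME ab. snd ab \<noteq> 0 \<and> Fract a b = Fract (fst ab) (snd ab))"
  have "snd ab \<noteq> 0 \<and> Fract a b = Fract (fst ab) (snd ab)"
    unfolding ab_def by (rule someI[of _ "(a,b)"]) (use b in simp)
  then have ab: "snd ab \<noteq> 0" "a * snd ab = fst ab * b"
    using eq_fract(1)[of b "snd ab" a "fst ab"] b by auto
  have "sub w a * sub w (snd ab) = sub w (fst ab) * sub w b"
    unfolding rhom_mult[OF rhom_sub, symmetric] ab(2) ..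
  moreover have "sg w (Fract a b) = sub w (fst ab) / sub w (snd ab)"
    unfolding sg_def ab_def[symmetric] by (simp add: case_prod_beta)
  ultimately show ?thesis using sub_nonzero[OF w b] sub_nonzero[OF w ab(1)] by (simp add: frac_eq_eq)
qed

lemma rhom_sg:
  assumes w: "w permutes {1,2,3}" shows "rhom (sg w)"
proof (rule rhomI)
  have "sg w (Fract 1 1) = 1"
    by (subst sg_Fract[OF w]) (simp_all add: rhom_1[OF rhom_sub])
  then show "sg w 1 = 1" by (simp only: One_fract_def)
  fix x y :: rf
  obtain a b where x: "x = Fract a b" "b \<noteq> 0" by (cases x)
  obtain a' b' where y: "y = Fract a' b'" "b' \<noteq> 0" by (cases y)
  note n = sub_nonzero[OF w x(2)] sub_nonzero[OF w y(2)]
  show "sg w (x + y) = sg w x + sg w y"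
    using x(2) y(2) n by (simp add: x(1) y(1) sg_Fract[OF w] rhom_add[OF rhom_sub] rhom_mult[OF rhom_sub] add_frac_eq)
  show "sg w (x * y) = sg w x * sg w y"
    using x(2) y(2) n by (simp add: x(1) y(1) sg_Fract[OF w] rhom_mult[OF rhom_sub])
qed

lemma sg_to_fract: "w permutes {1,2,3} \<Longrightarrow> sg w (to_fract p) = sub w p"
  unfolding to_fract_def by (subst sg_Fract) (simp_all add: rhom_1[OF rhom_sub])

lemma sg_inverse:
  assumes w: "w permutes {1,2,3}" shows "sg w (inverse x) = inverse (sg w x)"
proof (cases "x = 0")
  case False
  have "sg w x * sg w (inverse x) = 1"
    unfolding rhom_mult[OF rhom_sg[OF w], symmetric] using False by (simp add: rhom_1[OF rhom_sg[OF w]])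
  then show ?thesis by (rule inverse_unique[symmetric])
qed (simp add: rhom_0[OF rhom_sg[OF w]])

lemma sg_divide: "w permutes {1,2,3} \<Longrightarrow> sg w (x / y) = sg w x / sg w y"
  by (simp add: divide_inverse rhom_mult[OF rhom_sg] sg_inverse)

lemma sg_powi: "w permutes {1,2,3} \<Longrightarrow> sg w (x powi k) = sg w x powi k"
  by (simp add: power_int_def rhom_power[OF rhom_sg] sg_inverse)

lemma sg_scal: "w permutes {1,2,3} \<Longrightarrow> sg w (scal c) = scal c"
  by (simp add: scal_to_fract sg_to_fract)
    (simp add: sub_def ev2_def ev1_pCons[OF rhom_scal] ev1_pCons[OF rhom_ev1[OF rhom_scal]] ev1_0 scal_to_fract)

lemma tv_prod3: "tv 1 * tv 2 * tv 3 = 1"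
proof -
  have "tv 1 * tv 2 \<noteq> 0" by simp
  then show ?thesis unfolding tv_3 by (rule right_inverse)
qed

lemma sg_tv:
  assumes w: "w permutes {1,2,3}" and i: "i \<in> {1,2,3}" shows "sg w (tv i) = tv (w i)"
proof -
  have 1: "sg w (tv 1) = tv (w 1)" and 2: "sg w (tv 2) = tv (w 2)"
    unfolding tv_1 tv_2 sg_to_fract[OF w] sub_def ev2_mon[OF rhom_scal] by simp_all
  have "tv (w 1) * tv (w 2) * tv (w 3) = 1"
    using perm3_cases[OF w] tv_prod3 by (auto simp: mult_ac)
  then have "inverse (tv (w 1) * tv (w 2)) = tv (w 3)" by (rule inverse_unique)
  then have "sg w (tv 3) = tv (w 3)"
    unfolding tv_3 sg_inverse[OF w] rhom_mult[OF rhom_sg[OF w]] 1 2 .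
  then show ?thesis using i 1 2 by auto
qed

lemma prod3_perm:
  fixes g :: "nat \<Rightarrow> 'a::comm_monoid_mult"
  assumes w: "w permutes {1,2,3}"
  shows "g (w 1) * g (w 2) * g (w 3) = g 1 * g 2 * g 3"
  using perm3_cases[OF w] by (auto simp: mult_ac)

lemma sg_lmon:
  assumes w: "w permutes {1,2,3}" shows "sg w (lmon e) = lmon (e \<circ> inv_into UNIV w)"
proof -
  have iw: "inv_into UNIV w (w i) = i" for i using permutes_inverses(2)[OF w] .
  have "sg w (lmon e) = tv (w 1) powi e 1 * tv (w 2) powi e 2 * tv (w 3) powi e 3"
    by (simp add: lmon_def rhom_mult[OF rhom_sg[OF w]] sg_powi[OF w] sg_tv[OF w])
  also have "\<dots> = lmon (e \<circ> inv_into UNIV w)"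
    using prod3_perm[OF w, of "\<lambda>j. tv j powi e (inv_into UNIV w j)"] by (simp add: iw lmon_def)
  finally show ?thesis .
qed

lemma sg_Fval:
  assumes w: "w permutes {1,2,3}" and i: "i \<in> {1,2,3}" shows "sg w (Fval \<chi> i) = Fval \<chi> (w i)"
  by (simp add: Fval_def rhom_sum[OF rhom_sg[OF w]] rhom_mult[OF rhom_sg[OF w]] rhom_of_nat[OF rhom_sg[OF w]]
      sg_powi[OF w] sg_tv[OF w i])

lemma sg_sF: assumes w: "w permutes {1,2,3}" shows "sg w (sF \<chi>) = sF \<chi>"
  by (simp add: sF_def rhom_mult[OF rhom_sg[OF w]] sg_Fval[OF w] prod3_perm[OF w])

text \<open>Whatever representation of \<open>p\<close> is taken, the substituted expression is the
  image of \<open>p\<close> under the homomorphism \<open>sg w\<close>. Hence the definite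
  description in \<open>wact\<close> has a unique solution.\<close>

lemma wact_eq_sg:
  assumes w: "w permutes {1,2,3}" and p: "p \<in> RFQ \<chi>"
  shows "wact w \<chi> p = sg w p"
proof -
  have sgeq: "(\<Sum>e\<in>S. scal (c e) * lmon (e \<circ> inv_into UNIV w)) / sF \<chi> ^ n
      = sg w ((\<Sum>e\<in>S. scal (c e) * lmon e) / sF \<chi> ^ n)" for S :: "(nat \<Rightarrow> int) set" and c n
    by (simp add: sg_divide[OF w] rhom_sum[OF rhom_sg[OF w]] rhom_mult[OF rhom_sg[OF w]] sg_scal[OF w] sg_lmon[OF w]
        rhom_power[OF rhom_sg[OF w]] sg_sF[OF w])
  obtain r n where r: "p = r / sF \<chi> ^ n" "r \<in> RQ" using p unfolding RFQ_def by blast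
  obtain S c where S: "finite S" "r = (\<Sum>e\<in>S. scal (c e) * lmon e)" using r(2) by (rule RQ_E)
  show ?thesis unfolding wact_def
  proof (rule the_equality)
    show "\<exists>S c n. finite S \<and> p = (\<Sum>e\<in>S. scal (c e) * lmon e) / sF \<chi> ^ n \<and>
      sg w p = (\<Sum>e\<in>S. scal (c e) * lmon (e \<circ> inv_into UNIV w)) / sF \<chi> ^ n"
      unfolding sgeq using S r by blast
  next
    fix q assume "\<exists>S c n. finite S \<and> p = (\<Sum>e\<in>S. scal (c e) * lmon e) / sF \<chi> ^ n \<and>
      q = (\<Sum>e\<in>S. scal (c e) * lmon (e \<circ> inv_into UNIV w)) / sF \<chi> ^ n"
    then show "q = sg w p" unfolding sgeq by blast
  qed
qed

text \<open>The instance makes \<^typ>\<open>rat poly poly\<close> a unique factorization domain with gcds. The library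
  theory on fields as Euclidean rings would also turn the complex numbers into a Euclidean ring, whose
  division rules interfere with the simplification of complex fractions above.\<close>

instantiation rat :: "{unique_euclidean_ring, normalization_euclidean_semiring, normalization_semidom_multiplicative}"
begin

definition normalize_rat :: "rat \<Rightarrow> rat" where "normalize_rat x = of_bool (x \<noteq> 0)"
definition unit_factor_rat :: "rat \<Rightarrow> rat" where "unit_factor_rat x = x"
definition modulo_rat :: "rat \<Rightarrow> rat \<Rightarrow> rat" where "modulo_rat x y = (if y = 0 then x else 0)"
definition euclidean_size_rat :: "rat \<Rightarrow> nat" where "euclidean_size_rat x = of_bool (x \<noteq> 0)"
definition division_segment_rat :: "rat \<Rightarrow> rat" where "division_segment_rat x = 1"

instance
  by standard (auto simp: normalize_rat_def unit_factor_rat_def modulo_rat_def euclidean_size_rat_def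
      division_segment_rat_def dvd_field_iff field_split_simps)

end

instantiation rat :: euclidean_ring_gcd
begin

definition gcd_rat :: "rat \<Rightarrow> rat \<Rightarrow> rat" where "gcd_rat = Euclidean_Algorithm.gcd"
definition lcm_rat :: "rat \<Rightarrow> rat \<Rightarrow> rat" where "lcm_rat = Euclidean_Algorithm.lcm"
definition Gcd_rat :: "rat set \<Rightarrow> rat" where "Gcd_rat = Euclidean_Algorithm.Gcd"
definition Lcm_rat :: "rat set \<Rightarrow> rat" where "Lcm_rat = Euclidean_Algorithm.Lcm"

instance
  by standard (simp_all add: gcd_rat_def lcm_rat_def Gcd_rat_def Lcm_rat_def)

end

instance rat :: semiring_gcd_mult_normalize ..

section \<open>The localised ring and coprimality\<close>

text \<open>The interface between the two halves of the proof: all that the cohomology computation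
  uses of the exponential functor is a character with finite support, a positive top weight
  \<open>hi\<close> and only negative nonzero roots.\<close>

locale chi_data =
  fixes \<chi> :: "int \<Rightarrow> nat" and hi :: int
  assumes fin: "finite {k. \<chi> k \<noteq> 0}"
    and a: "\<chi> hi \<noteq> 0" "hi > 0" "\<And>k. \<chi> k \<noteq> 0 \<Longrightarrow> k \<le> hi"
    and neg: "\<And>\<rho>. lpoly \<chi> \<rho> = 0 \<Longrightarrow> \<rho> \<noteq> 0 \<Longrightarrow> Im \<rho> = 0 \<and> Re \<rho> < 0"
begin

abbreviation "f1 \<equiv> Fval \<chi> 1"
abbreviation "f2 \<equiv> Fval \<chi> 2"
abbreviation "f3 \<equiv> Fval \<chi> 3"
abbreviation "R \<equiv> RFQ \<chi>"
abbreviation "M \<equiv> to_fract (mon 1 1)"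

definition N :: nat where "N = nat (Max ((\<lambda>k. \<bar>k\<bar>) ` {k. \<chi> k \<noteq> 0}))"

lemma N: "\<chi> k \<noteq> 0 \<Longrightarrow> \<bar>k\<bar> \<le> int N"
proof -
  assume "\<chi> k \<noteq> 0"
  then have "\<bar>k\<bar> \<le> Max ((\<lambda>k. \<bar>k\<bar>) ` {k. \<chi> k \<noteq> 0})" by (intro Max_ge) (use fin in auto)
  then show ?thesis unfolding N_def by linarith
qed

lemma Fval_pf: "M ^ N * Fval \<chi> i = to_fract (pf \<chi> N i)"
proof -
  have t: "(if i = 1 then tv 1 else if i = 2 then tv 2 else inverse (tv 1 * tv 2)) = tv i"
    by (simp add: tv_def)
  have "to_fract (pf \<chi> N i) = M ^ N * (\<Sum>k\<in>{k. \<chi> k \<noteq> 0}. of_nat (\<chi> k) *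
      (if i = 1 then tv 1 else if i = 2 then tv 2 else inverse (tv 1 * tv 2)) powi k)"
    unfolding ev2_scal_tv[of "pf \<chi> N i", symmetric] tv_prod[symmetric]
    by (rule ev2_pf[where \<chi>=\<chi> and n=N, OF rhom_scal N tv_nz tv_nz])
  then show ?thesis unfolding t Fval_def by (rule sym)
qed

lemma Fval_RQ: "Fval \<chi> i \<in> RQ"
  unfolding Fval_def by (intro RQ_sum RQ_mult RQ_of_nat RQ_tv)

lemma evC_pf: "x \<noteq> 0 \<Longrightarrow> y \<noteq> 0 \<Longrightarrow> ev2 of_rat x y (pf \<chi> N i) = (x * y) ^ N * lpoly \<chi> (tev i x y)"
  unfolding lpoly_def tev_def by (rule ev2_pf[where \<chi>=\<chi> and n=N, OF rhom_of_rat N])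

lemma one_pos: "0 < (1::real)" by simp

lemma lpoly_real_pos:
  assumes "r > 0" obtains G where "lpoly \<chi> (of_real r :: complex) = of_real G" "G > 0"
  using lpoly_pos[OF fin _ assms] a(1) by blast

text \<open>At the identity of the torus the value is the sum of the multiplicities, which is
  positive.\<close>

lemma Fval_nz: "Fval \<chi> i \<noteq> 0"
proof
  assume "Fval \<chi> i = 0"
  then have "pf \<chi> N i = 0" using Fval_pf[of i] by simp
  then have "ev2 of_rat 1 1 (pf \<chi> N i) = (0::complex)" by (simp only: rhom_0[OF rhomC])
  then have "lpoly \<chi> (tev i 1 1) = 0" using evC_pf[of 1 1 i] by simp
  moreover have "tev i 1 1 = of_real 1" by (simp add: tev_def)
  ultimately have "lpoly \<chi> (of_real 1 :: complex) = 0" by (simp only:)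
  moreover obtain G where "lpoly \<chi> (of_real 1 :: complex) = of_real G" "G > 0" using lpoly_real_pos[OF one_pos] by blast
  ultimately show False by simp
qed

lemma sF_nz: "sF \<chi> \<noteq> 0" by (simp add: sF_def Fval_nz)

lemma RFQ_iff: "r \<in> R \<longleftrightarrow> (\<exists>n. r * sF \<chi> ^ n \<in> RQ)"
proof
  assume "r \<in> R"
  then obtain q n where "r = q / sF \<chi> ^ n" "q \<in> RQ" unfolding RFQ_def by blast
  then have "r * sF \<chi> ^ n \<in> RQ" using sF_nz by simp
  then show "\<exists>n. r * sF \<chi> ^ n \<in> RQ" ..
next
  assume "\<exists>n. r * sF \<chi> ^ n \<in> RQ"
  then obtain n where "r * sF \<chi> ^ n \<in> RQ" ..
  moreover have "r = (r * sF \<chi> ^ n) / sF \<chi> ^ n" using sF_nz by simp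
  ultimately show "r \<in> R" unfolding RFQ_def by blast
qed

lemma sF_RQ: "sF \<chi> \<in> RQ" unfolding sF_def by (intro RQ_mult Fval_RQ)

lemma R_of_RQ: "r \<in> RQ \<Longrightarrow> r \<in> R"
  unfolding RFQ_iff by (rule exI[of _ 0]) simp

lemma R_0: "0 \<in> R" and R_1: "1 \<in> R" by (intro R_of_RQ RQ_0 RQ_1)+

lemma R_add: assumes "r \<in> R" "q \<in> R" shows "r + q \<in> R"
proof -
  obtain n m where nm: "r * sF \<chi> ^ n \<in> RQ" "q * sF \<chi> ^ m \<in> RQ" using assms unfolding RFQ_iff by blast
  have "r * sF \<chi> ^ n * sF \<chi> ^ m + q * sF \<chi> ^ m * sF \<chi> ^ n \<in> RQ"
    by (rule RQ_add[OF RQ_mult[OF nm(1) RQ_power[OF sF_RQ]] RQ_mult[OF nm(2) RQ_power[OF sF_RQ]]])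
  moreover have "r * sF \<chi> ^ n * sF \<chi> ^ m + q * sF \<chi> ^ m * sF \<chi> ^ n = (r + q) * sF \<chi> ^ (n + m)"
    by (simp add: algebra_simps power_add)
  ultimately show ?thesis unfolding RFQ_iff by (intro exI[of _ "n + m"]) simp
qed

lemma R_mult: assumes "r \<in> R" "q \<in> R" shows "r * q \<in> R"
proof -
  obtain n m where "r * sF \<chi> ^ n \<in> RQ" "q * sF \<chi> ^ m \<in> RQ" using assms unfolding RFQ_iff by blast
  then have "(r * sF \<chi> ^ n) * (q * sF \<chi> ^ m) \<in> RQ" by (rule RQ_mult)
  moreover have "(r * sF \<chi> ^ n) * (q * sF \<chi> ^ m) = (r * q) * sF \<chi> ^ (n + m)"
    by (simp add: algebra_simps power_add)
  ultimately show ?thesis unfolding RFQ_iff by (intro exI[of _ "n + m"]) simp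
qed

lemma R_uminus: "r \<in> R \<Longrightarrow> - r \<in> R"
  using R_mult[OF R_of_RQ[OF RQ_uminus[OF RQ_1]], of r] by simp

lemma R_diff: "r \<in> R \<Longrightarrow> q \<in> R \<Longrightarrow> r - q \<in> R"
  using R_add[of r "- q"] R_uminus by simp

lemma R_power: "r \<in> R \<Longrightarrow> r ^ n \<in> R"
  by (induction n) (auto intro: R_1 R_mult)

lemma R_Fval: "Fval \<chi> i \<in> R" by (intro R_of_RQ Fval_RQ)

lemma R_inverse_sF: "inverse (sF \<chi>) \<in> R"
  unfolding RFQ_iff by (rule exI[of _ 1]) (simp add: sF_nz RQ_1)

lemma R_inverse_Fval: assumes "i \<in> {1,2,3}" shows "inverse (Fval \<chi> i) \<in> R"
proof -
  have s: "sF \<chi> * inverse (sF \<chi>) = 1" by (rule right_inverse[OF sF_nz])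
  have i: "inverse f1 = f2 * f3 * inverse (sF \<chi>)" "inverse f2 = f1 * f3 * inverse (sF \<chi>)"
    "inverse f3 = f1 * f2 * inverse (sF \<chi>)"
    by (rule inverse_unique, use s in \<open>simp only: sF_def mult_ac\<close>)+
  have "f2 * f3 * inverse (sF \<chi>) \<in> R" "f1 * f3 * inverse (sF \<chi>) \<in> R" "f1 * f2 * inverse (sF \<chi>) \<in> R"
    by (rule R_mult[OF R_mult[OF R_Fval R_Fval] R_inverse_sF])+
  then show ?thesis using assms unfolding i[symmetric] by blast
qed

lemma R_powi: "r \<in> R \<Longrightarrow> inverse r \<in> R \<Longrightarrow> r powi k \<in> R"
  unfolding power_int_def by (simp add: R_power)

lemma R_inverse_M: "inverse M \<in> R"
proof -
  have "tv 1 powi (-1) * tv 2 powi (-1) = inverse M"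
    unfolding tv_prod[symmetric] by (simp add: power_int_minus)
  then show ?thesis using R_of_RQ[OF RQ_mult[OF RQ_tv RQ_tv]] by metis
qed

lemma R_to_fract: "to_fract p \<in> R" by (intro R_of_RQ RQ_to_fract)

text \<open>The inverses of t_1 and t_2 and the element t_3 become polynomials after multiplication
  by t_1 t_2, and the elements cleared by some power of it form a ring \<open>C\<close>.\<close>

lemma RQ_denom:
  assumes "r \<in> RQ" shows "\<exists>j p. r * M ^ j = to_fract p"
proof -
  define C where "C = {r. \<exists>j p. r * M ^ j = to_fract p}"
  have Ci: "r \<in> C" if "r * M ^ j = to_fract p" for r j p using that unfolding C_def by blast
  have Mp: "M ^ k = to_fract (mon 1 1 ^ k)" for k by (induction k) simp_all
  have C_add: "x + y \<in> C" if "x \<in> C" "y \<in> C" for x y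
  proof -
    obtain j p j' p' where "x * M ^ j = to_fract p" "y * M ^ j' = to_fract p'" using \<open>x \<in> C\<close> \<open>y \<in> C\<close> unfolding C_def by blast
    moreover have "(x + y) * M ^ (j + j') = x * M ^ j * M ^ j' + y * M ^ j' * M ^ j" by (simp add: algebra_simps power_add)
    ultimately show ?thesis by (intro Ci[of _ "j + j'" "p * mon 1 1 ^ j' + p' * mon 1 1 ^ j"]) (simp add: Mp)
  qed
  have C_mult: "x * y \<in> C" if "x \<in> C" "y \<in> C" for x y
  proof -
    obtain j p j' p' where "x * M ^ j = to_fract p" "y * M ^ j' = to_fract p'" using \<open>x \<in> C\<close> \<open>y \<in> C\<close> unfolding C_def by blast
    moreover have "(x * y) * M ^ (j + j') = (x * M ^ j) * (y * M ^ j')" by (simp add: algebra_simps power_add)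
    ultimately show ?thesis by (intro Ci[of _ "j + j'" "p * p'"]) simp
  qed
  have C_fr: "to_fract p \<in> C" for p by (rule Ci[of _ 0]) simp
  have C_pow: "x ^ k \<in> C" if "x \<in> C" for x k
    by (induction k) (use that C_mult C_fr[of 1] in auto)
  have t: "tv 1 \<in> C" "tv 2 \<in> C" "inverse (tv 1) \<in> C" "inverse (tv 2) \<in> C"
    unfolding tv_1 tv_2
  proof (rule C_fr, rule C_fr)
    have "inverse (tv 1) * M ^ 1 = to_fract (mon 0 1)" "inverse (tv 2) * M ^ 1 = to_fract (mon 1 0)"
      unfolding tv_1[symmetric] tv_2[symmetric] tv_prod[symmetric] power_one_right by (simp_all add: field_simps)
    then show "inverse (to_fract (mon 1 0)) \<in> C" "inverse (to_fract (mon 0 1)) \<in> C"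
      unfolding tv_1 tv_2 by (blast intro: Ci)+
  qed
  have t3: "tv 3 \<in> C" "inverse (tv 3) \<in> C"
    unfolding tv_3 by (auto intro!: C_mult t simp: inverse_mult_distrib)
  have tp: "tv i powi k \<in> C" if "i \<in> {1,2,3}" for i k
    using that t t3 by (auto simp: power_int_def intro!: C_pow)
  obtain S c where S: "finite S" "r = (\<Sum>e\<in>S. scal (c e) * lmon e)" using assms by (rule RQ_E)
  have term_C: "scal (c e) * lmon e \<in> C" for e
    unfolding scal_to_fract lmon_def by (intro C_mult C_fr tp) auto
  have "r \<in> C" unfolding S(2) using S(1) by induction (use term_C C_add C_fr[of 0] in auto)
  then show ?thesis by (simp add: C_def)
qed

text \<open>The denominators that occur, powers of \<open>sF \<chi>\<close> and of \<open>M\<close>,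
  are units of \<open>R\<close>; divisibility questions in \<open>R\<close> thus reduce to
  polynomials.\<close>

lemma R_denom:
  assumes "r \<in> R"
  obtains d p where "d \<noteq> 0" "inverse (to_fract d) \<in> R" "r * to_fract d = to_fract p"
proof -
  define s where "s = pf \<chi> N 1 * pf \<chi> N 2 * pf \<chi> N 3"
  have s: "to_fract s = sF \<chi> * M ^ (3 * N)"
  proof -
    have "to_fract s = (M ^ N * f1) * (M ^ N * f2) * (M ^ N * f3)" unfolding Fval_pf s_def by simp
    also have "\<dots> = sF \<chi> * (M ^ N * M ^ N * M ^ N)" by (simp add: sF_def mult_ac)
    also have "M ^ N * M ^ N * M ^ N = M ^ (3 * N)"
      unfolding power_add[symmetric] by (rule arg_cong[of _ _ "\<lambda>k. M ^ k"]) simp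
    finally show ?thesis .
  qed
  obtain n where "r * sF \<chi> ^ n \<in> RQ" using assms unfolding RFQ_iff by blast
  then obtain j p where p: "r * sF \<chi> ^ n * M ^ j = to_fract p" using RQ_denom by blast
  have tp: "to_fract (x ^ k) = to_fract x ^ k" for x :: "rat poly poly" and k by (induction k) simp_all
  define d where "d = s ^ n * mon 1 1 ^ j"
  have d: "to_fract d = sF \<chi> ^ n * (M ^ (3 * N)) ^ n * M ^ j"
    by (simp add: d_def tp s power_mult_distrib)
  have "to_fract d \<noteq> 0" unfolding d using sF_nz by simp
  then have "d \<noteq> 0" by auto
  moreover have "inverse (to_fract d) = inverse (sF \<chi>) ^ n * (inverse M ^ (3 * N)) ^ n * inverse M ^ j"
    unfolding d by (simp add: power_inverse)
  then have "inverse (to_fract d) \<in> R" by (auto intro!: R_mult R_power R_inverse_sF R_inverse_M)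
  moreover have "r * to_fract d = to_fract (p * (mon 1 1 ^ (3 * N)) ^ n)"
    unfolding d to_fract_mult p[symmetric] tp by (simp add: mult_ac)
  ultimately show ?thesis using that by blast
qed

text \<open>The term of the top weight alone is at least \<open>t\<close> for
  \<open>t \<ge> 1\<close>, so it exceeds \<open>G\<close> at
  \<open>t = \<bar>G\<bar> + 1\<close>.\<close>

lemma not_const: 
  assumes "\<And>t. t > 0 \<Longrightarrow> lpoly \<chi> (of_real t :: complex) = of_real G" shows False
proof -
  define t where "t = \<bar>G\<bar> + 1"
  have t: "t \<ge> 1" by (simp add: t_def)
  have "of_real (\<Sum>k\<in>{k. \<chi> k \<noteq> 0}. real (\<chi> k) * t powi k) = lpoly \<chi> (of_real t :: complex)"
    by (simp add: lpoly_def)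
  also have "\<dots> = of_real G" using assms t by simp
  finally have "(\<Sum>k\<in>{k. \<chi> k \<noteq> 0}. real (\<chi> k) * t powi k) = G" by (simp only: of_real_eq_iff)
  moreover have "real (\<chi> hi) * t powi hi \<le> (\<Sum>k\<in>{k. \<chi> k \<noteq> 0}. real (\<chi> k) * t powi k)"
    by (rule member_le_sum) (use a fin t in auto)
  moreover have "t \<le> t powi hi"
    using power_int_increasing[of 1 hi t] a(2) t by simp
  moreover have "1 * t powi hi \<le> real (\<chi> hi) * t powi hi"
    using a(1) t by (intro mult_right_mono) auto
  ultimately show False using t_def by linarith
qed

text \<open>At the point (t, 1) equality would read F(1) = F(1/t), at (1, 1/t) it would read F(1/t)
  = F(t); F would be constant on the positive reals.\<close>

lemma f2_ne_f3: "f2 \<noteq> f3"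
proof
  assume "f2 = f3"
  then have e: "pf \<chi> N 2 = pf \<chi> N 3" using Fval_pf[of 2] Fval_pf[of 3] by simp
  obtain G where G: "lpoly \<chi> (of_real 1 :: complex) = of_real G" using lpoly_real_pos[OF one_pos] by blast
  show False
  proof (rule not_const)
    fix t :: real assume t: "t > 0"
    have "lpoly \<chi> (tev 2 (of_real t) 1) = lpoly \<chi> (tev 3 (of_real t) 1)"
      using evC_pf[of "of_real t" 1 2] evC_pf[of "of_real t" 1 3] t e by simp
    then have "lpoly \<chi> (of_real (inverse t) :: complex) = of_real G" using G by (simp add: tev_def)
    moreover have "lpoly \<chi> (tev 2 1 (of_real (inverse t))) = lpoly \<chi> (tev 3 1 (of_real (inverse t)))"
      using evC_pf[of 1 "of_real (inverse t)" 2] evC_pf[of 1 "of_real (inverse t)" 3] t e by simp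
    ultimately show "lpoly \<chi> (of_real t :: complex) = of_real G" by (simp add: tev_def)
  qed
qed

lemma f1_ne_f2: "f1 \<noteq> f2"
proof
  assume e: "f1 = f2"
  have w: "transpose 1 3 permutes {1,2,3::nat}" by (rule permutes_swap_id) auto
  have "sg (transpose 1 3) f1 = sg (transpose 1 3) f2" using e by simp
  then show False using f2_ne_f3 sg_Fval[OF w, of 1] sg_Fval[OF w, of 2] by (simp add: transpose_def)
qed

text \<open>With g = F(t), h = F(1/t) and c = F(1), the points (1, t) and (1, 1/t) would give g^2 =
  c h and h^2 = c g, hence g = c for all positive t. This is what makes \<open>w\<close> differ from
  1.\<close>

lemma square_ne: "f2\<^sup>2 \<noteq> f1 * f3"
proof
  assume "f2\<^sup>2 = f1 * f3"
  then have "(M ^ N * f2)\<^sup>2 = (M ^ N * f1) * (M ^ N * f3)" by (simp add: power2_eq_square mult_ac)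
  then have e: "pf \<chi> N 2 * pf \<chi> N 2 = pf \<chi> N 1 * pf \<chi> N 3"
    unfolding Fval_pf power2_eq_square to_fract_mult[symmetric] to_fract_eq_iff .
  obtain c where c: "lpoly \<chi> (of_real 1 :: complex) = of_real c" "c > 0" using lpoly_real_pos[OF one_pos] by blast
  show False
  proof (rule not_const)
    fix t :: real assume t: "t > 0"
    obtain g where g: "lpoly \<chi> (of_real t :: complex) = of_real g" "g > 0" using lpoly_real_pos[OF t] by blast
    obtain h where h: "lpoly \<chi> (of_real (inverse t) :: complex) = of_real h" "h > 0" using lpoly_real_pos[OF positive_imp_inverse_positive[OF t]] by blast
    have ev: "lpoly \<chi> y * lpoly \<chi> y = lpoly \<chi> 1 * lpoly \<chi> (inverse y)" if "y \<noteq> 0" for y :: complex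
    proof -
      have "ev2 of_rat 1 y (pf \<chi> N 2) * ev2 of_rat 1 y (pf \<chi> N 2) = ev2 of_rat 1 y (pf \<chi> N 1) * ev2 of_rat 1 y (pf \<chi> N 3)"
        unfolding rhom_mult[OF rhomC, symmetric] e ..
      then show ?thesis using that by (simp add: evC_pf tev_def)
    qed
    have "complex_of_real (g * g) = of_real (c * h)" "complex_of_real (h * h) = of_real (c * g)"
      using ev[of "of_real t"] ev[of "of_real (inverse t)"] t g h c by simp_all
    then have gh: "g * g = c * h" "h * h = c * g" by (simp_all only: of_real_eq_iff)
    have "(g * g) * (g * g) = c * c * (c * g)" unfolding gh(1) using gh(2) by (simp add: mult_ac)
    then have "g ^ 3 = c ^ 3" using g(2) by (simp add: power3_eq_cube mult_ac)
    then have "g = c" using g(2) c(2) by (simp add: power_eq_iff_eq_base)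
    then show "lpoly \<chi> (of_real t :: complex) = of_real c" using g by simp
  qed
qed

lemma dvd_mon_power:
  "g \<noteq> 0 \<Longrightarrow> (\<And>H. prime_elem H \<Longrightarrow> H dvd g \<Longrightarrow> H dvd mon 1 0 \<or> H dvd mon 0 1) \<Longrightarrow> \<exists>k. g dvd mon 1 1 ^ k"
proof (induction g rule: prime_divisors_induct)
  case (unit x)
  then show ?case by (intro exI[of _ 0]) (simp add: unit_imp_dvd)
next
  case (factor p x)
  have "\<exists>k. x dvd mon 1 1 ^ k"
    by (rule factor.IH) (use factor.prems in \<open>auto intro: dvd_mult\<close>)
  then obtain k where k: "x dvd mon 1 1 ^ k" ..
  have m: "mon 1 1 = mon 1 0 * mon 0 1" by (simp add: mon_mult)
  have "p dvd mon 1 0 \<or> p dvd mon 0 1"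
    using factor.prems(2)[of p] factor.hyps by (simp add: prime_def)
  then have "p dvd mon 1 1" unfolding m by auto
  then have "p * x dvd mon 1 1 * mon 1 1 ^ k" using k by (rule mult_dvd_mono)
  then show ?case by (intro exI[of _ "Suc k"]) simp
qed simp

text \<open>By \<open>common_prime_divisor_monomial\<close> the gcd \<open>g\<close> of the cleared
  differences divides a power of t_1 t_2 and is therefore a unit of \<open>R\<close>; the remaining
  factors \<open>q1\<close> and \<open>q2\<close> are coprime polynomials.\<close>

theorem coprime_R:
  assumes al: "\<alpha> \<in> R" and be: "\<beta> \<in> R" and eq: "\<alpha> * (f1 - f2) = \<beta> * (f2 - f3)"
  obtains \<gamma> where "\<gamma> \<in> R" "\<alpha> = \<gamma> * (f2 - f3)" "\<beta> = \<gamma> * (f1 - f2)"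
proof -
  define p1 where "p1 = pf \<chi> N 1 - pf \<chi> N 2"
  define p2 where "p2 = pf \<chi> N 2 - pf \<chi> N 3"
  have p: "to_fract p1 = M ^ N * (f1 - f2)" "to_fract p2 = M ^ N * (f2 - f3)"
    by (simp_all add: p1_def p2_def Fval_pf[symmetric] right_diff_distrib)
  obtain d A where d: "d \<noteq> 0" "inverse (to_fract d) \<in> R" "\<alpha> * to_fract d = to_fract A" using R_denom[OF al] by blast
  obtain e B where e: "e \<noteq> 0" "inverse (to_fract e) \<in> R" "\<beta> * to_fract e = to_fract B" using R_denom[OF be] by blast
  have "to_fract (A * e * p1) = to_fract (B * d * p2)"
  proof -
    have "to_fract (A * e * p1) = to_fract d * to_fract e * M ^ N * (\<alpha> * (f1 - f2))"
      unfolding to_fract_mult d(3)[symmetric] p by (simp only: mult_ac)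
    also have "\<dots> = to_fract (B * d * p2)"
      unfolding eq to_fract_mult e(3)[symmetric] p by (simp only: mult_ac)
    finally show ?thesis .
  qed
  then have poly_eq: "A * e * p1 = B * d * p2" by (simp only: to_fract_eq_iff)
  define g where "g = gcd p1 p2"
  have "to_fract p1 \<noteq> 0" unfolding p using f1_ne_f2 by simp
  then have p10: "p1 \<noteq> 0" by auto
  then have g0: "g \<noteq> 0" by (simp add: g_def)
  obtain q1 q2 where q: "p1 = q1 * g" "p2 = q2 * g" "coprime q1 q2"
    using gcd_coprime_exists[of p1 p2] g0 unfolding g_def by blast
  have "A * e * q1 = B * d * q2" using poly_eq g0 unfolding q(1,2) by (simp add: mult.assoc[symmetric])
  then have "q2 dvd A * e * q1" by simp
  then have "q2 dvd A * e" using q(3) by (simp add: coprime_dvd_mult_left_iff coprime_commute)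
  then obtain t where t: "A * e = q2 * t" by (elim dvdE)
  have "\<exists>k. g dvd mon 1 1 ^ k"
  proof (rule dvd_mon_power[OF g0])
    fix H assume H: "prime_elem H" "H dvd g"
    have "H dvd p1" "H dvd p2" using H(2) by (auto simp: g_def)
    then show "H dvd mon 1 0 \<or> H dvd mon 0 1"
      using common_prime_divisor_monomial[OF fin a N neg H(1)] unfolding p1_def p2_def by blast
  qed
  then obtain k u where u: "mon 1 1 ^ k = g * u" by (auto elim: dvdE)
  have Mk: "M ^ k = to_fract g * to_fract u"
  proof -
    have "M ^ k = to_fract (mon 1 1 ^ k)" by (induction k) simp_all
    then show ?thesis by (simp add: u)
  qed
  \<comment> \<open>This is \<open>t * M ^ N / (g * d * e)\<close>, with the inverse of
    \<open>g\<close> written as \<open>u / M ^ k\<close> to exhibit it as an element of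
    \<open>R\<close>.\<close>
  define \<gamma> where "\<gamma> = to_fract t * to_fract u * M ^ N * inverse M ^ k * inverse (to_fract d) * inverse (to_fract e)"
  have "\<gamma> \<in> R" unfolding \<gamma>_def by (intro R_mult R_to_fract R_power R_inverse_M d e)
  moreover have ag: "\<alpha> = \<gamma> * (f2 - f3)"
  proof -
    have n: "to_fract d \<noteq> 0" "to_fract e \<noteq> 0" "M ^ k \<noteq> 0" using d(1) e(1) by simp_all
    have "\<alpha> * (to_fract d * to_fract e * M ^ k) = (\<alpha> * to_fract d) * to_fract e * M ^ k" by (simp only: mult_ac)
    also have "\<dots> = to_fract (A * e) * M ^ k" unfolding d(3) to_fract_mult ..
    also have "\<dots> = to_fract t * to_fract u * to_fract p2"
      unfolding t Mk q(2) to_fract_mult by (simp only: mult_ac)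
    also have "\<dots> = \<gamma> * (f2 - f3) * (to_fract d * to_fract e * M ^ k)"
      unfolding p(2) \<gamma>_def power_inverse using n by (simp add: field_simps)
    finally show ?thesis using n by (simp only: mult_right_cancel[OF no_zero_divisors[OF no_zero_divisors[OF n(1,2)] n(3)]])
  qed
  moreover have "\<beta> = \<gamma> * (f1 - f2)"
  proof -
    have "\<beta> * (f2 - f3) = \<gamma> * (f1 - f2) * (f2 - f3)" using eq unfolding ag by (simp only: mult_ac)
    then show ?thesis using f2_ne_f3 by simp
  qed
  ultimately show ?thesis using that by blast
qed

end

section \<open>Lattice coordinates of the alcove triangulation\<close>

lemma permutes_3_cases:
  assumes \<pi>: "\<pi> permutes {a,b,c}" and d: "a \<noteq> b" "a \<noteq> c" "b \<noteq> c"
  shows "\<pi> = id \<or> \<pi> = transpose a b \<or> \<pi> = transpose a c \<or> \<pi> = transpose b c \<or>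
    \<pi> = transpose a b \<circ> transpose b c \<or> \<pi> = transpose b c \<circ> transpose a b"
proof -
  have im: "\<pi> a \<in> {a,b,c}" "\<pi> b \<in> {a,b,c}" "\<pi> c \<in> {a,b,c}"
    using permutes_in_image[OF \<pi>] by blast+
  have ne: "\<pi> a \<noteq> \<pi> b" "\<pi> a \<noteq> \<pi> c" "\<pi> b \<noteq> \<pi> c"
    using d by (simp_all add: inj_eq[OF permutes_inj[OF \<pi>]])
  have ext: "\<pi> = g" if "\<pi> a = g a" "\<pi> b = g b" "\<pi> c = g c" "\<And>x. x \<notin> {a,b,c} \<Longrightarrow> g x = x" for g
    using that permutes_not_in[OF \<pi>] by (intro ext) (metis insertE singletonD)
  show ?thesis
  proof (cases "\<pi> a = a")
    case True
    show ?thesis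
    proof (cases "\<pi> b = b")
      case bb: True
      have "\<pi> = id" by (rule ext) (use True bb im ne in auto)
      then show ?thesis by blast
    next
      case False
      have "\<pi> = transpose b c" by (rule ext) (use True False im ne d in \<open>auto simp: transpose_def\<close>)
      then show ?thesis by blast
    qed
  next
    case na: False
    show ?thesis
    proof (cases "\<pi> a = b")
      case ab: True
      show ?thesis
      proof (cases "\<pi> b = a")
        case True
        have "\<pi> = transpose a b" by (rule ext) (use ab True im ne d in \<open>auto simp: transpose_def\<close>)
        then show ?thesis by blast
      next
        case False
        have "\<pi> = transpose a b \<circ> transpose b c" by (rule ext) (use ab False im ne d in \<open>auto simp: transpose_def\<close>)
        then show ?thesis by blast
      qed
    next
      case nb: False
      show ?thesis
      proof (cases "\<pi> b = b")
        case True
        have "\<pi> = transpose a c" by (rule ext) (use na nb True im ne d in \<open>auto simp: transpose_def\<close>)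
        then show ?thesis by blast
      next
        case False
        have "\<pi> = transpose b c \<circ> transpose a b" by (rule ext) (use na nb False im ne d in \<open>auto simp: transpose_def\<close>)
        then show ?thesis by blast
      qed
    qed
  qed
qed

lemma sign_transpose: "a \<noteq> b \<Longrightarrow> sign (transpose a b) = - 1"
  by (simp add: sign_swap_id)

lemma sign_transpose_comp: "a \<noteq> b \<Longrightarrow> c \<noteq> d \<Longrightarrow> sign (transpose a b \<circ> transpose c d) = 1"
  by (simp add: sign_compose permutation_swap_id sign_swap_id)

text \<open>Coordinates in the basis (2, -1, -1), (-1, 2, -1) of the scaled coweight lattice;
  subtracting the third coordinate of the point from the first two gives 3m and 3n, which is how
  \<open>cm\<close> and \<open>cn\<close> recover them.\<close>

definition V :: "int \<Rightarrow> int \<Rightarrow> pt" where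
  "V m n = (2 * m - n, 2 * n - m, - m - n)"

definition cm :: "pt \<Rightarrow> int" where "cm x = (cmp x 1 - cmp x 3) div 3"
definition cn :: "pt \<Rightarrow> int" where "cn x = (cmp x 2 - cmp x 3) div 3"

lemma cmp_simps [simp]: "cmp (a,b,c) 1 = a" "cmp (a,b,c) 2 = b" "cmp (a,b,c) 3 = c"
  by (simp_all add: cmp_def)

lemma mkpt_eq: "mkpt g = (g 1, g 2, g 3)" by (simp add: mkpt_def)

lemma cm_V [simp]: "cm (V m n) = m" and cn_V [simp]: "cn (V m n) = n"
proof -
  have "2 * m - n - (- m - n) = m * 3" "2 * n - m - (- m - n) = n * 3" by simp_all
  then show "cm (V m n) = m" "cn (V m n) = n" unfolding cm_def cn_def V_def cmp_simps by simp_all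
qed

lemma V_eq_iff [simp]: "V m n = V m' n' \<longleftrightarrow> m = m' \<and> n = n'"
  by (metis cm_V cn_V)

lemma V_vertex [simp]: "V m n \<in> alc_vertices"
proof -
  have "2 * m - n - (2 * n - m) = 3 * (m - n)" "2 * n - m - (- m - n) = 3 * n" by simp_all
  then show ?thesis unfolding alc_vertices_def mem_Collect_eq V_def cmp_simps by simp
qed

lemma vertexE:
  assumes "x \<in> alc_vertices" obtains m n where "x = V m n"
proof -
  obtain a b c where x: "x = (a,b,c)" by (cases x)
  have h: "a + b + c = 0" "(a - b) mod 3 = 0" "(b - c) mod 3 = 0" using assms by (simp_all add: alc_vertices_def x)
  obtain k l where kl: "a - b = 3 * k" "b - c = 3 * l" using h(2,3) by (auto elim!: dvdE simp: mod_eq_0_iff_dvd)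
  have "x = V (k + l) l" unfolding x V_def using h(1) kl by simp
  then show ?thesis using that by blast
qed

text \<open>In these coordinates the triangulation is the square grid with the diagonal (1, 1) drawn
  in each square, which cuts it into an upward and a downward triangle.\<close>

definition dirs :: "(int \<times> int) set" where
  "dirs = {(1,0), (0,1), (1,1), (-1,0), (0,-1), (-1,-1)}"

lemma adjacent_V: "adjacent (V m n) (V m' n') \<longleftrightarrow> (m' - m, n' - n) \<in> dirs"
proof -
  have "edge_dirs = (\<Union>i\<in>{1,2,3}. \<Union>s\<in>{1,-1}. {mkpt (\<lambda>j. s * (3 * of_bool (j = i) - 1))})"
    unfolding edge_dirs_def by blast
  also have "\<dots> = {V 1 0, V (- 1) 0, V 0 1, V 0 (- 1), V (- 1) (- 1), V 1 1}"
    by (simp add: mkpt_eq V_def insert_commute)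
  finally have e: "edge_dirs = {V 1 0, V (- 1) 0, V 0 1, V 0 (- 1), V (- 1) (- 1), V 1 1}" .
  have d: "mkpt (\<lambda>i. cmp (V m' n') i - cmp (V m n) i) = V (m' - m) (n' - n)"
    by (simp add: mkpt_eq V_def)
  show ?thesis unfolding adjacent_def d e dirs_def by auto
qed

lemma adjacent_sym: "(a, b) \<in> dirs \<Longrightarrow> (- a, - b) \<in> dirs"
  by (auto simp: dirs_def)

lemma transl_V: "l \<in> Lambda \<Longrightarrow> transl l (V m n) = V (m + cmp l 1 - cmp l 3) (n + cmp l 2 - cmp l 3)"
  unfolding transl_def mkpt_eq V_def cmp_simps Lambda_def by simp

lemma simplices_0: "xs \<in> simplices 0 \<longleftrightarrow> (\<exists>m n. xs = [V m n])"
proof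
  assume "xs \<in> simplices 0"
  then have "length xs = 1" "set xs \<subseteq> alc_vertices" by (auto simp: simplices_def One_nat_def)
  then obtain x where "xs = [x]" "x \<in> alc_vertices" by (auto simp: length_Suc_conv One_nat_def)
  then show "\<exists>m n. xs = [V m n]" using vertexE by blast
next
  assume "\<exists>m n. xs = [V m n]"
  then show "xs \<in> simplices 0" by (auto simp: simplices_def)
qed

lemma all_less_Suc: "(\<forall>i<Suc n. P i) \<longleftrightarrow> (\<forall>i<n. P i) \<and> P n"
  by (auto simp: less_Suc_eq)

lemma simplices_1_list: "[V m n, V m' n'] \<in> simplices 1 \<longleftrightarrow> (m' - m, n' - n) \<in> dirs"
  using adjacent_sym[of "m' - m" "n' - n"]
  by (auto simp: simplices_def adjacent_V all_less_Suc One_nat_def)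

lemma simplices_1: "xs \<in> simplices 1 \<longleftrightarrow> (\<exists>m n m' n'. xs = [V m n, V m' n'] \<and> (m' - m, n' - n) \<in> dirs)"
proof
  assume xs: "xs \<in> simplices 1"
  then have "length xs = Suc (Suc 0)" "set xs \<subseteq> alc_vertices" by (auto simp: simplices_def One_nat_def)
  then obtain x y where xy: "xs = [x,y]" "x \<in> alc_vertices" "y \<in> alc_vertices" by (auto simp: length_Suc_conv)
  obtain m n where x: "x = V m n" using vertexE[OF xy(2)] by blast
  obtain m' n' where y: "y = V m' n'" using vertexE[OF xy(3)] by blast
  show "\<exists>m n m' n'. xs = [V m n, V m' n'] \<and> (m' - m, n' - n) \<in> dirs"
    using xs unfolding xy(1) x y simplices_1_list by blast
next
  assume "\<exists>m n m' n'. xs = [V m n, V m' n'] \<and> (m' - m, n' - n) \<in> dirs"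
  then obtain m n m' n' where "xs = [V m n, V m' n']" "(m' - m, n' - n) \<in> dirs" by blast
  then show "xs \<in> simplices 1" by (simp only: simplices_1_list)
qed

lemma simplices_2_list: "[V m n, V m' n', V m'' n''] \<in> simplices 2 \<longleftrightarrow>
    (m' - m, n' - n) \<in> dirs \<and> (m'' - m, n'' - n) \<in> dirs \<and> (m'' - m', n'' - n') \<in> dirs"
proof -
  have "adjacent (V b b') (V a a')" if "adjacent (V a a') (V b b')" for a a' b b'
    using adjacent_sym[OF that[unfolded adjacent_V]] unfolding adjacent_V minus_diff_eq .
  note sy = this
  have "[V m n, V m' n', V m'' n''] \<in> simplices 2 \<longleftrightarrow>
      adjacent (V m n) (V m' n') \<and> adjacent (V m n) (V m'' n'') \<and> adjacent (V m' n') (V m'' n'')"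
    by (simp add: simplices_def all_less_Suc numeral_2_eq_2 One_nat_def)
      (use sy[of m n m' n'] sy[of m' n' m n] sy[of m n m'' n''] sy[of m'' n'' m n] sy[of m' n' m'' n''] sy[of m'' n'' m' n'] in blast)
  then show ?thesis unfolding adjacent_V .
qed

lemma simplices_2: "xs \<in> simplices 2 \<longleftrightarrow> (\<exists>m n m' n' m'' n''. xs = [V m n, V m' n', V m'' n''] \<and>
    (m' - m, n' - n) \<in> dirs \<and> (m'' - m, n'' - n) \<in> dirs \<and> (m'' - m', n'' - n') \<in> dirs)"
proof
  assume xs: "xs \<in> simplices 2"
  then have "length xs = Suc (Suc (Suc 0))" "set xs \<subseteq> alc_vertices" by (auto simp: simplices_def)
  then obtain x y z where xyz: "xs = [x,y,z]" "x \<in> alc_vertices" "y \<in> alc_vertices" "z \<in> alc_vertices"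
    by (auto simp: length_Suc_conv)
  obtain m n where x: "x = V m n" using vertexE[OF xyz(2)] by blast
  obtain m' n' where y: "y = V m' n'" using vertexE[OF xyz(3)] by blast
  obtain m'' n'' where z: "z = V m'' n''" using vertexE[OF xyz(4)] by blast
  show "\<exists>m n m' n' m'' n''. xs = [V m n, V m' n', V m'' n''] \<and>
    (m' - m, n' - n) \<in> dirs \<and> (m'' - m, n'' - n) \<in> dirs \<and> (m'' - m', n'' - n') \<in> dirs"
    using xs unfolding xyz(1) x y z simplices_2_list by blast
next
  assume "\<exists>m n m' n' m'' n''. xs = [V m n, V m' n', V m'' n''] \<and>
    (m' - m, n' - n) \<in> dirs \<and> (m'' - m, n'' - n) \<in> dirs \<and> (m'' - m', n'' - n') \<in> dirs"
  then obtain m n m' n' m'' n'' where "xs = [V m n, V m' n', V m'' n'']"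
    "(m' - m, n' - n) \<in> dirs" "(m'' - m, n'' - n) \<in> dirs" "(m'' - m', n'' - n') \<in> dirs" by blast
  then show "xs \<in> simplices 2" by (simp only: simplices_2_list simp_thms)
qed

text \<open>The vertices are 3-coloured by this residue, so no four of them are mutually adjacent.\<close>

lemma adjacent_colour: "adjacent x y \<Longrightarrow> cmp x 3 mod 3 \<noteq> cmp y 3 mod 3"
proof
  assume a: "adjacent x y" and m: "cmp x 3 mod 3 = cmp y 3 mod 3"
  have "(cmp y 3 - cmp x 3) mod 3 = 0" using m by (metis mod_diff_cong diff_self mod_0)
  moreover have "cmp y 3 - cmp x 3 \<in> {1, -1, 2, -2}"
    using a unfolding adjacent_def edge_dirs_def mkpt_eq by auto
  ultimately show False by auto
qed

lemma simplices_ge_3: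
  assumes "k \<ge> 3" shows "simplices k = {}"
proof (rule ccontr)
  assume "simplices k \<noteq> {}"
  then obtain xs where xs: "xs \<in> simplices k" by blast
  then have l: "length xs \<ge> 4" and adj: "\<And>i j. i < length xs \<Longrightarrow> j < length xs \<Longrightarrow> i \<noteq> j \<Longrightarrow> adjacent (xs ! i) (xs ! j)"
    using assms by (auto simp: simplices_def)
  define c where "c i = cmp (xs ! i) 3 mod 3" for i
  have ne: "c i \<noteq> c j" if "i < 4" "j < 4" "i \<noteq> j" for i j
    using adjacent_colour[OF adj[of i j]] that l by (simp add: c_def)
  have b: "c i = 0 \<or> c i = 1 \<or> c i = 2" for i
  proof -
    have "0 \<le> c i" "c i < 3" by (simp_all add: c_def)
    then show ?thesis by linarith
  qed
  show False using b[of 0] b[of 1] b[of 2] b[of 3] ne[of 0 1] ne[of 0 2] ne[of 0 3] ne[of 1 2] ne[of 1 3] ne[of 2 3]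
    by auto
qed

lemma cobd_0: "[x,y] \<in> simplices 1 \<Longrightarrow> cobd 0 \<phi> [x,y] = \<phi> [y] - \<phi> [x]"
  by (simp add: cobd_def One_nat_def)

lemma cobd_1: "[x,y,z] \<in> simplices 2 \<Longrightarrow> cobd 1 \<phi> [x,y,z] = \<phi> [y,z] - \<phi> [x,z] + \<phi> [x,y]"
  by (simp add: cobd_def One_nat_def numeral_2_eq_2)

section \<open>The ideal and equivariant functions on the lattice\<close>

context chi_data
begin

abbreviation "I \<equiv> Fideal \<chi>"

text \<open>Translation by (1, -1, 0) moves (m, n) to (m + 1, n - 1) with factor \<open>u\<close>,
  and translation by (-1, 2, -1) moves it to (m, n + 3) with factor \<open>w\<close>. These two
  vectors generate \<open>Lambda\<close>.\<close>

definition u :: rf where "u = f1 / f2"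
definition w :: rf where "w = f2\<^sup>2 / (f1 * f3)"

lemma f_nz [simp]: "f1 \<noteq> 0" "f2 \<noteq> 0" "f3 \<noteq> 0" by (rule Fval_nz)+

lemma inv_R: "inverse f1 \<in> R" "inverse f2 \<in> R" "inverse f3 \<in> R"
  by (rule R_inverse_Fval, simp)+

lemma u_R: "u \<in> R" "inverse u \<in> R"
  unfolding u_def divide_inverse inverse_mult_distrib inverse_inverse_eq by (intro R_mult R_Fval inv_R)+

lemma w_R: "w \<in> R" "inverse w \<in> R"
  unfolding w_def divide_inverse inverse_mult_distrib inverse_inverse_eq power_inverse[symmetric]
  by (intro R_mult R_Fval R_power inv_R)+

lemma uw_nz [simp]: "u \<noteq> 0" "w \<noteq> 0" by (simp_all add: u_def w_def)

lemma u_ne_1: "u \<noteq> 1" using f1_ne_f2 by (simp add: u_def)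

lemma w_ne_1: "w \<noteq> 1" using square_ne by (simp add: w_def)

lemma u_minus_1: "f2 * (u - 1) = f1 - f2" by (simp add: u_def right_diff_distrib)

text \<open>Both sides are f2^2 - f1 f3. As the values F(t_i) are units, \<open>u - 1\<close> and
  \<open>w - 1\<close> generate the same ideal as the differences.\<close>

lemma w_minus_1: "f1 * f3 * (w - 1) = f2 * (f2 - f3) - f3 * (f1 - f2)"
  by (simp add: w_def algebra_simps power2_eq_square)

lemma I_intro: "a \<in> R \<Longrightarrow> b \<in> R \<Longrightarrow> a * (f2 - f1) + b * (f3 - f2) \<in> I"
  unfolding Fideal_def by blast

lemma I_add: assumes "x \<in> I" "y \<in> I" shows "x + y \<in> I"
proof -
  obtain a b where 1: "a \<in> R" "b \<in> R" "x = a * (f2 - f1) + b * (f3 - f2)" using assms(1) unfolding Fideal_def by blast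
  obtain a' b' where 2: "a' \<in> R" "b' \<in> R" "y = a' * (f2 - f1) + b' * (f3 - f2)" using assms(2) unfolding Fideal_def by blast
  have "x + y = (a + a') * (f2 - f1) + (b + b') * (f3 - f2)" unfolding 1 2 by (simp add: algebra_simps)
  then show ?thesis using I_intro[OF R_add[OF 1(1) 2(1)] R_add[OF 1(2) 2(2)]] by simp
qed

lemma I_mult: assumes "r \<in> R" "x \<in> I" shows "r * x \<in> I"
proof -
  obtain a b where 1: "a \<in> R" "b \<in> R" "x = a * (f2 - f1) + b * (f3 - f2)" using assms(2) unfolding Fideal_def by blast
  have "r * x = (r * a) * (f2 - f1) + (r * b) * (f3 - f2)" unfolding 1 by (simp add: algebra_simps)
  then show ?thesis using I_intro[OF R_mult[OF assms(1) 1(1)] R_mult[OF assms(1) 1(2)]] by simp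
qed

lemma I_0: "0 \<in> I" using I_intro[OF R_0 R_0] by simp

lemma I_uminus: "x \<in> I \<Longrightarrow> - x \<in> I"
  using I_mult[OF R_uminus[OF R_1], of x] by simp

lemma I_diff: "x \<in> I \<Longrightarrow> y \<in> I \<Longrightarrow> x - y \<in> I"
  using I_add[of x "- y"] I_uminus by simp

lemma I_gens: "f2 - f1 \<in> I" "f3 - f2 \<in> I"
  using I_intro[OF R_1 R_0] I_intro[OF R_0 R_1] by simp_all

lemma I_Fval_diff: assumes "i \<in> {1,2,3}" "j \<in> {1,2,3}" shows "Fval \<chi> i - Fval \<chi> j \<in> I"
proof -
  have "f3 - f1 \<in> I" using I_add[OF I_gens] by simp
  moreover have "f1 - f2 \<in> I" "f2 - f3 \<in> I" "f1 - f3 \<in> I"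
    using I_uminus[OF I_gens(1)] I_uminus[OF I_gens(2)] I_uminus[OF \<open>f3 - f1 \<in> I\<close>] by simp_all
  ultimately show ?thesis using assms I_gens I_0 by auto
qed

lemma u_1_I: "u - 1 \<in> I"
proof -
  have "u - 1 = inverse f2 * (f1 - f2)" unfolding u_minus_1[symmetric] by (simp add: mult.assoc[symmetric])
  then show ?thesis using I_mult[OF inv_R(2) I_Fval_diff[of 1 2]] by simp
qed

lemma w_1_I: "w - 1 \<in> I"
proof -
  have gen: "i * j * (a * b * c) = (i * a) * (j * b) * c" for a b c i j :: rf by (simp only: mult_ac)
  have "w - 1 = inverse f1 * inverse f3 * (f1 * f3 * (w - 1))" unfolding gen by simp
  also have "\<dots> \<in> I" unfolding w_minus_1
    by (rule I_mult[OF R_mult[OF inv_R(1,3)] I_diff[OF I_mult[OF R_Fval I_Fval_diff] I_mult[OF R_Fval I_Fval_diff]]])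
      simp_all
  finally show ?thesis .
qed

lemma I_elim:
  assumes "x \<in> I" obtains \<alpha> \<beta> where "\<alpha> \<in> R" "\<beta> \<in> R" "x = (w - 1) * \<alpha> + (u - 1) * \<beta>"
proof -
  obtain a b where 1: "a \<in> R" "b \<in> R" "x = a * (f2 - f1) + b * (f3 - f2)" using assms unfolding Fideal_def by blast
  have e: "f3 - f2 = inverse f2 * (- (f1 * f3 * (w - 1)) - f3 * (f2 * (u - 1)))"
    unfolding w_minus_1 u_minus_1 by (simp add: mult.assoc[symmetric])
  have gen: "a * (- (F2 * U)) + b * (i * (- (F1 * F3 * W) - F3 * (F2 * U)))
      = W * (- (b * i * F1 * F3)) + U * (- (a * F2) - b * (i * F2 * F3))" for a b i F1 F2 F3 U W :: rf
    by (simp add: algebra_simps)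
  have e': "f2 - f1 = - (f2 * (u - 1))" unfolding u_minus_1 by simp
  have "x = (w - 1) * (- (b * inverse f2 * f1 * f3)) + (u - 1) * (- (a * f2) - b * (inverse f2 * f2 * f3))"
    unfolding 1(3) e e' by (rule gen)
  moreover have "- (b * inverse f2 * f1 * f3) \<in> R" "- (a * f2) - b * (inverse f2 * f2 * f3) \<in> R"
    by (intro R_uminus R_diff R_mult 1 inv_R R_Fval)+
  ultimately show ?thesis using that by blast
qed

text \<open>The vertex (m, n) is reached from (0, j) with j = (m + n) mod 3 by m steps (1, -1) and
  (m + n) div 3 steps (0, 3), each step contributing its factor \<open>u\<close> or
  \<open>w\<close>.\<close>

definition ext :: "(int \<Rightarrow> rf) \<Rightarrow> int \<Rightarrow> int \<Rightarrow> rf" where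
  "ext b m n = u powi m * w powi ((m + n) div 3) * b ((m + n) mod 3)"

definition mul :: "int \<Rightarrow> int \<Rightarrow> int \<Rightarrow> rf" where
  "mul a b c = f1 powi a * f2 powi b * f3 powi c"

lemma mul_mult: "mul a b c * mul a' b' c' = mul (a + a') (b + b') (c + c')"
  by (simp add: mul_def power_int_add mult_ac)

lemma uw_mul: "u powi m * w powi q = mul (m - q) (2 * q - m) (- q)"
proof -
  have "u powi m = mul m (- m) 0"
    by (simp add: u_def mul_def divide_inverse power_int_mult_distrib power_int_inverse power_int_minus)
  moreover have "w powi q = mul (- q) (2 * q) (- q)"
  proof -
    have "(f2\<^sup>2) powi q = f2 powi (2 * q)"
      using power_int_mult[of f2 2 q] by simp
    then show ?thesis
      by (simp add: w_def mul_def divide_inverse power_int_mult_distrib power_int_inverse power_int_minus mult_ac)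
  qed
  ultimately show ?thesis by (simp add: mul_mult)
qed

definition eqv :: "(int \<Rightarrow> int \<Rightarrow> rf) \<Rightarrow> bool" where
  "eqv G \<longleftrightarrow> (\<forall>m n. G m n \<in> R) \<and> (\<forall>m n a b c. a + b + c = 0 \<longrightarrow> G (m + a - c) (n + b - c) = mul a b c * G m n)"

lemma eqv_R: "eqv G \<Longrightarrow> G m n \<in> R" by (simp add: eqv_def)

lemma eqv_shift: "eqv G \<Longrightarrow> a + b + c = 0 \<Longrightarrow> G (m + a - c) (n + b - c) = mul a b c * G m n"
  by (simp add: eqv_def)

lemma eqv_ext:
  assumes "\<And>j. b j \<in> R" shows "eqv (ext b)"
  unfolding eqv_def
proof (intro conjI allI impI)
  show "ext b m n \<in> R" for m n
    unfolding ext_def by (rule R_mult[OF R_mult[OF R_powi[OF u_R] R_powi[OF w_R]] assms])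
  fix m n a b' c :: int assume s: "a + b' + c = 0"
  have e: "m + a - c + (n + b' - c) = m + n + 3 * (- c)" using s by linarith
  define q where "q = (m + n) div 3"
  have d: "(m + n + 3 * (- c)) div 3 = q - c" "(m + n + 3 * (- c)) mod 3 = (m + n) mod 3"
    using div_mult_self2[of 3 "m + n" "- c"] mod_mult_self2[of "m + n" 3 "- c"] by (simp_all only: q_def)
  have "ext b (m + a - c) (n + b' - c) = mul (m + a - c - (q - c)) (2 * (q - c) - (m + a - c)) (- (q - c)) * b ((m + n) mod 3)"
    unfolding ext_def e uw_mul d ..
  also have "m + a - c - (q - c) = a + (m - q)" by simp
  also have "2 * (q - c) - (m + a - c) = b' + (2 * q - m)"
  proof -
    have "b' = - a - c" using s by linarith
    then show ?thesis by (simp only:) (simp add: algebra_simps)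
  qed
  also have "- (q - c) = c + - q" by simp
  finally show "ext b (m + a - c) (n + b' - c) = mul a b' c * ext b m n"
    unfolding ext_def uw_mul q_def[symmetric] by (simp only: mul_mult[symmetric] mult.assoc)
qed

lemma eqv_eq_ext: assumes G: "eqv G" shows "G m n = ext (\<lambda>j. G 0 j) m n"
proof -
  define q where "q = (m + n) div 3"
  define j where "j = (m + n) mod 3"
  have mn: "m + n = 3 * q + j" by (simp add: q_def j_def)
  have "G (0 + (m - q) - (- q)) (j + (2 * q - m) - (- q)) = mul (m - q) (2 * q - m) (- q) * G 0 j"
    by (rule eqv_shift[OF G]) simp
  moreover have "0 + (m - q) - (- q) = m" "j + (2 * q - m) - (- q) = n" using mn by linarith+
  ultimately show ?thesis unfolding ext_def q_def[symmetric] j_def[symmetric] uw_mul by simp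
qed

lemma mod3_cases: "(k::int) mod 3 = 0 \<or> k mod 3 = 1 \<or> k mod 3 = 2"
proof -
  have "0 \<le> k mod 3" "k mod 3 < 3" by simp_all
  then show ?thesis by linarith
qed

text \<open>The orbits of \<open>Lambda\<close> on vertices are the residue classes of m + n modulo
  3, represented by (0, 0), (0, 1) and (0, 2).\<close>

lemma eqv_unique:
  assumes "eqv G" "eqv G'" "G 0 0 = G' 0 0" "G 0 1 = G' 0 1" "G 0 2 = G' 0 2"
  shows "G m n = G' m n"
proof -
  have "G 0 ((m + n) mod 3) = G' 0 ((m + n) mod 3)" using mod3_cases[of "m + n"] assms(3-5) by auto
  then show ?thesis unfolding eqv_eq_ext[OF assms(1), of m n] eqv_eq_ext[OF assms(2), of m n] ext_def by simp
qed

lemma eqv_add: "eqv G \<Longrightarrow> eqv G' \<Longrightarrow> eqv (\<lambda>m n. G m n + G' m n)"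
  by (simp add: eqv_def R_add distrib_left)

lemma eqv_diff: "eqv G \<Longrightarrow> eqv G' \<Longrightarrow> eqv (\<lambda>m n. G m n - G' m n)"
  by (simp add: eqv_def R_diff right_diff_distrib)

lemma eqv_translate: assumes "eqv G" shows "eqv (\<lambda>m n. G (m + a) (n + b))"
  unfolding eqv_def
proof (intro conjI allI impI)
  show "G (m + a) (n + b) \<in> R" for m n by (rule eqv_R[OF assms])
  fix m n a' b' c' :: int assume "a' + b' + c' = 0"
  from eqv_shift[OF assms this, of "m + a" "n + b"]
  show "G (m + a' - c' + a) (n + b' - c' + b) = mul a' b' c' * G (m + a) (n + b)" by (simp add: algebra_simps)
qed

lemma eqv_1: "eqv G \<Longrightarrow> G 1 n = u * G 0 (n + 1)" and eqv_3: "eqv G \<Longrightarrow> G m (n + 3) = w * G m n"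
proof -
  assume G: "eqv G"
  have "u = mul 1 (- 1) 0" using uw_mul[of 1 0] by simp
  then show "G 1 n = u * G 0 (n + 1)" using eqv_shift[OF G, of 1 "- 1" 0 0 "n + 1"] by simp
  have "w = mul (- 1) 2 (- 1)" using uw_mul[of 0 1] by simp
  moreover have "G (m + - 1 - - 1) (n + 2 - - 1) = mul (- 1) 2 (- 1) * G m n"
    by (rule eqv_shift[OF G]) simp
  moreover have "m + - 1 - - 1 = m" "n + 2 - - 1 = n + 3" by simp_all
  ultimately show "G m (n + 3) = w * G m n" by (simp only:)
qed

lemma powi_1_I: assumes "x \<in> R" "inverse x \<in> R" "x \<noteq> 0" "x - 1 \<in> I" shows "x powi k - 1 \<in> I"
proof -
  have nat: "y ^ n - 1 \<in> I" if "y \<in> R" "y - 1 \<in> I" for y n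
  proof (induction n)
    case (Suc n)
    have e: "y ^ Suc n - 1 = y * (y ^ n - 1) + (y - 1)" by (simp add: right_diff_distrib)
    show ?case unfolding e by (rule I_add[OF I_mult[OF that(1) Suc] that(2)])
  qed (simp add: I_0)
  have "inverse x - 1 = - (inverse x * (x - 1))" using assms(3) by (simp add: right_diff_distrib)
  then have "inverse x - 1 \<in> I" using I_uminus[OF I_mult[OF assms(2,4)]] by simp
  then have "inverse x ^ n - 1 \<in> I" for n by (rule nat[OF assms(2)])
  then show ?thesis using nat[OF assms(1,4)] unfolding power_int_def by (cases "0 \<le> k") simp_all
qed

text \<open>Both \<open>u\<close> and \<open>w\<close> are congruent to 1 modulo the ideal, so the
  factors in \<open>ext\<close> disappear there.\<close>

lemma eqv_mod_I: assumes G: "eqv G" shows "G m n - G 0 ((m + n) mod 3) \<in> I"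
proof -
  define p where "p = u powi m" define q where "q = w powi ((m + n) div 3)"
  have R: "p \<in> R" unfolding p_def by (rule R_powi[OF u_R])
  have i: "p - 1 \<in> I" "q - 1 \<in> I"
    unfolding p_def q_def by (rule powi_1_I[OF u_R uw_nz(1) u_1_I] powi_1_I[OF w_R uw_nz(2) w_1_I])+
  have e: "p * q - 1 = p * (q - 1) + (p - 1)" by (simp add: right_diff_distrib)
  have "p * q - 1 \<in> I" unfolding e by (rule I_add[OF I_mult[OF R i(2)] i(1)])
  then have "G 0 ((m + n) mod 3) * (p * q - 1) \<in> I" by (rule I_mult[OF eqv_R[OF G]])
  moreover have "G m n - G 0 ((m + n) mod 3) = G 0 ((m + n) mod 3) * (p * q - 1)"
    unfolding eqv_eq_ext[OF G, of m n] ext_def p_def[symmetric] q_def[symmetric] by (simp add: right_diff_distrib left_diff_distrib mult.commute)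
  ultimately show ?thesis by simp
qed

text \<open>The three base vertices represent the three orbits, so modulo the ideal the sum does not
  depend on the representatives. Cyclic orders suffice for the Weyl group computation.\<close>

lemma eqv_sum_mod_I:
  assumes G: "eqv G" and c: "((a0 + b0) mod 3, (a1 + b1) mod 3, (a2 + b2) mod 3) \<in> {(0,1,2),(1,2,0),(2,0,1)}"
  shows "(G a0 b0 + G a1 b1 + G a2 b2) - (G 0 0 + G 0 1 + G 0 2) \<in> I"
proof -
  have "(G a0 b0 - G 0 ((a0 + b0) mod 3)) + (G a1 b1 - G 0 ((a1 + b1) mod 3)) + (G a2 b2 - G 0 ((a2 + b2) mod 3)) \<in> I"
    by (intro I_add eqv_mod_I[OF G])
  moreover have "G 0 x + G 0 y + G 0 z = G 0 0 + G 0 1 + G 0 2" if "(x, y, z) \<in> {(0,1,2),(1,2,0),(2,0,1)}" for x y z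
    using that by (auto simp only: insert_iff prod.inject empty_iff ac_simps)
  note this[OF c]
  moreover have "(a - a') + (b - b') + (c - c') = (a + b + c) - (a' + b' + c')" for a b c a' b' c' :: rf by simp
  ultimately show ?thesis by (simp only:)
qed

end

section \<open>Alternating functions on edges and triangles\<close>

lemma permute_list_3: "permute_list \<pi> [x,y,z] = [[x,y,z] ! \<pi> 0, [x,y,z] ! \<pi> 1, [x,y,z] ! \<pi> 2]"
  by (simp add: permute_list_def upt_rec One_nat_def numeral_2_eq_2)

lemma permute_list_2: "permute_list \<pi> [x,y] = [[x,y] ! \<pi> 0, [x,y] ! \<pi> 1]"
  by (simp add: permute_list_def upt_rec One_nat_def)

lemma nth_3: "[x,y,z] ! 0 = x" "[x,y,z] ! 1 = y" "[x,y,z] ! 2 = z"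
  by (simp_all add: One_nat_def numeral_2_eq_2)

lemma nth_2: "[x,y] ! 0 = x" "[x,y] ! 1 = y"
  by (simp_all add: One_nat_def)

lemma permutes_Suc_1: 
  assumes "\<pi> permutes {..<Suc 1}" shows "\<pi> = id \<or> \<pi> = transpose 0 1"
proof -
  have \<pi>: "\<pi> permutes {0,1}" using assms by (simp add: lessThan_Suc insert_commute One_nat_def)
  have "\<pi> 0 \<in> {0,1}" "\<pi> 1 \<in> {0,1}" using permutes_in_image[OF \<pi>] by blast+
  moreover have "\<pi> 0 \<noteq> \<pi> 1" by (simp add: inj_eq[OF permutes_inj[OF \<pi>]])
  ultimately consider "\<pi> 0 = 0" "\<pi> 1 = 1" | "\<pi> 0 = 1" "\<pi> 1 = 0" by fastforce
  then show ?thesis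
  proof cases
    case 1
    have "\<pi> x = id x" for x using 1 permutes_not_in[OF \<pi>, of x] by (cases "x \<in> {0,1}") auto
    then show ?thesis by blast
  next
    case 2
    have "\<pi> x = transpose 0 1 x" for x using 2 permutes_not_in[OF \<pi>, of x] by (cases "x \<in> {0,1}") (auto simp: transpose_def)
    then show ?thesis by blast
  qed
qed

lemma simplices_1_swap: "[x,y] \<in> simplices 1 \<Longrightarrow> [y,x] \<in> simplices 1"
  unfolding simplices_1 using adjacent_sym by fastforce

lemma simplices_2_swap:
  assumes "[x,y,z] \<in> simplices 2" shows "[y,x,z] \<in> simplices 2" "[x,z,y] \<in> simplices 2"
proof -
  obtain m n m' n' m'' n'' where e: "x = V m n" "y = V m' n'" "z = V m'' n''"
    and d: "(m' - m, n' - n) \<in> dirs" "(m'' - m, n'' - n) \<in> dirs" "(m'' - m', n'' - n') \<in> dirs"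
    using assms unfolding simplices_2 by auto
  show "[y,x,z] \<in> simplices 2" "[x,z,y] \<in> simplices 2"
    unfolding e simplices_2_list using d adjacent_sym[OF d(1)] adjacent_sym[OF d(3)] by simp_all
qed

lemma simplices_2_face:
  assumes "[x,y,z] \<in> simplices 2"
  shows "[y,z] \<in> simplices 1" "[x,z] \<in> simplices 1" "[x,y] \<in> simplices 1"
proof -
  obtain m n m' n' m'' n'' where e: "x = V m n" "y = V m' n'" "z = V m'' n''"
    and d: "(m' - m, n' - n) \<in> dirs" "(m'' - m, n'' - n) \<in> dirs" "(m'' - m', n'' - n') \<in> dirs"
    using assms unfolding simplices_2 by auto
  show "[y,z] \<in> simplices 1" "[x,z] \<in> simplices 1" "[x,y] \<in> simplices 1"
    unfolding e simplices_1_list by (rule d)+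
qed

text \<open>The alternating condition for the two adjacent transpositions; they generate the
  symmetric group on three letters.\<close>

definition swap3 :: "(pt list \<Rightarrow> rf) \<Rightarrow> bool" where
  "swap3 A \<longleftrightarrow> (\<forall>x y z. [x,y,z] \<in> simplices 2 \<longrightarrow> A [y,x,z] = - A [x,y,z] \<and> A [x,z,y] = - A [x,y,z])"

lemma swap3_D:
  assumes "swap3 A" "[x,y,z] \<in> simplices 2" shows "A [y,x,z] = - A [x,y,z]" "A [x,z,y] = - A [x,y,z]"
  using assms unfolding swap3_def by blast+

lemma swap3_rot:
  assumes "swap3 A" "[x,y,z] \<in> simplices 2" shows "A [y,z,x] = A [x,y,z]" "A [z,x,y] = A [x,y,z]"
proof -
  note s = simplices_2_swap[OF assms(2)]
  have "A [y,z,x] = - A [y,x,z]" by (rule swap3_D(2)[OF assms(1) s(1)])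
  then show "A [y,z,x] = A [x,y,z]" by (simp add: swap3_D(1)[OF assms])
  have "A [z,x,y] = - A [x,z,y]" by (rule swap3_D(1)[OF assms(1) s(2)])
  then show "A [z,x,y] = A [x,y,z]" by (simp add: swap3_D(2)[OF assms])
qed

lemma swap3_alternating:
  assumes A: "swap3 A" and xs: "xs \<in> simplices 2" and \<pi>: "\<pi> permutes {..<Suc 2}"
  shows "A (permute_list \<pi> xs) = of_int (sign \<pi>) * A xs"
proof -
  have "{..<Suc 2} = {0,1,2::nat}" by auto
  then have \<pi>': "\<pi> permutes {0,1,2}" using \<pi> by (simp only:)
  obtain x y z where e: "xs = [x,y,z]" using xs unfolding simplices_2 by blast
  note xyz = xs[unfolded e]
  note s = simplices_2_swap[OF xyz]
  have 1: "A [z,y,x] = - A [x,y,z]"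
    using swap3_D(2)[OF A simplices_2_swap(1)[OF s(2)]] swap3_rot(2)[OF A xyz] by simp
  have val: "A (permute_list \<pi> xs) = c * A [x,y,z]"
    if "A [[x,y,z] ! i, [x,y,z] ! j, [x,y,z] ! k] = c * A [x,y,z]" "\<pi> 0 = i" "\<pi> 1 = j" "\<pi> 2 = k" for i j k c
    unfolding e permute_list_3 that(2-4) by (rule that(1))
  consider "\<pi> = id" | "\<pi> = transpose 0 1" | "\<pi> = transpose 0 2" | "\<pi> = transpose 1 2" |
    "\<pi> = transpose 0 1 \<circ> transpose 1 2" | "\<pi> = transpose 1 2 \<circ> transpose 0 1"
    using permutes_3_cases[OF \<pi>'] by auto
  then show ?thesis
  proof cases
    case 1 then show ?thesis by (simp add: sign_id)
  next
    case 2
    have "sign \<pi> = - 1" unfolding 2 by (rule sign_transpose) simp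
    moreover have "A (permute_list \<pi> xs) = - 1 * A [x,y,z]"
      by (rule val[of 1 0 2]) (simp_all add: 2 transpose_def nth_3 swap3_D[OF A xyz])
    ultimately show ?thesis by (simp add: e)
  next
    case 3
    have "sign \<pi> = - 1" unfolding 3 by (rule sign_transpose) simp
    moreover have "A (permute_list \<pi> xs) = - 1 * A [x,y,z]"
      by (rule val[of 2 1 0]) (simp_all add: 3 transpose_def nth_3 1)
    ultimately show ?thesis by (simp add: e)
  next
    case 4
    have "sign \<pi> = - 1" unfolding 4 by (rule sign_transpose) simp
    moreover have "A (permute_list \<pi> xs) = - 1 * A [x,y,z]"
      by (rule val[of 0 2 1]) (simp_all add: 4 transpose_def nth_3 swap3_D[OF A xyz])
    ultimately show ?thesis by (simp add: e)
  next
    case 5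
    have "sign \<pi> = 1" unfolding 5 by (rule sign_transpose_comp) simp_all
    moreover have "A (permute_list \<pi> xs) = 1 * A [x,y,z]"
      by (rule val[of 1 2 0]) (simp_all add: 5 transpose_def nth_3 swap3_rot[OF A xyz])
    ultimately show ?thesis by (simp add: e)
  next
    case 6
    have "sign \<pi> = 1" unfolding 6 by (rule sign_transpose_comp) simp_all
    moreover have "A (permute_list \<pi> xs) = 1 * A [x,y,z]"
      by (rule val[of 2 0 1]) (simp_all add: 6 transpose_def nth_3 swap3_rot[OF A xyz])
    ultimately show ?thesis by (simp add: e)
  qed
qed

text \<open>The sum m + n is distinct at the three vertices of a triangle. Sorting by it through
  adjacent swaps leads to an upward or a downward triangle in standard order.\<close>

lemma swap3_agree:
  assumes A: "swap3 A" and B: "swap3 B"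
    and up: "\<And>m n. A [V m n, V (m + 1) n, V (m + 1) (n + 1)] = B [V m n, V (m + 1) n, V (m + 1) (n + 1)]"
    and dn: "\<And>m n. A [V m n, V m (n + 1), V (m + 1) (n + 1)] = B [V m n, V m (n + 1), V (m + 1) (n + 1)]"
    and xs: "xs \<in> simplices 2"
  shows "A xs = B xs"
proof -
  define \<sigma> where "\<sigma> x = cm x + cn x" for x
  have sorted: "A [x,y,z] = B [x,y,z]" if s: "[x,y,z] \<in> simplices 2" and o: "\<sigma> x < \<sigma> y" "\<sigma> y < \<sigma> z" for x y z
  proof -
    obtain m n m' n' m'' n'' where e: "x = V m n" "y = V m' n'" "z = V m'' n''"
      and d: "(m' - m, n' - n) \<in> dirs" "(m'' - m, n'' - n) \<in> dirs" "(m'' - m', n'' - n') \<in> dirs"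
      using s unfolding simplices_2 by auto
    have o': "m + n < m' + n'" "m' + n' < m'' + n''" using o by (simp_all add: \<sigma>_def e)
    have d2: "m'' - m \<le> 1" "n'' - n \<le> 1" using d(2) by (auto simp: dirs_def)
    have "(m' = m + 1 \<and> n' = n \<and> m'' = m + 1 \<and> n'' = n + 1) \<or> (m' = m \<and> n' = n + 1 \<and> m'' = m + 1 \<and> n'' = n + 1)"
      using d(1) o' d2 unfolding dirs_def insert_iff prod.inject empty_iff by (elim disjE conjE FalseE; presburger)
    then show ?thesis unfolding e by (elim disjE conjE) (simp_all only: up dn)
  qed
  have sw: "A [y,x,z] = B [y,x,z]" "A [x,z,y] = B [x,z,y]"
    if "[x,y,z] \<in> simplices 2" "A [x,y,z] = B [x,y,z]" for x y z
    using swap3_D[OF A that(1)] swap3_D[OF B that(1)] that(2) by simp_all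
  obtain x y z where e: "xs = [x,y,z]" using xs unfolding simplices_2 by blast
  note xyz = xs[unfolded e]
  have ne: "\<sigma> x \<noteq> \<sigma> y" "\<sigma> x \<noteq> \<sigma> z" "\<sigma> y \<noteq> \<sigma> z"
  proof -
    obtain m n m' n' m'' n'' where e: "x = V m n" "y = V m' n'" "z = V m'' n''"
      and d: "(m' - m, n' - n) \<in> dirs" "(m'' - m, n'' - n) \<in> dirs" "(m'' - m', n'' - n') \<in> dirs"
      using xyz unfolding simplices_2 by auto
    have "a + b \<noteq> 0" if "(a, b) \<in> dirs" for a b using that by (auto simp: dirs_def)
    from this[OF d(1)] this[OF d(2)] this[OF d(3)]
    show "\<sigma> x \<noteq> \<sigma> y" "\<sigma> x \<noteq> \<sigma> z" "\<sigma> y \<noteq> \<sigma> z"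
      unfolding e \<sigma>_def cm_V cn_V by presburger+
  qed
  note s = simplices_2_swap[OF xyz]
  note yzx = simplices_2_swap(2)[OF s(1)]
  note zxy = simplices_2_swap(1)[OF s(2)]
  note zyx = simplices_2_swap(2)[OF zxy]
  consider "\<sigma> x < \<sigma> y" "\<sigma> y < \<sigma> z" | "\<sigma> y < \<sigma> x" "\<sigma> x < \<sigma> z" | "\<sigma> x < \<sigma> z" "\<sigma> z < \<sigma> y"
    | "\<sigma> y < \<sigma> z" "\<sigma> z < \<sigma> x" | "\<sigma> z < \<sigma> x" "\<sigma> x < \<sigma> y" | "\<sigma> z < \<sigma> y" "\<sigma> y < \<sigma> x"
    using ne by linarith
  then show ?thesis unfolding e
  proof cases
    case 1 then show "A [x,y,z] = B [x,y,z]" by (rule sorted[OF xyz])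
  next
    case 2 then show "A [x,y,z] = B [x,y,z]" by (intro sw(1)[OF s(1)] sorted[OF s(1)])
  next
    case 3 then show "A [x,y,z] = B [x,y,z]" by (intro sw(2)[OF s(2)] sorted[OF s(2)])
  next
    case 4 then show "A [x,y,z] = B [x,y,z]" by (intro sw(1)[OF s(1)] sw(2)[OF yzx] sorted[OF yzx])
  next
    case 5 then show "A [x,y,z] = B [x,y,z]" by (intro sw(2)[OF s(2)] sw(1)[OF zxy] sorted[OF zxy])
  next
    case 6 then show "A [x,y,z] = B [x,y,z]"
      by (intro sw(1)[OF s(1)] sw(2)[OF yzx] sw(1)[OF zyx] sorted[OF zyx])
  qed
qed

lemma up_simplex: "[V m n, V (m + 1) n, V (m + 1) (n + 1)] \<in> simplices 2"
  and dn_simplex: "[V m n, V m (n + 1), V (m + 1) (n + 1)] \<in> simplices 2"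
  unfolding simplices_2_list by (simp_all add: dirs_def)

lemma edge_simplex: "[V m n, V (m + 1) n] \<in> simplices 1" "[V m n, V m (n + 1)] \<in> simplices 1"
  "[V m n, V (m + 1) (n + 1)] \<in> simplices 1"
  unfolding simplices_1_list by (simp_all add: dirs_def)

text \<open>\<open>H\<close>, \<open>K\<close> and \<open>D\<close> give the values on edges in the
  directions (1, 0), (0, 1) and (1, 1), indexed by the initial vertex; a reversed edge is looked up
  at its endpoint with the opposite sign.\<close>

definition edge :: "(int \<Rightarrow> int \<Rightarrow> rf) \<Rightarrow> (int \<Rightarrow> int \<Rightarrow> rf) \<Rightarrow> (int \<Rightarrow> int \<Rightarrow> rf) \<Rightarrow> int \<Rightarrow> int \<Rightarrow> int \<Rightarrow> int \<Rightarrow> rf" where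
  "edge H K D m n m' n' = (if m' - m = 1 \<and> n' - n = 0 then H m n else if m' - m = 0 \<and> n' - n = 1 then K m n
     else if m' - m = 1 \<and> n' - n = 1 then D m n else if m' - m = -1 \<and> n' - n = 0 then - H m' n'
     else if m' - m = 0 \<and> n' - n = -1 then - K m' n' else - D m' n')"

lemma edge_swap: "(m' - m, n' - n) \<in> dirs \<Longrightarrow> edge H K D m' n' m n = - edge H K D m n m' n'"
  unfolding dirs_def by (elim insertE emptyE) (simp_all add: edge_def)

definition mk0 :: "(int \<Rightarrow> int \<Rightarrow> rf) \<Rightarrow> pt list \<Rightarrow> rf" where
  "mk0 g xs = (if xs \<in> simplices 0 then g (cm (hd xs)) (cn (hd xs)) else 0)"

definition mk1 :: "(int \<Rightarrow> int \<Rightarrow> rf) \<Rightarrow> (int \<Rightarrow> int \<Rightarrow> rf) \<Rightarrow> (int \<Rightarrow> int \<Rightarrow> rf) \<Rightarrow> pt list \<Rightarrow> rf" where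
  "mk1 H K D xs = (if xs \<in> simplices 1
     then edge H K D (cm (xs ! 0)) (cn (xs ! 0)) (cm (xs ! 1)) (cn (xs ! 1)) else 0)"

text \<open>The determinant is the orientation of a triangle, and the coordinate sums of an upward triangle
  with lower left vertex \<open>(m, n)\<close> are \<open>3 * m + 2\<close> and \<open>3 * n + 1\<close>.\<close>

definition tri :: "(int \<Rightarrow> int \<Rightarrow> rf) \<Rightarrow> int \<Rightarrow> int \<Rightarrow> int \<Rightarrow> int \<Rightarrow> int \<Rightarrow> int \<Rightarrow> rf" where
  "tri U m n m' n' m'' n'' = of_int ((m' - m) * (n'' - n) - (m'' - m) * (n' - n)) *
     (if (m + m' + m'') mod 3 = 2 then U ((m + m' + m'' - 2) div 3) ((n + n' + n'' - 1) div 3) else 0)"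

definition mk2 :: "(int \<Rightarrow> int \<Rightarrow> rf) \<Rightarrow> pt list \<Rightarrow> rf" where
  "mk2 U xs = (if xs \<in> simplices 2
     then tri U (cm (xs ! 0)) (cn (xs ! 0)) (cm (xs ! 1)) (cn (xs ! 1)) (cm (xs ! 2)) (cn (xs ! 2)) else 0)"

lemma tri_swap: "tri U m' n' m n m'' n'' = - tri U m n m' n' m'' n''" "tri U m n m'' n'' m' n' = - tri U m n m' n' m'' n''"
proof -
  have c: "m' + m + m'' = m + m' + m''" "n' + n + n'' = n + n' + n''" "m + m'' + m' = m + m' + m''" "n + n'' + n' = n + n' + n''"
    by simp_all
  have d: "(m - m') * (n'' - n') - (m'' - m') * (n - n') = - ((m' - m) * (n'' - n) - (m'' - m) * (n' - n))"
    "(m'' - m) * (n' - n) - (m' - m) * (n'' - n) = - ((m' - m) * (n'' - n) - (m'' - m) * (n' - n))"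
    by (simp_all add: algebra_simps)
  show "tri U m' n' m n m'' n'' = - tri U m n m' n' m'' n''" "tri U m n m'' n'' m' n' = - tri U m n m' n' m'' n''"
    unfolding tri_def c d of_int_minus mult_minus_left by (rule refl)+
qed

lemma swap3_mk2: "swap3 (mk2 U)"
  unfolding swap3_def
proof (intro allI impI)
  fix x y z assume xyz: "[x,y,z] \<in> simplices 2"
  show "mk2 U [y,x,z] = - mk2 U [x,y,z] \<and> mk2 U [x,z,y] = - mk2 U [x,y,z]"
    unfolding mk2_def nth_3 using xyz simplices_2_swap[OF xyz]
    by (simp add: tri_swap(1)[of U "cm y" "cn y"] tri_swap(2)[of U "cm x" "cn x" "cm z" "cn z"])
qed

section \<open>Cochains as equivariant functions\<close>

context chi_data
begin

lemma coch_D: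
  assumes "\<phi> \<in> cochains \<chi> k"
  shows "xs \<notin> simplices k \<Longrightarrow> \<phi> xs = 0"
    and "xs \<in> simplices k \<Longrightarrow> \<pi> permutes {..<Suc k} \<Longrightarrow> \<phi> (permute_list \<pi> xs) = of_int (sign \<pi>) * \<phi> xs"
    and "xs \<in> simplices k \<Longrightarrow> l \<in> Lambda \<Longrightarrow> \<phi> (map (transl l) xs) = Fmon \<chi> l * \<phi> xs"
  using assms unfolding cochains_def by blast+

lemma coch_R: assumes "\<phi> \<in> cochains \<chi> k" shows "\<phi> xs \<in> R"
  using assms coch_D(1)[OF assms, of xs] R_0 unfolding cochains_def by (cases "xs \<in> simplices k") auto

lemma coch_swap2:
  assumes "\<phi> \<in> cochains \<chi> 1" "[x,y] \<in> simplices 1" shows "\<phi> [y,x] = - \<phi> [x,y]"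
proof -
  have p: "transpose 0 1 permutes {..<Suc 1}" by (rule permutes_swap_id) auto
  have "\<phi> (permute_list (transpose 0 1) [x,y]) = - \<phi> [x,y]"
    using coch_D(2)[OF assms p] sign_transpose[of "0::nat" 1] by simp
  moreover have "permute_list (transpose 0 1) [x,y] = [y,x]"
    by (simp add: permute_list_2 transpose_def nth_2)
  ultimately show ?thesis by (simp only:)
qed

lemma coch_swap3: assumes "\<phi> \<in> cochains \<chi> 2" shows "swap3 \<phi>"
  unfolding swap3_def
proof (intro allI impI conjI)
  fix x y z assume s: "[x,y,z] \<in> simplices 2"
  have p: "transpose 0 1 permutes {..<Suc 2}" "transpose 1 2 permutes {..<Suc 2}" by (rule permutes_swap_id; auto)+
  have "\<phi> (permute_list (transpose 0 1) [x,y,z]) = - \<phi> [x,y,z]"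
    using coch_D(2)[OF assms s p(1)] sign_transpose[of "0::nat" 1] by simp
  moreover have "permute_list (transpose 0 1) [x,y,z] = [y,x,z]"
    by (simp add: permute_list_3 transpose_def nth_3)
  ultimately show "\<phi> [y,x,z] = - \<phi> [x,y,z]" by (simp only:)
  have "\<phi> (permute_list (transpose 1 2) [x,y,z]) = - \<phi> [x,y,z]"
    using coch_D(2)[OF assms s p(2)] sign_transpose[of "1::nat" 2] by simp
  moreover have "permute_list (transpose 1 2) [x,y,z] = [x,z,y]"
    by (simp add: permute_list_3 transpose_def nth_3)
  ultimately show "\<phi> [x,z,y] = - \<phi> [x,y,z]" by (simp only:)
qed

text \<open>The list \<open>cs\<close> is a shape of simplex, given by offsets from a moving base
  vertex; translation by \<open>Lambda\<close> moves only the base.\<close>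

lemma coch_eqv:
  assumes \<phi>: "\<phi> \<in> cochains \<chi> k" and s: "\<And>m n. map (\<lambda>(a,b). V (m + a) (n + b)) cs \<in> simplices k"
  shows "eqv (\<lambda>m n. \<phi> (map (\<lambda>(a,b). V (m + a) (n + b)) cs))"
  unfolding eqv_def
proof (intro conjI allI impI)
  show "\<phi> (map (\<lambda>(a,b). V (m + a) (n + b)) cs) \<in> R" for m n by (rule coch_R[OF \<phi>])
  fix m n a b c :: int assume "a + b + c = 0"
  then have l: "(a,b,c) \<in> Lambda" by (simp add: Lambda_def)
  have "map (transl (a,b,c)) (map (\<lambda>(a,b). V (m + a) (n + b)) cs) = map (\<lambda>(a',b'). V (m + a - c + a') (n + b - c + b')) cs"
    by (auto simp: transl_V[OF l] algebra_simps)
  moreover have "Fmon \<chi> (a,b,c) = mul a b c" by (simp add: Fmon_def mul_def)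
  ultimately show "\<phi> (map (\<lambda>(a',b'). V (m + a - c + a') (n + b - c + b')) cs) = mul a b c * \<phi> (map (\<lambda>(a,b). V (m + a) (n + b)) cs)"
    using coch_D(3)[OF \<phi> s[of m n] l] by (simp only:)
qed

definition eH :: "(pt list \<Rightarrow> rf) \<Rightarrow> int \<Rightarrow> int \<Rightarrow> rf" where "eH \<phi> m n = \<phi> [V m n, V (m + 1) n]"
definition eK :: "(pt list \<Rightarrow> rf) \<Rightarrow> int \<Rightarrow> int \<Rightarrow> rf" where "eK \<phi> m n = \<phi> [V m n, V m (n + 1)]"
definition eD :: "(pt list \<Rightarrow> rf) \<Rightarrow> int \<Rightarrow> int \<Rightarrow> rf" where "eD \<phi> m n = \<phi> [V m n, V (m + 1) (n + 1)]"
definition tU :: "(pt list \<Rightarrow> rf) \<Rightarrow> int \<Rightarrow> int \<Rightarrow> rf" where "tU \<phi> m n = \<phi> [V m n, V (m + 1) n, V (m + 1) (n + 1)]"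
definition tD :: "(pt list \<Rightarrow> rf) \<Rightarrow> int \<Rightarrow> int \<Rightarrow> rf" where "tD \<phi> m n = \<phi> [V m n, V m (n + 1), V (m + 1) (n + 1)]"

lemma eqv_edges:
  assumes "\<phi> \<in> cochains \<chi> 1" shows "eqv (eH \<phi>)" "eqv (eK \<phi>)" "eqv (eD \<phi>)"
  using coch_eqv[OF assms, of "[(0,0),(1,0)]"] coch_eqv[OF assms, of "[(0,0),(0,1)]"] coch_eqv[OF assms, of "[(0,0),(1,1)]"]
  by (simp_all add: edge_simplex eH_def[abs_def] eK_def[abs_def] eD_def[abs_def])

lemma eqv_tris:
  assumes "\<phi> \<in> cochains \<chi> 2" shows "eqv (tU \<phi>)" "eqv (tD \<phi>)"
  using coch_eqv[OF assms, of "[(0,0),(1,0),(1,1)]"] coch_eqv[OF assms, of "[(0,0),(0,1),(1,1)]"]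
  by (simp_all add: up_simplex dn_simplex tU_def[abs_def] tD_def[abs_def])

lemma mk0_cochain: assumes "eqv g" shows "mk0 g \<in> cochains \<chi> 0"
  unfolding cochains_def mem_Collect_eq
proof (intro conjI allI impI ballI)
  show "mk0 g xs = 0" if "xs \<notin> simplices 0" for xs using that by (simp add: mk0_def)
  fix xs assume xs: "xs \<in> simplices 0"
  then obtain m n where e: "xs = [V m n]" unfolding simplices_0 by blast
  show "mk0 g xs \<in> R" using xs eqv_R[OF assms] by (simp add: mk0_def)
  show "mk0 g (permute_list \<pi> xs) = of_int (sign \<pi>) * mk0 g xs" if p: "\<pi> permutes {..<Suc 0}" for \<pi>
  proof -
    have "\<pi> 0 = 0" using permutes_in_image[OF p, of 0] by simp
    then have "\<pi> x = id x" for x using permutes_not_in[OF p, of x] by (cases "x = 0") auto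
    then have "\<pi> = id" by blast
    then show ?thesis by (simp add: sign_id)
  qed
  show "mk0 g (map (transl l) xs) = Fmon \<chi> l * mk0 g xs" if l: "l \<in> Lambda" for l
  proof -
    have "cmp l 1 + cmp l 2 + cmp l 3 = 0" using l by (simp add: Lambda_def)
    from eqv_shift[OF assms this, of m n] show ?thesis
      by (simp add: e transl_V[OF l] mk0_def simplices_0 Fmon_def mul_def)
  qed
qed

lemma mk1_cochain: assumes H: "eqv H" and K: "eqv K" and D: "eqv D" shows "mk1 H K D \<in> cochains \<chi> 1"
  unfolding cochains_def mem_Collect_eq
proof (intro conjI allI impI ballI)
  show "mk1 H K D xs = 0" if "xs \<notin> simplices 1" for xs using that by (simp add: mk1_def)
  fix xs assume xs: "xs \<in> simplices 1"
  then obtain m n m' n' where e: "xs = [V m n, V m' n']" and d: "(m' - m, n' - n) \<in> dirs" unfolding simplices_1 by blast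
  have sw: "[V m' n', V m n] \<in> simplices 1" using simplices_1_swap xs unfolding e by blast
  show "mk1 H K D xs \<in> R" using xs
    by (simp add: mk1_def edge_def eqv_R[OF H] eqv_R[OF K] eqv_R[OF D] R_uminus)
  show "mk1 H K D (permute_list \<pi> xs) = of_int (sign \<pi>) * mk1 H K D xs" if p: "\<pi> permutes {..<Suc 1}" for \<pi>
    using permutes_Suc_1[OF p]
  proof
    assume "\<pi> = id" then show ?thesis by (simp add: sign_id)
  next
    assume t: "\<pi> = transpose 0 1"
    have "permute_list \<pi> xs = [V m' n', V m n]" by (simp add: e permute_list_2 t transpose_def nth_2)
    moreover have "sign \<pi> = - 1" unfolding t by (rule sign_transpose) simp
    ultimately show ?thesis using xs sw edge_swap[OF d, of H K D] unfolding e by (simp add: mk1_def nth_2)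
  qed
  show "mk1 H K D (map (transl l) xs) = Fmon \<chi> l * mk1 H K D xs" if l: "l \<in> Lambda" for l
  proof -
    have s: "cmp l 1 + cmp l 2 + cmp l 3 = 0" using l by (simp add: Lambda_def)
    have F: "Fmon \<chi> l = mul (cmp l 1) (cmp l 2) (cmp l 3)" by (simp add: Fmon_def mul_def)
    have m: "map (transl l) xs = [V (m + cmp l 1 - cmp l 3) (n + cmp l 2 - cmp l 3), V (m' + cmp l 1 - cmp l 3) (n' + cmp l 2 - cmp l 3)]"
      by (simp add: e transl_V[OF l])
    have df: "m' + cmp l 1 - cmp l 3 - (m + cmp l 1 - cmp l 3) = m' - m" "n' + cmp l 2 - cmp l 3 - (n + cmp l 2 - cmp l 3) = n' - n"
      by simp_all
    have "map (transl l) xs \<in> simplices 1" unfolding m simplices_1_list df by (rule d)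
    then have "mk1 H K D (map (transl l) xs) = edge H K D (m + cmp l 1 - cmp l 3) (n + cmp l 2 - cmp l 3) (m' + cmp l 1 - cmp l 3) (n' + cmp l 2 - cmp l 3)"
      unfolding m mk1_def by (simp add: nth_2)
    also have "\<dots> = Fmon \<chi> l * edge H K D m n m' n'"
      unfolding edge_def df eqv_shift[OF H s] eqv_shift[OF K s] eqv_shift[OF D s] F by simp
    also have "edge H K D m n m' n' = mk1 H K D xs" using xs unfolding e mk1_def by (simp add: nth_2)
    finally show ?thesis .
  qed
qed

lemma mk2_cochain: assumes U: "eqv U" shows "mk2 U \<in> cochains \<chi> 2"
  unfolding cochains_def mem_Collect_eq
proof (intro conjI allI impI ballI)
  show "mk2 U xs = 0" if "xs \<notin> simplices 2" for xs using that by (simp add: mk2_def)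
  fix xs assume xs: "xs \<in> simplices 2"
  then obtain m n m' n' m'' n'' where e: "xs = [V m n, V m' n', V m'' n'']"
    and d: "(m' - m, n' - n) \<in> dirs" "(m'' - m, n'' - n) \<in> dirs" "(m'' - m', n'' - n') \<in> dirs" unfolding simplices_2 by blast
  have Ri: "of_int k \<in> R" for k
    by (cases k rule: int_cases2) (simp_all add: R_of_RQ RQ_of_nat R_uminus)
  show "mk2 U xs \<in> R" using xs eqv_R[OF U] R_0 Ri unfolding mk2_def tri_def by (simp add: R_mult R_diff)
  show "mk2 U (permute_list \<pi> xs) = of_int (sign \<pi>) * mk2 U xs" if "\<pi> permutes {..<Suc 2}" for \<pi>
    by (rule swap3_alternating[OF swap3_mk2 xs that])
  show "mk2 U (map (transl l) xs) = Fmon \<chi> l * mk2 U xs" if l: "l \<in> Lambda" for l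
  proof -
    define s where "s = cmp l 1 - cmp l 3"
    define t where "t = cmp l 2 - cmp l 3"
    have z: "cmp l 1 + cmp l 2 + cmp l 3 = 0" using l by (simp add: Lambda_def)
    have m: "map (transl l) xs = [V (m + s) (n + t), V (m' + s) (n' + t), V (m'' + s) (n'' + t)]"
      by (simp add: e transl_V[OF l] s_def t_def algebra_simps)
    have df: "x + y - (x' + y) = x - x'" for x x' y :: int by simp
    have "map (transl l) xs \<in> simplices 2" unfolding m simplices_2_list df using d by simp
    then have "mk2 U (map (transl l) xs) = tri U (m + s) (n + t) (m' + s) (n' + t) (m'' + s) (n'' + t)"
      unfolding m mk2_def by (simp add: nth_3)
    also have "\<dots> = Fmon \<chi> l * tri U m n m' n' m'' n''"
    proof -
      have c: "m + s + (m' + s) + (m'' + s) = (m + m' + m'') + 3 * s"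
        "m + s + (m' + s) + (m'' + s) - 2 = (m + m' + m'' - 2) + 3 * s"
        "n + t + (n' + t) + (n'' + t) - 1 = (n + n' + n'' - 1) + 3 * t" by simp_all
      have dv: "(x + 3 * y) div 3 = x div 3 + y" "(x + 3 * y) mod 3 = x mod 3" for x y :: int by simp_all
      have F: "Fmon \<chi> l = mul (cmp l 1) (cmp l 2) (cmp l 3)" by (simp add: Fmon_def mul_def)
      have "U (p + s) (q + t) = Fmon \<chi> l * U p q" for p q
        using eqv_shift[OF U z, of p q] unfolding F s_def t_def by (simp add: algebra_simps)
      then show ?thesis unfolding tri_def c(2,3) unfolding c(1) dv df by simp
    qed
    also have "tri U m n m' n' m'' n'' = mk2 U xs" using xs unfolding e mk2_def by (simp add: nth_3)
    finally show ?thesis .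
  qed
qed

end

section \<open>Cohomology degree by degree\<close>

context chi_data
begin

lemma zero_cochain: "(\<lambda>_. 0) \<in> cochains \<chi> k"
  by (simp add: cochains_def R_0)

lemma mk0_V: "mk0 g [V m n] = g m n"
  by (simp add: mk0_def simplices_0)

lemma mk1_edges: "eH (mk1 H K D) m n = H m n" "eK (mk1 H K D) m n = K m n" "eD (mk1 H K D) m n = D m n"
  by (simp_all add: eH_def eK_def eD_def mk1_def edge_simplex edge_def nth_2)

lemma mk2_tris: "tU (mk2 U) m n = U m n" "tD (mk2 U) m n = 0"
proof -
  have e: "(m + (m + 1) + (m + 1)) mod 3 = 2" "(m + (m + 1) + (m + 1) - 2) div 3 = m" "(n + n + (n + 1) - 1) div 3 = n"
    "(m + m + (m + 1)) mod 3 = 1"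
    by presburger+
  show "tU (mk2 U) m n = U m n"
    unfolding tU_def mk2_def tri_def nth_3 cm_V cn_V by (simp only: e up_simplex if_True) simp
  show "tD (mk2 U) m n = 0"
    unfolding tD_def mk2_def tri_def nth_3 cm_V cn_V by (simp only: e dn_simplex if_True) simp
qed

lemma cobd_0_off: "xs \<notin> simplices 1 \<Longrightarrow> cobd 0 \<psi> xs = 0"
  by (simp add: cobd_def One_nat_def)

lemma cobd_1_off: "xs \<notin> simplices 2 \<Longrightarrow> cobd 1 \<psi> xs = 0"
  by (simp add: cobd_def One_nat_def numeral_2_eq_2)

lemma tris_cobd:
  "tU (cobd 1 \<psi>) m n = eK \<psi> (m + 1) n - eD \<psi> m n + eH \<psi> m n"
  "tD (cobd 1 \<psi>) m n = eH \<psi> m (n + 1) - eD \<psi> m n + eK \<psi> m n"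
  unfolding tU_def tD_def eH_def eK_def eD_def by (rule cobd_1[OF up_simplex] cobd_1[OF dn_simplex])+

lemma swap3_cobd: assumes \<psi>: "\<psi> \<in> cochains \<chi> 1" shows "swap3 (cobd 1 \<psi>)"
  unfolding swap3_def
proof (intro allI impI)
  fix x y z assume s: "[x,y,z] \<in> simplices 2"
  note f = simplices_2_face[OF s]
  show "cobd 1 \<psi> [y,x,z] = - cobd 1 \<psi> [x,y,z] \<and> cobd 1 \<psi> [x,z,y] = - cobd 1 \<psi> [x,y,z]"
    unfolding cobd_1[OF s] cobd_1[OF simplices_2_swap(1)[OF s]] cobd_1[OF simplices_2_swap(2)[OF s]]
      coch_swap2[OF \<psi> f(3)] coch_swap2[OF \<psi> f(1)] by simp
qed

lemma ext_0: "ext b 0 0 = b 0" "ext b 0 1 = b 1" "ext b 0 2 = b 2"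
  by (simp_all add: ext_def)

text \<open>A cocycle is constant along edges, while (1, n) and (0, n + 1) are related by the factor
  \<open>u\<close>, which is not 1 in a field.\<close>

lemma degree_0:
  assumes "\<phi> \<in> cocycles \<chi> 0" shows "\<phi> = (\<lambda>_. 0)"
proof -
  have c: "\<phi> \<in> cochains \<chi> 0" and z: "cobd 0 \<phi> = (\<lambda>_. 0)" using assms by (simp_all add: cocycles_def)
  define g where "g m n = \<phi> [V m n]" for m n
  have G: "eqv g" using coch_eqv[OF c, of "[(0,0)]"] by (simp add: g_def[abs_def] simplices_0)
  have e: "g m' n' = g m n" if "[V m n, V m' n'] \<in> simplices 1" for m n m' n'
    using cobd_0[OF that, of \<phi>] fun_cong[OF z, of "[V m n, V m' n']"] by (simp add: g_def)
  have z0: "g 0 (n + 1) = 0" for n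
  proof -
    have "g 1 (n + 1) = g 0 (n + 1)" using e[OF edge_simplex(1), of 0 "n + 1"] by simp
    moreover have "g 1 (n + 1) = g 1 n" using e[OF edge_simplex(2), of 1 n] by simp
    ultimately have "(u - 1) * g 0 (n + 1) = 0" using eqv_1[OF G, of n] by (simp add: left_diff_distrib)
    then show ?thesis using u_ne_1 by simp
  qed
  have "g 0 n = 0" for n using z0[of "n - 1"] by simp
  then have "g m n = 0" for m n using eqv_eq_ext[OF G, of m n] by (simp add: ext_def)
  then have "\<phi> xs = 0" for xs
    using coch_D(1)[OF c, of xs] unfolding simplices_0 g_def by blast
  then show ?thesis by blast
qed

lemma degree_ge_3:
  assumes "\<phi> \<in> cocycles \<chi> k" "k \<ge> 3" shows "\<phi> \<in> coboundaries \<chi> k"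
proof -
  have c: "\<phi> \<in> cochains \<chi> k" using assms by (simp add: cocycles_def)
  have "\<phi> xs = 0" for xs by (rule coch_D(1)[OF c]) (simp add: simplices_ge_3[OF assms(2)])
  then have "\<phi> = cobd (k - 1) (\<lambda>_. 0)" by (simp add: cobd_def fun_eq_iff)
  then show ?thesis using zero_cochain assms(2) unfolding coboundaries_def by auto
qed

text \<open>Exactness in the middle of the Koszul complex of \<open>u - 1\<close> and \<open>w - 1\<close>.\<close>

lemma coprime_uw:
  assumes x: "x \<in> R" and y: "y \<in> R" and eq: "(u - 1) * x = (w - 1) * y"
  obtains g where "g \<in> R" "x = (w - 1) * g" "y = (u - 1) * g"
proof -
  \<comment> \<open>With \<open>y\<close> divided by the unit f1 f3, the relation can be rewritten
    in the differences f1 - f2 and f2 - f3, to which \<open>coprime_R\<close> applies.\<close>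
  define c where "c = inverse f1 * inverse f3 * y"
  have yc: "y = f1 * f3 * c"
  proof -
    have "f1 * f3 * c = (f1 * inverse f1) * (f3 * inverse f3) * y" unfolding c_def by (simp only: mult_ac)
    then show ?thesis by simp
  qed
  have cR: "c \<in> R" unfolding c_def by (intro R_mult inv_R y)
  have "x * (f1 - f2) = f2 * ((u - 1) * x)" unfolding u_minus_1[symmetric] by (simp only: mult_ac)
  also have "\<dots> = f2 * c * (f1 * f3 * (w - 1))" unfolding eq yc by (simp only: mult_ac)
  finally have 1: "x * (f1 - f2) = f2 * c * (f2 * (f2 - f3) - f3 * (f1 - f2))" unfolding w_minus_1 .
  have gen: "F2 * c * (F2 * E - F3 * D) + F2 * F3 * c * D = F2 * F2 * c * E" for F2 F3 D E :: rf
    by (simp add: algebra_simps)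
  have 2: "(x + f2 * f3 * c) * (f1 - f2) = (f2 * f2 * c) * (f2 - f3)"
    unfolding distrib_right 1 by (rule gen)
  obtain \<gamma> where \<gamma>: "\<gamma> \<in> R" "x + f2 * f3 * c = \<gamma> * (f2 - f3)" "f2 * f2 * c = \<gamma> * (f1 - f2)"
    by (rule coprime_R[OF _ _ 2]) (intro R_add R_mult x cR R_Fval)+
  \<comment> \<open>The unit factor compensates for the change of generators from the differences
    back to \<open>u - 1\<close> and \<open>w - 1\<close>.\<close>
  define g where "g = \<gamma> * f1 * f3 * inverse f2"
  have gR: "g \<in> R" unfolding g_def by (intro R_mult \<gamma>(1) R_Fval inv_R)
  have fg: "f2 * g = \<gamma> * f1 * f3" by (simp add: g_def)
  have gen2: "F2 * x = F2 * (x + F2 * F3 * c) - F3 * (F2 * F2 * c)" for F2 F3 :: rf by (simp add: algebra_simps)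
  have gen3: "F2 * (\<gamma> * E) - F3 * (\<gamma> * D) = \<gamma> * (F2 * E - F3 * D)" for F2 F3 D E :: rf by (simp add: algebra_simps)
  have "f2 * x = f2 * (x + f2 * f3 * c) - f3 * (f2 * f2 * c)" by (rule gen2)
  also have "\<dots> = \<gamma> * (f2 * (f2 - f3) - f3 * (f1 - f2))" unfolding \<gamma>(2,3) by (rule gen3)
  also have "\<dots> = f2 * g * (w - 1)" unfolding w_minus_1[symmetric] fg by (simp only: mult.assoc)
  finally have "f2 * x = f2 * ((w - 1) * g)" by (simp only: mult_ac)
  then have xg: "x = (w - 1) * g" by (rule iffD1[OF mult_left_cancel[OF f_nz(2)]])
  have yy: "(w - 1) * y = (w - 1) * ((u - 1) * g)" unfolding eq[symmetric] xg by (simp only: mult_ac)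
  have nz: "w - 1 \<noteq> 0" using w_ne_1 by simp
  have "y = (u - 1) * g" by (rule iffD1[OF mult_left_cancel[OF nz] yy])
  then show ?thesis using that gR xg by blast
qed

text \<open>A potential with value g0 at the base vertex is determined by \<open>K\<close> along the
  column of (0, 0). Three vertical steps must multiply it by \<open>w\<close>, and the first
  horizontal edge must have the prescribed value; this asks that
  \<open>k0 + k1 + k2 = (w - 1) * g0\<close> and \<open>h0 - u * k0 = (u - 1) * g0\<close>. The
  cocycle condition makes the two compatible, and \<open>coprime_uw\<close> solves them.\<close>

lemma degree_1:
  assumes "\<phi> \<in> cocycles \<chi> 1" shows "\<phi> \<in> coboundaries \<chi> 1"
proof -
  have c: "\<phi> \<in> cochains \<chi> 1" and z: "cobd 1 \<phi> = (\<lambda>_. 0)" using assms by (simp_all add: cocycles_def)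
  define H where "H = eH \<phi>"
  define K where "K = eK \<phi>"
  define D where "D = eD \<phi>"
  note E = eqv_edges[OF c, folded H_def K_def D_def]
  have up: "K (m + 1) n - D m n + H m n = 0" and dn: "H m (n + 1) - D m n + K m n = 0" for m n
    using tris_cobd[of \<phi> m n] unfolding z by (simp_all add: tU_def tD_def H_def K_def D_def)
  have rel: "K (m + 1) n + H m n = H m (n + 1) + K m n" for m n
  proof -
    have "K (m + 1) n + H m n = (K (m + 1) n - D m n + H m n) + D m n" by simp
    also have "\<dots> = (H m (n + 1) - D m n + K m n) + D m n" by (simp only: up dn)
    finally show ?thesis by simp
  qed
  have rel0: "u * K 0 (n + 1) + H 0 n = H 0 (n + 1) + K 0 n" for n
    using rel[of 0 n] eqv_1[OF E(2), of n] by simp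
  define k0 k1 k2 h0 h1 h2 where kh: "k0 = K 0 0" "k1 = K 0 1" "k2 = K 0 2" "h0 = H 0 0" "h1 = H 0 1" "h2 = H 0 2"
  have r: "u * k1 + h0 = h1 + k0" "u * k2 + h1 = h2 + k1" "u * (w * k0) + h2 = w * h0 + k2"
    using rel0[of 0] rel0[of 1] rel0[of 2] eqv_3[OF E(2), of 0 0] eqv_3[OF E(1), of 0 0] by (simp_all add: kh)
  have hh: "h1 = u * k1 + h0 - k0" "h2 = u * k2 + (u * k1 + h0 - k0) - k1"
    using r(1,2) by (simp_all add: algebra_simps)
  have r3: "u * (w * k0) + (u * k2 + (u * k1 + h0 - k0) - k1) = w * h0 + k2" using r(3) unfolding hh .
  have gen: "(u - 1) * (k0 + k1 + k2) - (w - 1) * (h0 - u * k0) =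
      (u * (w * k0) + (u * k2 + (u * k1 + h0 - k0) - k1)) - (w * h0 + k2)"
    by (simp add: algebra_simps)
  \<comment> \<open>The three cocycle relations on the representatives, with \<open>h1\<close> and
    \<open>h2\<close> eliminated: the closing condition around the fundamental domain.\<close>
  have eq: "(u - 1) * (k0 + k1 + k2) = (w - 1) * (h0 - u * k0)"
    using gen unfolding r3 by simp
  have KR: "k0 \<in> R" "k1 \<in> R" "k2 \<in> R" "h0 \<in> R" unfolding kh by (rule eqv_R[OF E(2)] eqv_R[OF E(1)])+
  obtain g0 where g0: "g0 \<in> R" "k0 + k1 + k2 = (w - 1) * g0" "h0 - u * k0 = (u - 1) * g0"
    by (rule coprime_uw[OF _ _ eq]) (intro R_add R_diff R_mult KR u_R)+
  \<comment> \<open>The potential at the three representatives, accumulated from the vertical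
    edges.\<close>
  define b where "b j = (if j = 0 then g0 else if j = 1 then g0 + k0 else g0 + k0 + k1)" for j :: int
  define g where "g = ext b"
  have G: "eqv g" unfolding g_def by (rule eqv_ext) (simp add: b_def R_add KR g0(1))
  have g012: "g 0 0 = g0" "g 0 1 = g0 + k0" "g 0 2 = g0 + k0 + k1" by (simp_all add: g_def ext_0 b_def)
  have g3: "g 0 3 = w * g0" using eqv_3[OF G, of 0 0] by (simp add: g012)
  have KG: "eqv (\<lambda>m n. g m (n + 1) - g m n)" using eqv_diff[OF eqv_translate[OF G, of 0 1] G] by simp
  have HG: "eqv (\<lambda>m n. g (m + 1) n - g m n)" using eqv_diff[OF eqv_translate[OF G, of 1 0] G] by simp
  have k2: "k2 = w * g0 - (g0 + k0 + k1)"
  proof -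
    have "k2 = (k0 + k1 + k2) - (k0 + k1)" by simp
    then show ?thesis unfolding g0(2) by (simp add: algebra_simps)
  qed
  have Kg: "K m n = g m (n + 1) - g m n" for m n
    by (rule eqv_unique[OF E(2) KG]) (simp_all add: kh[symmetric] g012 g3 k2)
  have h0: "H 0 0 = u * g 0 (0 + 1) - g 0 0"
  proof -
    have "h0 = (h0 - u * k0) + u * k0" by simp
    then show ?thesis unfolding g0(3) by (simp add: kh(4)[symmetric] g012 algebra_simps)
  qed
  \<comment> \<open>The cocycle relation propagates the correct horizontal value up the column, so
    that \<open>h0\<close> is the only one to be arranged.\<close>
  have Hs: "H 0 (j + 1) = u * g 0 (j + 1 + 1) - g 0 (j + 1)" if "H 0 j = u * g 0 (j + 1) - g 0 j" for j
  proof -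
    have "H 0 (j + 1) = (u * K 0 (j + 1) + H 0 j) - K 0 j" unfolding rel0 by simp
    then show ?thesis unfolding that Kg by (simp add: algebra_simps)
  qed
  have h1: "H 0 1 = u * g 0 (1 + 1) - g 0 1" using Hs[OF h0] by simp
  have h2: "H 0 2 = u * g 0 (2 + 1) - g 0 2" using Hs[OF h1] by simp
  have Hg: "H m n = g (m + 1) n - g m n" for m n
    by (rule eqv_unique[OF E(1) HG]) (simp_all only: add_0 eqv_1[OF G] h0 h1 h2)
  have Dg: "D m n = g (m + 1) (n + 1) - g m n" for m n
  proof -
    have "D m n = (K (m + 1) n - (K (m + 1) n - D m n + H m n)) + H m n" by simp
    then show ?thesis unfolding up unfolding Kg Hg by simp
  qed
  have pos: "\<phi> [V m n, V m' n'] = g m' n' - g m n" if "(m' - m, n' - n) \<in> {(1,0),(0,1),(1,1)}" for m n m' n'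
  proof -
    have "m' = m + 1 \<and> n' = n \<or> m' = m \<and> n' = n + 1 \<or> m' = m + 1 \<and> n' = n + 1" using that by auto
    then show ?thesis
      by (elim disjE conjE) (simp_all only: Hg[unfolded H_def eH_def] Kg[unfolded K_def eK_def] Dg[unfolded D_def eD_def])
  qed
  have "\<phi> xs = cobd 0 (mk0 g) xs" for xs
  proof (cases "xs \<in> simplices 1")
    case False then show ?thesis by (simp add: coch_D(1)[OF c] cobd_0_off)
  next
    case True
    then obtain m n m' n' where e: "xs = [V m n, V m' n']" and d: "(m' - m, n' - n) \<in> dirs" unfolding simplices_1 by blast
    note s = True[unfolded e]
    have "\<phi> [V m n, V m' n'] = g m' n' - g m n"
    proof (cases "(m' - m, n' - n) \<in> {(1,0),(0,1),(1,1)}")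
      case True then show ?thesis by (rule pos)
    next
      case False
      then have "(m - m', n - n') \<in> {(1,0),(0,1),(1,1)}" using d unfolding dirs_def by (elim insertE emptyE) simp_all
      then show ?thesis using pos[of m m' n n'] coch_swap2[OF c s] by simp
    qed
    then show ?thesis unfolding e cobd_0[OF s] mk0_V .
  qed
  then have "\<phi> = cobd 0 (mk0 g)" by blast
  then show ?thesis using mk0_cochain[OF G] unfolding coboundaries_def by (simp add: One_nat_def)
qed

text \<open>The standard vertex orders of \<open>tU\<close> and \<open>tD\<close> have opposite
  orientations, so the difference is the value on the consistently oriented fundamental
  domain.\<close>

definition Phi :: "(pt list \<Rightarrow> rf) \<Rightarrow> rf" where
  "Phi \<phi> = (tU \<phi> 0 0 + tU \<phi> 0 1 + tU \<phi> 0 2) - (tD \<phi> 0 0 + tD \<phi> 0 1 + tD \<phi> 0 2)"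

lemma Phi_R: "\<phi> \<in> cochains \<chi> 2 \<Longrightarrow> Phi \<phi> \<in> R"
  unfolding Phi_def tU_def tD_def by (intro R_diff R_add coch_R)

lemma Phi_linear: "Phi (\<lambda>xs. a * \<phi> xs + \<psi> xs) = a * Phi \<phi> + Phi \<psi>"
  unfolding Phi_def tU_def tD_def by (simp add: algebra_simps)

text \<open>Diagonal edges cancel within a square and horizontal ones telescope up the column;
  opposite sides of the fundamental domain differ by the factors \<open>u\<close> and
  \<open>w\<close>.\<close>

lemma Phi_cobd: assumes "\<psi> \<in> cochains \<chi> 1" shows "Phi (cobd 1 \<psi>) \<in> I"
proof -
  note E = eqv_edges[OF assms]
  have e: "eK \<psi> 1 0 = u * eK \<psi> 0 1" "eK \<psi> 1 1 = u * eK \<psi> 0 2" "eK \<psi> 1 2 = u * (w * eK \<psi> 0 0)"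
    "eH \<psi> 0 3 = w * eH \<psi> 0 0"
    using eqv_1[OF E(2), of 0] eqv_1[OF E(2), of 1] eqv_1[OF E(2), of 2] eqv_3[OF E(2), of 0 0] eqv_3[OF E(1), of 0 0]
    by simp_all
  have "Phi (cobd 1 \<psi>) = (eK \<psi> 0 0 + eK \<psi> 0 1 + eK \<psi> 0 2) * (u - 1) + (u * eK \<psi> 0 0 - eH \<psi> 0 0) * (w - 1)"
    unfolding Phi_def tris_cobd by (simp add: e algebra_simps)
  also have "\<dots> \<in> I"
    by (intro I_add I_mult u_1_I w_1_I R_add R_diff R_mult u_R eqv_R[OF E(1)] eqv_R[OF E(2)])
  finally show ?thesis .
qed

text \<open>The formula in \<open>Phi_cobd\<close> is run backwards: once \<open>K\<close> and
  \<open>H 0 0\<close> are chosen, the other horizontal values are forced, and closing up after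
  three steps is exactly the assumption on \<open>Phi \<phi>\<close>.\<close>

lemma Phi_I_cobd:
  assumes \<phi>: "\<phi> \<in> cochains \<chi> 2" and i: "Phi \<phi> \<in> I"
  obtains \<psi> where "\<psi> \<in> cochains \<chi> 1" "\<phi> = cobd 1 \<psi>"
proof -
  define U where "U = tU \<phi>"
  define T where "T = tD \<phi>"
  note E = eqv_tris[OF \<phi>, folded U_def T_def]
  define X where "X m n = U m n - T m n" for m n
  have X: "eqv X" unfolding X_def[abs_def] by (rule eqv_diff[OF E])
  obtain \<alpha> \<beta> where ab: "\<alpha> \<in> R" "\<beta> \<in> R" "Phi \<phi> = (w - 1) * \<alpha> + (u - 1) * \<beta>" using I_elim[OF i] by blast
  have "Phi \<phi> = X 0 0 + X 0 1 + X 0 2" by (simp add: Phi_def X_def U_def T_def)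
  then have x2: "X 0 2 = (w - 1) * \<alpha> + (u - 1) * \<beta> - X 0 0 - X 0 1" unfolding ab(3) by simp
  \<comment> \<open>In \<open>Phi_cobd\<close> the coefficient of \<open>u - 1\<close> is the sum of
    the three values of \<open>K\<close>, and that of \<open>w - 1\<close> is
    \<open>u * K 0 0 - H 0 0\<close>. A single value \<open>\<beta>\<close> placed away from (0, 0),
    together with \<open>H 0 0 = - \<alpha>\<close>, realises both.\<close>
  define K where "K = ext (\<lambda>j. if j = 1 then \<beta> else 0)"
  have K: "eqv K" unfolding K_def by (rule eqv_ext) (simp add: ab R_0)
  define hb where "hb j = (if j = 0 then - \<alpha> else if j = 1 then - \<alpha> + u * \<beta> - X 0 0
    else - \<alpha> + u * \<beta> - X 0 0 - \<beta> - X 0 1)" for j :: int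
  define H where "H = ext hb"
  have H: "eqv H" unfolding H_def
    by (rule eqv_ext) (simp add: hb_def ab R_uminus R_add R_diff R_mult u_R eqv_R[OF X])
  have k: "K 0 0 = 0" "K 0 1 = \<beta>" "K 0 2 = 0" by (simp_all add: K_def ext_0)
  have k1: "K 1 0 = u * \<beta>" "K 1 1 = 0" "K 1 2 = 0"
    using eqv_1[OF K, of 0] eqv_1[OF K, of 1] eqv_1[OF K, of 2] eqv_3[OF K, of 0 0] by (simp_all add: k)
  have h: "H 0 0 = - \<alpha>" "H 0 1 = - \<alpha> + u * \<beta> - X 0 0" "H 0 2 = - \<alpha> + u * \<beta> - X 0 0 - \<beta> - X 0 1"
    by (simp_all add: H_def ext_0 hb_def)
  have h3: "H 0 3 = - (w * \<alpha>)" using eqv_3[OF H, of 0 0] by (simp add: h)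
  have HK: "H m (n + 1) = H m n + K (m + 1) n - K m n - X m n" for m n
  proof (rule eqv_unique[of "\<lambda>m n. H m (n + 1)" "\<lambda>m n. H m n + K (m + 1) n - K m n - X m n"])
    show "eqv (\<lambda>m n. H m (n + 1))" using eqv_translate[OF H, of 0 1] by simp
    have "eqv (\<lambda>m n. K (m + 1) n)" using eqv_translate[OF K, of 1 0] by simp
    then show "eqv (\<lambda>m n. H m n + K (m + 1) n - K m n - X m n)" by (intro eqv_diff eqv_add H K X)
    show "H 0 (0 + 1) = H 0 0 + K (0 + 1) 0 - K 0 0 - X 0 0" by (simp add: h k k1)
    show "H 0 (1 + 1) = H 0 1 + K (0 + 1) 1 - K 0 1 - X 0 1" by (simp add: h k k1)
    \<comment> \<open>The closing step: \<open>H 0 3\<close> is already fixed as \<open>w\<close>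
      times \<open>H 0 0\<close>, and the representation of \<open>Phi \<phi>\<close> enters through
      \<open>x2\<close>.\<close>
    show "H 0 (2 + 1) = H 0 2 + K (0 + 1) 2 - K 0 2 - X 0 2" by (simp add: h h3 k k1 x2 algebra_simps)
  qed
  \<comment> \<open>Solved from the upward triangles; \<open>HK\<close> is then what the downward
    triangles require.\<close>
  define D where "D m n = H m n + K (m + 1) n - U m n" for m n
  have "eqv (\<lambda>m n. K (m + 1) n)" using eqv_translate[OF K, of 1 0] by simp
  then have D: "eqv D" unfolding D_def[abs_def] by (intro eqv_diff eqv_add H E(1))
  define \<psi> where "\<psi> = mk1 H K D"
  have \<psi>: "\<psi> \<in> cochains \<chi> 1" unfolding \<psi>_def by (rule mk1_cochain[OF H K D])
  have tU: "tU \<phi> m n = tU (cobd 1 \<psi>) m n" for m n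
    by (simp add: tris_cobd \<psi>_def mk1_edges D_def U_def)
  have tD: "tD \<phi> m n = tD (cobd 1 \<psi>) m n" for m n
    by (simp add: tris_cobd \<psi>_def mk1_edges HK D_def X_def T_def)
  have "\<phi> xs = cobd 1 \<psi> xs" for xs
  proof (cases "xs \<in> simplices 2")
    case False then show ?thesis by (simp add: coch_D(1)[OF \<phi>] cobd_1_off)
  next
    case True
    show ?thesis
      by (rule swap3_agree[OF coch_swap3[OF \<phi>] swap3_cobd[OF \<psi>] tU[unfolded tU_def] tD[unfolded tD_def] True])
  qed
  then have "\<phi> = cobd 1 \<psi>" by blast
  then show ?thesis using that \<psi> by blast
qed

lemma cocycles_2: "cocycles \<chi> 2 = cochains \<chi> 2"
  by (auto simp: cocycles_def cobd_def simplices_ge_3)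

text \<open>A cochain concentrated on a single orbit of upward triangles attains any prescribed
  value.\<close>

lemma Phi_surj: assumes p: "p \<in> R" shows "\<exists>\<phi>\<in>cochains \<chi> 2. Phi \<phi> = p"
proof -
  define U where "U = ext (\<lambda>j. if j = 0 then p else 0)"
  have U: "eqv U" unfolding U_def by (rule eqv_ext) (simp add: p R_0)
  have "Phi (mk2 U) = p" by (simp add: Phi_def mk2_tris U_def ext_0)
  then show ?thesis using mk2_cochain[OF U] by blast
qed

section \<open>The Weyl group action in degree 2\<close>

lemma sg_RQ:
  assumes v: "v permutes {1,2,3}" and x: "x \<in> RQ" shows "sg v x \<in> RQ"
proof -
  obtain S c where S: "finite S" "x = (\<Sum>e\<in>S. scal (c e) * lmon e)" using RQ_E[OF x] by blast
  have "sg v x = (\<Sum>e\<in>S. scal (c e) * lmon (e \<circ> inv_into UNIV v))"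
    unfolding S(2) by (simp only: rhom_sum[OF rhom_sg[OF v]] rhom_mult[OF rhom_sg[OF v]] sg_scal[OF v] sg_lmon[OF v])
  also have "\<dots> \<in> RQ" by (intro RQ_sum RQ_mult RQ_scal RQ_lmon)
  finally show ?thesis .
qed

lemma sg_R:
  assumes v: "v permutes {1,2,3}" and x: "x \<in> R" shows "sg v x \<in> R"
proof -
  obtain n where "x * sF \<chi> ^ n \<in> RQ" using x unfolding RFQ_iff by blast
  from sg_RQ[OF v this] have "sg v x * sF \<chi> ^ n \<in> RQ"
    by (simp only: rhom_mult[OF rhom_sg[OF v]] rhom_power[OF rhom_sg[OF v]] sg_sF[OF v])
  then show ?thesis unfolding RFQ_iff by blast
qed

text \<open>The ideal contains all differences F(t_i) - F(t_j), so permuting the variables preserves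
  it.\<close>

lemma sg_I:
  assumes v: "v permutes {1,2,3}" and x: "x \<in> I" shows "sg v x \<in> I"
proof -
  obtain a b where ab: "a \<in> R" "b \<in> R" "x = a * (f2 - f1) + b * (f3 - f2)" using x unfolding Fideal_def by blast
  have i: "v 1 \<in> {1,2,3}" "v 2 \<in> {1,2,3}" "v 3 \<in> {1,2,3}" using permutes_in_image[OF v] by blast+
  have F: "sg v f1 = Fval \<chi> (v 1)" "sg v f2 = Fval \<chi> (v 2)" "sg v f3 = Fval \<chi> (v 3)"
    by (rule sg_Fval[OF v]; simp)+
  have "sg v x = sg v a * (Fval \<chi> (v 2) - Fval \<chi> (v 1)) + sg v b * (Fval \<chi> (v 3) - Fval \<chi> (v 2))"
    unfolding ab(3) by (simp only: rhom_mult[OF rhom_sg[OF v]] rhom_add[OF rhom_sg[OF v]] rhom_diff[OF rhom_sg[OF v]] F)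
  also have "\<dots> \<in> I" by (intro I_add I_mult sg_R[OF v] ab(1,2) I_Fval_diff i)
  finally show ?thesis .
qed

text \<open>A permutation of coordinates may carry a standard triangle to one whose vertices are
  listed in a cyclically rotated order; rotations do not change the value.\<close>

lemma tri_rot:
  assumes \<phi>: "\<phi> \<in> cochains \<chi> 2"
  shows "\<phi> [V (m + 1) n, V (m + 1) (n + 1), V m n] = tU \<phi> m n" "\<phi> [V (m + 1) (n + 1), V m n, V (m + 1) n] = tU \<phi> m n"
    "\<phi> [V m (n + 1), V (m + 1) (n + 1), V m n] = tD \<phi> m n" "\<phi> [V (m + 1) (n + 1), V m n, V m (n + 1)] = tD \<phi> m n"
  unfolding tU_def tD_def
  by (rule swap3_rot[OF coch_swap3[OF \<phi>] up_simplex] swap3_rot[OF coch_swap3[OF \<phi>] dn_simplex])+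

abbreviation "rots \<equiv> {(0,1,2),(1,2,0),(2,0,1)} :: (int \<times> int \<times> int) set"

text \<open>Even permutations carry upward triangles to upward ones. The functions \<open>a\<close>,
  \<open>b\<close>, \<open>c\<close>, \<open>d\<close> give the base vertices of the images, and
  modulo the ideal only their residues count.\<close>

lemma Phi_even:
  assumes \<phi>: "\<phi> \<in> cochains \<chi> 2"
    and U: "\<And>j. tU A 0 j = tU \<phi> (a j) (b j)" and D: "\<And>j. tD A 0 j = tD \<phi> (c j) (d j)"
    and "((a 0 + b 0) mod 3, (a 1 + b 1) mod 3, (a 2 + b 2) mod 3) \<in> rots"
    and "((c 0 + d 0) mod 3, (c 1 + d 1) mod 3, (c 2 + d 2) mod 3) \<in> rots"
  shows "Phi A - Phi \<phi> \<in> I"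
proof -
  have gen: "(x - y) - (x' - y') = (x - x') - (y - y')" for x y x' y' :: rf by simp
  show ?thesis unfolding Phi_def U D gen
    by (intro I_diff eqv_sum_mod_I eqv_tris[OF \<phi>] assms(4,5))
qed

text \<open>Reflections exchange upward and downward triangles, so the two sums in
  \<open>Phi\<close> change places and the sign is reversed.\<close>

lemma Phi_odd:
  assumes \<phi>: "\<phi> \<in> cochains \<chi> 2"
    and U: "\<And>j. tU A 0 j = tD \<phi> (a j) (b j)" and D: "\<And>j. tD A 0 j = tU \<phi> (c j) (d j)"
    and "((a 0 + b 0) mod 3, (a 1 + b 1) mod 3, (a 2 + b 2) mod 3) \<in> rots"
    and "((c 0 + d 0) mod 3, (c 1 + d 1) mod 3, (c 2 + d 2) mod 3) \<in> rots"
  shows "Phi A + Phi \<phi> \<in> I"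
proof -
  have gen: "(x - y) + (x' - y') = (x - y') - (y - x')" for x y x' y' :: rf by simp
  show ?thesis unfolding Phi_def U D gen
    by (intro I_diff eqv_sum_mod_I eqv_tris[OF \<phi>] assms(4,5))
qed

lemma wpt_V:
  assumes "v permutes {1,2,3}"
  shows "wpt (inv_into UNIV v) (V m n) = (cmp (V m n) (v 1), cmp (V m n) (v 2), cmp (V m n) (v 3))"
  by (simp only: wpt_def mkpt_eq permutes_inv_inv[OF assms])

text \<open>Each of the six permutations acts linearly on (m, n) and preserves m + n modulo 3, so
  the base vertices of the image triangles have residues j plus a constant. Every case reduces to
  \<open>Phi_even\<close> or \<open>Phi_odd\<close> once these vertices are found.\<close>

lemma Phi_perm:
  assumes \<phi>: "\<phi> \<in> cochains \<chi> 2" and v: "v permutes {1,2,3}"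
  shows "Phi (\<lambda>xs. \<phi> (map (wpt (inv_into UNIV v)) xs)) - of_int (sign v) * Phi \<phi> \<in> I"
proof -
  define A where "A xs = \<phi> (map (wpt (inv_into UNIV v)) xs)" for xs
  note r = tri_rot[OF \<phi>]
  note pv = wpt_V[OF v]
  have c: "- 1 - j = - j - 1" for j :: int by simp
  have t: "transpose a b a = b" "transpose a b b = a" "z \<noteq> a \<Longrightarrow> z \<noteq> b \<Longrightarrow> transpose a b z = z" for a b z :: nat
    by (simp_all add: transpose_def)
  consider "v = id" | "v = transpose 1 2" | "v = transpose 1 3" | "v = transpose 2 3"
    | "v = transpose 1 2 \<circ> transpose 2 3" | "v = transpose 2 3 \<circ> transpose 1 2"
    using permutes_3_cases[OF v] by auto
  then have "Phi A - of_int (sign v) * Phi \<phi> \<in> I"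
  proof cases
    case 1
    have p: "wpt (inv_into UNIV v) (V m n) = V m n" for m n unfolding pv unfolding 1 by (simp add: V_def)
    have "Phi A - Phi \<phi> \<in> I"
      by (rule Phi_even[OF \<phi>, of A "\<lambda>_. 0" "\<lambda>j. j" "\<lambda>_. 0" "\<lambda>j. j"]) (simp_all add: tU_def tD_def A_def p)
    then show ?thesis by (simp add: 1 sign_id)
  next
    case 2
    have s: "sign v = - 1" unfolding 2 by (rule sign_transpose) simp
    have p: "wpt (inv_into UNIV v) (V m n) = V n m" for m n unfolding pv unfolding 2 by (simp add: V_def t)
    have "Phi A + Phi \<phi> \<in> I"
      by (rule Phi_odd[OF \<phi>, of A "\<lambda>j. j" "\<lambda>_. 0" "\<lambda>j. j" "\<lambda>_. 0"]) (simp_all add: tU_def tD_def A_def p)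
    then show ?thesis by (simp add: s)
  next
    case 3
    have s: "sign v = - 1" unfolding 3 by (rule sign_transpose) simp
    have p: "wpt (inv_into UNIV v) (V m n) = V (- m) (n - m)" for m n unfolding pv unfolding 3 by (simp add: V_def t)
    have "tU A 0 j = tD \<phi> (- 1) (j - 1)" for j
      using r(4)[of "- 1" "j - 1"] by (simp add: tU_def A_def p algebra_simps)
    moreover have "tD A 0 j = tU \<phi> (- 1) j" for j
      using r(1)[of "- 1" j] by (simp add: tD_def A_def p algebra_simps)
    ultimately have "Phi A + Phi \<phi> \<in> I"
      by (rule Phi_odd[OF \<phi>, of A "\<lambda>_. - 1" "\<lambda>j. j - 1" "\<lambda>_. - 1" "\<lambda>j. j"]) simp_all
    then show ?thesis by (simp add: s)
  next
    case 4
    have s: "sign v = - 1" unfolding 4 by (rule sign_transpose) simp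
    have p: "wpt (inv_into UNIV v) (V m n) = V (m - n) (- n)" for m n unfolding pv unfolding 4 by (simp add: V_def t)
    have "tU A 0 j = tD \<phi> (- j) (- j - 1)" for j
      using r(3)[of "- j" "- j - 1"] by (simp add: tU_def A_def p algebra_simps c)
    moreover have "tD A 0 j = tU \<phi> (- j - 1) (- j - 1)" for j
      using r(2)[of "- j - 1" "- j - 1"] by (simp add: tD_def A_def p algebra_simps c)
    ultimately have "Phi A + Phi \<phi> \<in> I"
      by (rule Phi_odd[OF \<phi>, of A "\<lambda>j. - j" "\<lambda>j. - j - 1" "\<lambda>j. - j - 1" "\<lambda>j. - j - 1"]) simp_all
    then show ?thesis by (simp add: s)
  next
    case 5
    have s: "sign v = 1" unfolding 5 by (rule sign_transpose_comp) simp_all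
    have p: "wpt (inv_into UNIV v) (V m n) = V (n - m) (- m)" for m n unfolding pv unfolding 5 by (simp add: V_def t)
    have "tU A 0 j = tU \<phi> (j - 1) (- 1)" for j
      using r(2)[of "j - 1" "- 1"] by (simp add: tU_def A_def p algebra_simps)
    moreover have "tD A 0 j = tD \<phi> j (- 1)" for j
      using r(3)[of j "- 1"] by (simp add: tD_def A_def p algebra_simps)
    ultimately have "Phi A - Phi \<phi> \<in> I"
      by (rule Phi_even[OF \<phi>, of A "\<lambda>j. j - 1" "\<lambda>_. - 1" "\<lambda>j. j" "\<lambda>_. - 1"]) simp_all
    then show ?thesis by (simp add: s)
  next
    case 6
    have s: "sign v = 1" unfolding 6 by (rule sign_transpose_comp) simp_all
    have p: "wpt (inv_into UNIV v) (V m n) = V (- n) (m - n)" for m n unfolding pv unfolding 6 by (simp add: V_def t)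
    have "tU A 0 j = tU \<phi> (- j - 1) (- j)" for j
      using r(1)[of "- j - 1" "- j"] by (simp add: tU_def A_def p algebra_simps c)
    moreover have "tD A 0 j = tD \<phi> (- j - 1) (- j - 1)" for j
      using r(4)[of "- j - 1" "- j - 1"] by (simp add: tD_def A_def p algebra_simps c)
    ultimately have "Phi A - Phi \<phi> \<in> I"
      by (rule Phi_even[OF \<phi>, of A "\<lambda>j. - j - 1" "\<lambda>j. - j" "\<lambda>j. - j - 1" "\<lambda>j. - j - 1"]) simp_all
    then show ?thesis by (simp add: s)
  qed
  then show ?thesis unfolding A_def[abs_def] .
qed

text \<open>The action on cochains combines a permutation of simplices, treated in
  \<open>Phi_perm\<close>, with the ring homomorphism \<open>sg v\<close>, which commutes with the
  sums in \<open>Phi\<close> and preserves the ideal.\<close>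

lemma Phi_wcoch:
  assumes \<phi>: "\<phi> \<in> cochains \<chi> 2" and v: "v permutes {1,2,3}"
  shows "Phi (wcoch v \<chi> \<phi>) - of_int (sign v) * wact v \<chi> (Phi \<phi>) \<in> I"
proof -
  note h = rhom_add[OF rhom_sg[OF v]] rhom_diff[OF rhom_sg[OF v]] rhom_mult[OF rhom_sg[OF v]]
    rhom_1[OF rhom_sg[OF v]] rhom_minus[OF rhom_sg[OF v]]
  define A where "A xs = \<phi> (map (wpt (inv_into UNIV v)) xs)" for xs
  have wc: "wcoch v \<chi> \<phi> = (\<lambda>xs. sg v (A xs))"
    unfolding wcoch_def A_def by (intro ext wact_eq_sg[OF v] coch_R[OF \<phi>])
  have "sg v (of_int (sign v)) = of_int (sign v)" by (cases "evenperm v") (simp_all add: sign_def h)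
  then have "Phi (wcoch v \<chi> \<phi>) - of_int (sign v) * wact v \<chi> (Phi \<phi>) = sg v (Phi A - of_int (sign v) * Phi \<phi>)"
    unfolding wc wact_eq_sg[OF v Phi_R[OF \<phi>]] unfolding Phi_def tU_def tD_def h by simp
  also have "\<dots> \<in> I" by (rule sg_I[OF v]) (use Phi_perm[OF \<phi> v] in \<open>simp only: A_def[abs_def]\<close>)
  finally show ?thesis .
qed

lemma coboundaries_pred: "coboundaries \<chi> 2 = cobd 1 ` cochains \<chi> 1"
  by (simp add: coboundaries_def One_nat_def)

text \<open>The map goes into the ring itself. Being linear and onto, with the coboundaries as the
  exact preimage of the ideal, it induces the isomorphism of the quotients, and equivariance is
  accordingly a congruence modulo the ideal.\<close>

theorem alcove_cohomology:
  "(\<forall>k. k \<noteq> 2 \<longrightarrow> cocycles \<chi> k \<subseteq> coboundaries \<chi> k) \<and>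
    (\<exists>\<Phi>. (\<forall>\<phi>\<in>cocycles \<chi> 2. \<Phi> \<phi> \<in> RFQ \<chi>) \<and>
      (\<forall>\<phi>\<in>cocycles \<chi> 2. \<forall>\<psi>\<in>cocycles \<chi> 2. \<forall>a\<in>RFQ \<chi>.
          \<Phi> (\<lambda>xs. a * \<phi> xs + \<psi> xs) = a * \<Phi> \<phi> + \<Phi> \<psi>) \<and>
      (\<forall>\<phi>\<in>cocycles \<chi> 2. \<Phi> \<phi> \<in> Fideal \<chi> \<longleftrightarrow> \<phi> \<in> coboundaries \<chi> 2) \<and>
      (\<forall>p\<in>RFQ \<chi>. \<exists>\<phi>\<in>cocycles \<chi> 2. \<Phi> \<phi> = p) \<and>
      (\<forall>v. v permutes {1,2,3} \<longrightarrow> (\<forall>\<phi>\<in>cocycles \<chi> 2.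
          \<Phi> (wcoch v \<chi> \<phi>) - of_int (sign v) * wact v \<chi> (\<Phi> \<phi>) \<in> Fideal \<chi>)))"
proof (intro conjI exI[of _ Phi] allI impI ballI subsetI)
  fix k \<phi> assume k: "k \<noteq> 2" and c: "\<phi> \<in> cocycles \<chi> k"
  consider "k = 0" | "k = 1" | "k \<ge> 3" using k by linarith
  then show "\<phi> \<in> coboundaries \<chi> k"
  proof cases
    case 1 then show ?thesis using degree_0 c by (simp add: coboundaries_def)
  next
    case 2 then show ?thesis using degree_1 c by (simp only:)
  next
    case 3 then show ?thesis by (rule degree_ge_3[OF c])
  qed
next
  fix \<phi> assume "\<phi> \<in> cocycles \<chi> 2"
  then have c: "\<phi> \<in> cochains \<chi> 2" unfolding cocycles_2 .
  show "Phi \<phi> \<in> R" by (rule Phi_R[OF c])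
  show "Phi \<phi> \<in> I \<longleftrightarrow> \<phi> \<in> coboundaries \<chi> 2"
    unfolding coboundaries_pred using Phi_I_cobd[OF c] Phi_cobd by blast
  show "Phi (wcoch v \<chi> \<phi>) - of_int (sign v) * wact v \<chi> (Phi \<phi>) \<in> I" if "v permutes {1,2,3}" for v
    by (rule Phi_wcoch[OF c that])
next
  show "Phi (\<lambda>xs. a * \<phi> xs + \<psi> xs) = a * Phi \<phi> + Phi \<psi>" for a \<phi> \<psi> by (rule Phi_linear)
  show "\<exists>\<phi>\<in>cocycles \<chi> 2. Phi \<phi> = p" if "p \<in> R" for p unfolding cocycles_2 by (rule Phi_surj[OF that])
qed

end

theorem theorem5p10:
  fixes d :: "nat \<Rightarrow> nat" and Fm :: "complex mat \<Rightarrow> complex mat"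
    and tau :: "nat \<Rightarrow> nat \<Rightarrow> complex mat"
  assumes "exponential_functor d Fm tau"
    and "lpdeg (Fchar Fm) > 0"
  shows "(\<forall>k. k \<noteq> 2 \<longrightarrow> cocycles (Fchar Fm) k \<subseteq> coboundaries (Fchar Fm) k) \<and>
    (\<exists>\<Phi>. (\<forall>\<phi>\<in>cocycles (Fchar Fm) 2. \<Phi> \<phi> \<in> RFQ (Fchar Fm)) \<and>
      (\<forall>\<phi>\<in>cocycles (Fchar Fm) 2. \<forall>\<psi>\<in>cocycles (Fchar Fm) 2. \<forall>a\<in>RFQ (Fchar Fm).
          \<Phi> (\<lambda>xs. a * \<phi> xs + \<psi> xs) = a * \<Phi> \<phi> + \<Phi> \<psi>) \<and>
      (\<forall>\<phi>\<in>cocycles (Fchar Fm) 2. \<Phi> \<phi> \<in> Fideal (Fchar Fm) \<longleftrightarrow> \<phi> \<in> coboundaries (Fchar Fm) 2) \<and>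
      (\<forall>p\<in>RFQ (Fchar Fm). \<exists>\<phi>\<in>cocycles (Fchar Fm) 2. \<Phi> \<phi> = p) \<and>
      (\<forall>w. w permutes {1,2,3} \<longrightarrow> (\<forall>\<phi>\<in>cocycles (Fchar Fm) 2.
          \<Phi> (wcoch w (Fchar Fm) \<phi>) - of_int (sign w) * wact w (Fchar Fm) (\<Phi> \<phi>) \<in> Fideal (Fchar Fm))))"
proof -
  interpret expfun d Fm tau by (rule expfun.intro) (rule assms(1))
  define S where "S = {k. Fchar Fm k \<noteq> 0}"
  have S: "finite S" unfolding S_def by (rule finite_Fchar)
  have ne: "S \<noteq> {}" and pos: "Max S > 0" using assms(2) unfolding lpdeg_def S_def by (simp_all split: if_splits)
  \<comment> \<open>The top weight is the degree of F(t_1), positive by assumption; negativity of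
    the roots is where the exponential structure enters.\<close>
  have "chi_data (Fchar Fm) (Max S)"
  proof
    show "finite {k. Fchar Fm k \<noteq> 0}" by (rule finite_Fchar)
    show "Fchar Fm (Max S) \<noteq> 0" using Max_in[OF S ne] unfolding S_def by simp
    show "Max S > 0" by (rule pos)
    show "k \<le> Max S" if "Fchar Fm k \<noteq> 0" for k by (rule Max_ge[OF S]) (use that in \<open>simp add: S_def\<close>)
    show "Im \<rho> = 0 \<and> Re \<rho> < 0" if "lpoly (Fchar Fm) \<rho> = 0" "\<rho> \<noteq> 0" for \<rho>
      by (rule roots_negative[OF finite_Fchar ne[unfolded S_def] f_Fchar that])
  qed
  then show ?thesis by (rule chi_data.alcove_cohomology)
qed

end
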